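(* Let $K$ be a field and let $\mathcal{C}$ be a uniform admissible unmixed clutter with $\operatorname{ht} I(\mathcal{C}) = 3$. Then the Alexander dual $I(\mathcal{C})^\vee$ of $I(\mathcal{C})$ has linear quotients, and so $\mathcal{C}$ is a Cohen-Macaulay clutter.
   Context: A clutter $\mathcal{C}$ consists of a finite vertex set $V(\mathcal{C})=\{x_1,\dots,x_n\}$ and a family $E(\mathcal{C})$ of nonempty subsets of $V(\mathcal{C})$ (edges), none of which properly contains another. It is uniform if all edges have the same cardinality. Let $K$ be a field, identify the vertices with the variables of $R=K[x_1,\dots,x_n]$, and let $I(\mathcal{C})=\langle \prod_{x_i\in e}x_i \mid e\in E(\mathcal{C})\rangle\subset R$ be the edge ideal. $\mathcal{C}$ is Cohen-Macaulay if $R/I(\mathcal{C})$ is a Cohen-Macaulay ring. A vertex cover is a subset $C\subseteq V(\mathcal{C})$ meeting every edge; it is minimal if no proper subset is a vertex cover. $\operatorname{ht} I(\mathcal{C})$ equals the smallest cardinality of a minimal vertex cover. $\mathcal{C}$ is unmixed if all its minimal vertex covers have the same cardinality. The Alexander dual of $I(\mathcal{C})$ is $I(\mathcal{C})^\vee=\langle \prod_{x_i\in C}x_i \mid C \text{ a minimal vertex cover of }\mathcal{C}\rangle$. Admissible: let $g=\operatorname{ht} I(\mathcal{C})$. Suppose that for some positive integer $d$ there are two partitions $\{X^1,\dots,X^d\}$ and $\{e_1,\dots,e_g\}$ of $V(\mathcal{C})$ with $|e_i\cap X^j|\le 1$ for all $i,j$. A subset $e\subseteq V(\mathcal{C})$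 of size $k$ with $|e\cap X^i|\le 1$ for all $i$ is admissible if $e$ meets exactly the classes $X^1,\dots,X^k$ and, writing $j_l$ for the index such that the vertex of $e\cap X^l$ lies in $e_{j_l}$, one has $j_1\le j_2\le\cdots\le j_k$. The clutter $\mathcal{C}$ is admissible if (for some such partitions) $e_1,\dots,e_g\in E(\mathcal{C})$ and all edges of $\mathcal{C}$ are admissible. Linear quotients: a monomial ideal $I$ has linear quotients if it has a system of minimal generators $\{u_1,\dots,u_r\}$, ordered with $\deg u_1\le\cdots\le\deg u_r$, such that for all $1\le i\le r-1$ the colon ideal $((u_1,\dots,u_i):u_{i+1})$ is generated by linear forms. *)

theory Defs
  imports
    "HOL-Library.Poly_Mapping"
    "HOL-Library.Extended_Nat"
    "HOL-Library.Disjoint_Sets"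
    "HOL-Algebra.QuotRing"
    "HOL-Algebra.Ring_Divisibility"
begin

section \<open>Heights, localization and Cohen-Macaulay rings\<close>

definition prime_height :: "('a, 'm) ring_scheme \<Rightarrow> 'a set \<Rightarrow> enat" where
  "prime_height R P =
     Sup {enat n | n. \<exists>Q :: nat \<Rightarrow> 'a set.
        (\<forall>i\<le>n. primeideal (Q i) R) \<and> (\<forall>i<n. Q i \<subset> Q (Suc i)) \<and> Q n = P}"

definition ideal_height :: "('a, 'm) ring_scheme \<Rightarrow> 'a set \<Rightarrow> enat" where
  "ideal_height R I = Inf {prime_height R P | P. primeideal P R \<and> I \<subseteq> P}"

definition krull_dim :: "('a, 'm) ring_scheme \<Rightarrow> enat" where
  "krull_dim R = Sup {prime_height R P | P. primeideal P R}"

text \<open>\<open>a / s\<close> and \<open>b / t\<close> are the same fraction iff \<open>u (t a - s b) = 0\<close> for some \<open>u \<in> S\<close>; the extra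
  factor \<open>u\<close> is needed since \<open>R\<close> may have zero divisors.\<close>

definition frac_rel :: "('a, 'm) ring_scheme \<Rightarrow> 'a set \<Rightarrow> (('a \<times> 'a) \<times> ('a \<times> 'a)) set" where
  "frac_rel R S = {((a, s), (b, t)). a \<in> carrier R \<and> s \<in> S \<and> b \<in> carrier R \<and> t \<in> S \<and>
     (\<exists>u\<in>S. u \<otimes>\<^bsub>R\<^esub> (t \<otimes>\<^bsub>R\<^esub> a \<ominus>\<^bsub>R\<^esub> s \<otimes>\<^bsub>R\<^esub> b) = \<zero>\<^bsub>R\<^esub>)}"

definition fraction :: "('a, 'm) ring_scheme \<Rightarrow> 'a set \<Rightarrow> 'a \<Rightarrow> 'a \<Rightarrow> ('a \<times> 'a) set" where
  "fraction R S a s = frac_rel R S `` {(a, s)}"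

text \<open>For fraction classes \<open>X\<close> and \<open>Y\<close> the unions below range over classes that are all equal, so
  they denote the class of the product and of the sum of any representatives.\<close>

definition localization :: "('a, 'm) ring_scheme \<Rightarrow> 'a set \<Rightarrow> ('a \<times> 'a) set ring" where
  "localization R S =
     \<lparr>carrier = (carrier R \<times> S) // frac_rel R S,
      mult = (\<lambda>X Y. \<Union>(a, s)\<in>X. \<Union>(b, t)\<in>Y. fraction R S (a \<otimes>\<^bsub>R\<^esub> b) (s \<otimes>\<^bsub>R\<^esub> t)),
      one = fraction R S \<one>\<^bsub>R\<^esub> \<one>\<^bsub>R\<^esub>,
      zero = fraction R S \<zero>\<^bsub>R\<^esub> \<one>\<^bsub>R\<^esub>,
      add = (\<lambda>X Y. \<Union>(a, s)\<in>X. \<Union>(b, t)\<in>Y.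
               fraction R S (t \<otimes>\<^bsub>R\<^esub> a \<oplus>\<^bsub>R\<^esub> s \<otimes>\<^bsub>R\<^esub> b) (s \<otimes>\<^bsub>R\<^esub> t))\<rparr>"

text \<open>The second conjunct says that \<open>xs ! i\<close> is a nonzerodivisor modulo the preceding elements.\<close>

definition regular_sequence :: "('a, 'm) ring_scheme \<Rightarrow> 'a list \<Rightarrow> bool" where
  "regular_sequence R xs \<longleftrightarrow>
     set xs \<subseteq> carrier R \<and>
     (\<forall>i<length xs. \<forall>r\<in>carrier R.
        r \<otimes>\<^bsub>R\<^esub> xs ! i \<in> Idl\<^bsub>R\<^esub> (set (take i xs)) \<longrightarrow> r \<in> Idl\<^bsub>R\<^esub> (set (take i xs))) \<and>
     Idl\<^bsub>R\<^esub> (set xs) \<noteq> carrier R"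

definition depth :: "('a, 'm) ring_scheme \<Rightarrow> 'a set \<Rightarrow> enat" where
  "depth R m = Sup {enat (length xs) | xs. regular_sequence R xs \<and> set xs \<subseteq> m}"

definition CM_local_ring :: "('a, 'm) ring_scheme \<Rightarrow> bool" where
  "CM_local_ring R \<longleftrightarrow>
     cring R \<and> noetherian_ring R \<and>
     (\<exists>m. {M. maximalideal M R} = {m} \<and> depth R m = krull_dim R)"

definition CM_ring :: "('a, 'm) ring_scheme \<Rightarrow> bool" where
  "CM_ring R \<longleftrightarrow>
     cring R \<and> noetherian_ring R \<and>
     (\<forall>m. maximalideal m R \<longrightarrow> CM_local_ring (localization R (carrier R - m)))"


section \<open>The polynomial ring and linear quotients\<close>

text \<open>Polynomials over \<open>'k\<close> in variables indexed by \<open>'v\<close>: an exponent vector \<open>'v \<Rightarrow>\<^sub>0 nat\<close> is mapped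
  to its coefficient, and multiplication is convolution.\<close>

type_synonym ('v, 'k) mpoly = "('v \<Rightarrow>\<^sub>0 nat) \<Rightarrow>\<^sub>0 'k"

definition mpoly_ring :: "('v, 'k::field) mpoly ring" where
  "mpoly_ring = \<lparr>carrier = UNIV, mult = (*), one = 1, zero = 0, add = (+)\<rparr>"

definition mono_poly :: "('v \<Rightarrow>\<^sub>0 nat) \<Rightarrow> ('v, 'k::field) mpoly" where
  "mono_poly a = Poly_Mapping.single a 1"

definition Var :: "'v \<Rightarrow> ('v, 'k::field) mpoly" where
  "Var v = mono_poly (Poly_Mapping.single v 1)"

definition mdeg :: "('v \<Rightarrow>\<^sub>0 nat) \<Rightarrow> nat" where
  "mdeg a = (\<Sum>v\<in>Poly_Mapping.keys a. Poly_Mapping.lookup a v)"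

definition linear_forms :: "('v, 'k::field) mpoly set" where
  "linear_forms = {p. \<forall>a\<in>Poly_Mapping.keys p. mdeg a = 1}"

definition colon :: "('a, 'm) ring_scheme \<Rightarrow> 'a set \<Rightarrow> 'a \<Rightarrow> 'a set" where
  "colon R I u = {r \<in> carrier R. r \<otimes>\<^bsub>R\<^esub> u \<in> I}"

text \<open>The minimal generators of a monomial ideal are its minimal monomial generators, given here
  by their exponent vectors. Lists are indexed from 0, so \<open>as ! i\<close> is the generator \<open>u\<^sub>i\<^sub>+\<^sub>1\<close> and
  \<open>take i as\<close> consists of \<open>u\<^sub>1, \<dots>, u\<^sub>i\<close>.\<close>

definition linear_quotients :: "('v, 'k::field) mpoly set \<Rightarrow> bool" where
  "linear_quotients I \<longleftrightarrow>
     (\<exists>as :: ('v \<Rightarrow>\<^sub>0 nat) list.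
        distinct as \<and>
        Idl\<^bsub>mpoly_ring\<^esub> (mono_poly ` set as) = I \<and>
        (\<forall>A. A \<subset> set as \<longrightarrow> Idl\<^bsub>mpoly_ring\<^esub> (mono_poly ` A) \<noteq> I) \<and>
        sorted (map mdeg as) \<and>
        (\<forall>i\<in>{1..<length as}. \<exists>L \<subseteq> (linear_forms :: ('v, 'k) mpoly set).
           colon mpoly_ring (Idl\<^bsub>mpoly_ring\<^esub> (mono_poly ` set (take i as))) (mono_poly (as ! i))
             = Idl\<^bsub>mpoly_ring\<^esub> L))"


section \<open>Clutters\<close>

text \<open>The vertex set of a clutter is the finite type \<open>'v\<close>, so a clutter is given by its edge set.\<close>

definition clutter :: "'v::finite set set \<Rightarrow> bool" where
  "clutter E \<longleftrightarrow> {} \<notin> E \<and> (\<forall>e\<in>E. \<forall>f\<in>E. \<not> e \<subset> f)"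

definition uniform :: "'v::finite set set \<Rightarrow> bool" where
  "uniform E \<longleftrightarrow> (\<forall>e\<in>E. \<forall>f\<in>E. card e = card f)"

definition vertex_cover :: "'v::finite set set \<Rightarrow> 'v set \<Rightarrow> bool" where
  "vertex_cover E C \<longleftrightarrow> (\<forall>e\<in>E. C \<inter> e \<noteq> {})"

definition minimal_vertex_cover :: "'v::finite set set \<Rightarrow> 'v set \<Rightarrow> bool" where
  "minimal_vertex_cover E C \<longleftrightarrow> vertex_cover E C \<and> (\<forall>D. D \<subset> C \<longrightarrow> \<not> vertex_cover E D)"

definition unmixed :: "'v::finite set set \<Rightarrow> bool" where
  "unmixed E \<longleftrightarrow>
     (\<forall>C D. minimal_vertex_cover E C \<longrightarrow> minimal_vertex_cover E D \<longrightarrow> card C = card D)"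

definition edge_ideal :: "'v::finite set set \<Rightarrow> ('v, 'k::field) mpoly set" where
  "edge_ideal E = Idl\<^bsub>mpoly_ring\<^esub> {\<Prod>v\<in>e. Var v | e. e \<in> E}"

definition alexander_dual :: "'v::finite set set \<Rightarrow> ('v, 'k::field) mpoly set" where
  "alexander_dual E = Idl\<^bsub>mpoly_ring\<^esub> {\<Prod>v\<in>C. Var v | C. minimal_vertex_cover E C}"

definition CM_clutter :: "'k::field itself \<Rightarrow> 'v::finite set set \<Rightarrow> bool" where
  "CM_clutter K E \<longleftrightarrow>
     CM_ring (mpoly_ring Quot (edge_ideal E :: ('v, 'k) mpoly set))"

text \<open>Below, \<open>X 1, \<dots>, X d\<close> and \<open>f 1, \<dots>, f g\<close> are the two partitions. As they partition the vertices,
  the function \<open>j\<close> is uniquely determined by \<open>e\<close> on \<open>{1..card e}\<close>.\<close>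

definition admissible_set ::
  "nat \<Rightarrow> (nat \<Rightarrow> 'v::finite set) \<Rightarrow> nat \<Rightarrow> (nat \<Rightarrow> 'v set) \<Rightarrow> 'v set \<Rightarrow> bool" where
  "admissible_set d X g f e \<longleftrightarrow>
     (\<forall>i\<in>{1..d}. card (e \<inter> X i) \<le> 1) \<and>
     (\<forall>i\<in>{1..d}. e \<inter> X i \<noteq> {} \<longleftrightarrow> i \<le> card e) \<and>
     (\<exists>j :: nat \<Rightarrow> nat.
        (\<forall>l\<in>{1..card e}. j l \<in> {1..g} \<and> e \<inter> X l \<subseteq> f (j l)) \<and> mono_on {1..card e} j)"

definition admissible :: "'k::field itself \<Rightarrow> 'v::finite set set \<Rightarrow> bool" where
  "admissible K E \<longleftrightarrow>
     (\<exists>g d X f.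
        ideal_height mpoly_ring (edge_ideal E :: ('v, 'k) mpoly set) = enat g \<and>
        d > 0 \<and>
        partition_on UNIV (X ` {1..d}) \<and> inj_on X {1..d} \<and>
        partition_on UNIV (f ` {1..g}) \<and> inj_on f {1..g} \<and>
        (\<forall>i\<in>{1..g}. \<forall>j\<in>{1..d}. card (f i \<inter> X j) \<le> 1) \<and>
        (\<forall>i\<in>{1..g}. f i \<in> E) \<and>
        (\<forall>e\<in>E. admissible_set d X g f e))"

end

(* Every minimal vertex cover has three elements, one in each of the edges e_1, e_2, e_3, and
   such a triple remains a cover when its vertex in e_1 moves to a smaller column or its vertex
   in e_3 moves to a larger one. Hence the covers, ordered by the column in e_2, then by that in
   e_1, then by decreasing column in e_3, form a shelling, which is the same as linear quotients.

   For the Cohen-Macaulay property write I as the intersection of the primes P_C generated by the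
   covers C. The shelling gives exact sequences 0 -> R/P_{i+1} -> R/J_{i+1} -> R/J_i -> 0 for
   J_i = P_1 \<inter> ... \<inter> P_i, so a sequence that is regular modulo every P_C is regular modulo I.
   The differences of two variables in the same e_i generate a polynomial ring A that maps
   isomorphically onto each R/P_C. By Zariski's lemma a maximal ideal m containing P_C contains a
   nonzero polynomial in each single variable outside C; carried over to A, these form a sequence
   in m of length dim A that is regular modulo every P_C. Conversely, no chain of primes above
   some P_C is longer than the number of variables outside C, by counting linearly independent
   power products. *)

theory Submission
  imports Defs "HOL-Computational_Algebra.Polynomial" "HOL-Library.FuncSet"
    "HOL-Library.Product_Lexorder"
begin

text \<open>\<open>CM_ring\<close> asks about the localization at every maximal ideal of R/I, and K
  need not be algebraically closed, so parameters vanishing at the origin are not enough: they have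
  to be found inside an arbitrary m, and this is what Zariski's lemma supplies. Such an m is only
  known to contain one of the P_C, whereas the exact sequences ask for regularity modulo all of them
  at once. The ring A depends on the e_i but not on the cover, and therefore one sequence can serve
  every cover.

  The column in e_2 comes first in the order because the middle vertex is the one that cannot be
  moved freely. If C and an earlier C' have different vertices b and b' in e_2, the cover that
  exchanges b for b' is not made from C: it is made from C', by moving the two outer vertices of C'
  to those of C in the permitted directions. If one of these moves is not permitted, then the
  opposite move is permitted in C, and that outer vertex of C is exchanged instead.\<close>

abbreviation (input) "keys \<equiv> Poly_Mapping.keys"
abbreviation (input) "lookup \<equiv> Poly_Mapping.lookup"
abbreviation (input) "single \<equiv> Poly_Mapping.single"

section \<open>Regular sequences\<close>

text \<open>A ring as a module over itself: \<open>idl.subspace\<close> means ideal and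
  \<open>idl.span\<close> the ideal generated by a set, so the library on spans serves for
  ideals.\<close>

interpretation idl: Modules.module "(*) :: 'a::comm_ring_1 \<Rightarrow> 'a \<Rightarrow> 'a"
  by unfold_locales (simp_all add: algebra_simps)

(* As a simp rule this is the reverse of mult.assoc and makes algebra_simps loop. *)
declare idl.scale_scale [simp del]

lemma span_insert_ideal:
  assumes "idl.subspace J"
  shows "y \<in> idl.span (insert x J) \<longleftrightarrow> (\<exists>k. y - k * x \<in> J)"
  using assms by (simp add: idl.span_breakdown_eq idl.span_eq_iff[THEN iffD2])

text \<open>The nonzerodivisor half of \<open>regular_sequence\<close>, taken on R/J. Properness is
  supplied later, by a prime ideal that contains the sequence.\<close>

definition weakly_regular :: "'a::comm_ring_1 set \<Rightarrow> 'a list \<Rightarrow> bool" where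
  "weakly_regular J xs \<longleftrightarrow> (\<forall>i<length xs. \<forall>r.
     r * xs ! i \<in> idl.span (J \<union> set (take i xs)) \<longrightarrow> r \<in> idl.span (J \<union> set (take i xs)))"

lemma weakly_regular_Nil [simp]: "weakly_regular J []"
  by (simp add: weakly_regular_def)

text \<open>Peeling off the first element replaces J by (J, x); this recursion carries regularity
  through exact sequences by induction on the list.\<close>

lemma weakly_regular_Cons:
  assumes "idl.subspace J"
  shows "weakly_regular J (x # xs) \<longleftrightarrow> (\<forall>r. r * x \<in> J \<longrightarrow> r \<in> J) \<and> weakly_regular (idl.span (insert x J)) xs"
proof -
  have J: "idl.span J = J"
    using assms by simp
  have sp: "idl.span (J \<union> insert x A) = idl.span (idl.span (insert x J) \<union> A)" for A
  proof (rule subset_antisym)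
    show "idl.span (J \<union> insert x A) \<subseteq> idl.span (idl.span (insert x J) \<union> A)"
      by (rule idl.span_mono) (use idl.span_superset[of "insert x J"] in blast)
    have "idl.span (insert x J) \<subseteq> idl.span (J \<union> insert x A)"
      by (rule idl.span_mono) blast
    then show "idl.span (idl.span (insert x J) \<union> A) \<subseteq> idl.span (J \<union> insert x A)"
      by (intro idl.span_minimal idl.subspace_span Un_least)
        (use idl.span_superset[of "J \<union> insert x A"] in blast)+
  qed
  show ?thesis
    unfolding weakly_regular_def by (simp add: All_less_Suc2 J flip: sp)
qed

text \<open>The hypotheses describe an exact sequence \<open>0 \<rightarrow> R/P \<rightarrow> R/N \<rightarrow> R/J \<rightarrow> 0\<close> whose first map is
  multiplication by \<open>s\<close>; they are preserved by passing to the quotient by \<open>x\<close>.\<close>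

lemma weakly_regular_extension:
  assumes "idl.subspace N" "idl.subspace J" "idl.subspace P"
    and "\<And>y. y \<in> J \<longleftrightarrow> (\<exists>t. y - s * t \<in> N)"
    and "\<And>t. s * t \<in> N \<longleftrightarrow> t \<in> P"
    and "weakly_regular J xs" "weakly_regular P xs"
  shows "weakly_regular N xs"
  using assms
proof (induction xs arbitrary: N J P)
  case Nil
  show ?case by simp
next
  case (Cons x xs)
  note N = Cons.prems(1) and J = Cons.prems(2) and P = Cons.prems(3)
    and JN = Cons.prems(4) and NP = Cons.prems(5)
  have regJ: "\<And>r. r * x \<in> J \<Longrightarrow> r \<in> J" and wJ: "weakly_regular (idl.span (insert x J)) xs"
    using Cons.prems(6) by (auto simp: weakly_regular_Cons[OF J])
  have regP: "\<And>r. r * x \<in> P \<Longrightarrow> r \<in> P" and wP: "weakly_regular (idl.span (insert x P)) xs"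
    using Cons.prems(7) by (auto simp: weakly_regular_Cons[OF P])
  have NJ: "y \<in> J" if "y \<in> N" for y
    unfolding JN by (intro exI[of _ 0]) (use that in simp)
  have sJ: "s * t \<in> J" for t
    unfolding JN by (intro exI[of _ t]) (simp add: idl.subspace_0[OF N])
  \<comment> \<open>Diagram chase: regularity on R/J puts r into J, so r is s*t modulo N; regularity
    on R/P then puts t into P.\<close>
  have "r \<in> N" if "r * x \<in> N" for r
  proof -
    have "r \<in> J"
      using that NJ regJ by blast
    then obtain t where t: "r - s * t \<in> N"
      using JN by blast
    have "s * (t * x) \<in> N"
      using idl.subspace_diff[OF N that idl.subspace_scale[OF N t, of x]]
      by (simp add: algebra_simps)
    then have "s * t \<in> N"
      using NP regP by blast
    then show "r \<in> N"
      using idl.subspace_add[OF N t, of "s * t"] by simp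
  qed
  moreover have "weakly_regular (idl.span (insert x N)) xs"
  proof (rule Cons.IH[OF _ _ _ _ _ wJ wP])
    fix y
    show "y \<in> idl.span (insert x J) \<longleftrightarrow> (\<exists>t. y - s * t \<in> idl.span (insert x N))"
      unfolding span_insert_ideal[OF J] span_insert_ideal[OF N] JN
      by (subst ex_comm) (simp add: diff_diff_eq add.commute)
  next
    fix t
    show "s * t \<in> idl.span (insert x N) \<longleftrightarrow> t \<in> idl.span (insert x P)"
      unfolding span_insert_ideal[OF P] span_insert_ideal[OF N]
    proof
      assume "\<exists>k. s * t - k * x \<in> N"
      then obtain k where k: "s * t - k * x \<in> N" by blast
      \<comment> \<open>Injectivity after dividing by x needs regularity on R/J: it makes k a
        multiple of s modulo N, and this multiple is absorbed into t.\<close>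
      then have "k * x \<in> J"
        using idl.subspace_diff[OF J sJ[of t] NJ[OF k]] by simp
      then obtain w where w: "k - s * w \<in> N"
        using regJ JN by blast
      have "s * (t - w * x) \<in> N"
        using idl.subspace_add[OF N k idl.subspace_scale[OF N w, of x]]
        by (simp add: algebra_simps)
      then show "\<exists>k. t - k * x \<in> P"
        using NP by blast
    next
      assume "\<exists>k. t - k * x \<in> P"
      then obtain k where "s * (t - k * x) \<in> N"
        using NP by blast
      then show "\<exists>k. s * t - k * x \<in> N"
        by (intro exI[of _ "s * k"]) (simp add: algebra_simps)
    qed
  qed auto
  ultimately show ?case
    using weakly_regular_Cons[OF N] by blast
qed

text \<open>The exact sequence with N = J \<inter> P: \<open>s\<close> generates J modulo J \<inter>
  P, and the annihilator of its class there is P because \<open>s\<close> is a nonzerodivisor modulo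
  P.\<close>

lemma weakly_regular_inter:
  assumes "idl.subspace J" "idl.subspace P" "s \<in> J"
    and sP: "\<And>t. s * t \<in> P \<Longrightarrow> t \<in> P"
    and JP: "\<And>y. y \<in> J \<Longrightarrow> \<exists>t. y - s * t \<in> P"
    and "weakly_regular J xs" "weakly_regular P xs"
  shows "weakly_regular (J \<inter> P) xs"
proof (rule weakly_regular_extension[where s = s, OF _ assms(1,2) _ _ assms(6,7)])
  show "idl.subspace (J \<inter> P)"
    using assms(1,2) by (rule idl.subspace_inter)
  have sJ: "s * t \<in> J" for t
    using idl.subspace_scale[OF assms(1,3), of t] by (simp add: mult.commute)
  show "y \<in> J \<longleftrightarrow> (\<exists>t. y - s * t \<in> J \<inter> P)" for y
  proof
    assume "y \<in> J"
    then show "\<exists>t. y - s * t \<in> J \<inter> P"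
      using JP idl.subspace_diff[OF assms(1) _ sJ] by blast
  next
    assume "\<exists>t. y - s * t \<in> J \<inter> P"
    then obtain t where "y - s * t \<in> J" by blast
    from idl.subspace_add[OF assms(1) this sJ[of t]] show "y \<in> J" by simp
  qed
  show "s * t \<in> J \<inter> P \<longleftrightarrow> t \<in> P" for t
    using sJ[of t] sP[of t] idl.subspace_scale[OF assms(2), of t s] by blast
qed


section \<open>Substitution and monomial ideals\<close>

text \<open>Polynomial rings in fewer variables are treated as subrings of one fixed type, so that
  inductions on the number of variables never change the type.\<close>

definition is_subring :: "'a::comm_ring_1 set \<Rightarrow> bool" where
  "is_subring B \<longleftrightarrow> 0 \<in> B \<and> 1 \<in> B \<and>
     (\<forall>x\<in>B. \<forall>y\<in>B. x + y \<in> B \<and> x * y \<in> B) \<and> (\<forall>x\<in>B. - x \<in> B)"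

lemma is_subringD:
  assumes "is_subring B"
  shows "0 \<in> B" "1 \<in> B" "\<And>x y. x \<in> B \<Longrightarrow> y \<in> B \<Longrightarrow> x + y \<in> B"
    "\<And>x y. x \<in> B \<Longrightarrow> y \<in> B \<Longrightarrow> x * y \<in> B" "\<And>x. x \<in> B \<Longrightarrow> - x \<in> B"
    "\<And>x y. x \<in> B \<Longrightarrow> y \<in> B \<Longrightarrow> x - y \<in> B"
proof -
  show *: "0 \<in> B" "1 \<in> B" "\<And>x y. x \<in> B \<Longrightarrow> y \<in> B \<Longrightarrow> x + y \<in> B"
    "\<And>x y. x \<in> B \<Longrightarrow> y \<in> B \<Longrightarrow> x * y \<in> B" "\<And>x. x \<in> B \<Longrightarrow> - x \<in> B"
    using assms by (auto simp: is_subring_def)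
  show "x - y \<in> B" if "x \<in> B" "y \<in> B" for x y
    using *(3)[OF that(1) *(5)[OF that(2)]] by simp
qed

lemma is_subring_sum: "is_subring B \<Longrightarrow> (\<And>i. i \<in> A \<Longrightarrow> f i \<in> B) \<Longrightarrow> sum f A \<in> B"
  by (induction A rule: infinite_finite_induct) (auto simp: is_subringD)

lemma is_subring_power: "is_subring B \<Longrightarrow> x \<in> B \<Longrightarrow> x ^ n \<in> B"
  by (induction n) (auto simp: is_subringD)

text \<open>Applied to subrings and also to ideals \<open>n\<close>, where it is the kernel of
  coefficientwise reduction modulo \<open>n\<close>.\<close>

definition polys_over :: "'a::comm_ring_1 set \<Rightarrow> 'a poly set" where
  "polys_over B = {p. \<forall>i. coeff p i \<in> B}"

lemma polys_overD: "p \<in> polys_over B \<Longrightarrow> coeff p i \<in> B"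
  by (simp add: polys_over_def)

lemma is_subring_polys_over:
  assumes "is_subring B"
  shows "is_subring (polys_over B)"
  using assms unfolding is_subring_def[of "polys_over B"]
  by (auto simp: polys_over_def is_subringD coeff_mult intro!: is_subring_sum)

lemma const_in_polys_over: "is_subring B \<Longrightarrow> c \<in> B \<Longrightarrow> [:c:] \<in> polys_over B"
  by (auto simp: polys_over_def coeff_pCons is_subringD split: nat.split)

lemma X_in_polys_over: "is_subring B \<Longrightarrow> [:0, 1:] \<in> polys_over B"
  by (auto simp: polys_over_def coeff_pCons is_subringD split: nat.split)

lemma monom_in_polys_over: "is_subring B \<Longrightarrow> c \<in> B \<Longrightarrow> monom c n \<in> polys_over B"
  by (auto simp: polys_over_def is_subringD)

lemma smult_in_polys_over: "is_subring B \<Longrightarrow> c \<in> B \<Longrightarrow> p \<in> polys_over B \<Longrightarrow> smult c p \<in> polys_over B"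
  by (auto simp: polys_over_def is_subringD)

section \<open>Constants, power products and evaluation homomorphisms\<close>

definition cst :: "'k::field \<Rightarrow> ('v, 'k) mpoly" where
  "cst c = single 0 c"

lemma cst_0 [simp]: "cst 0 = 0" and cst_1 [simp]: "cst 1 = 1"
  by (simp_all add: cst_def)

lemma cst_add: "cst (c + d) = cst c + cst d"
  by (simp add: cst_def single_add)

lemma cst_mult: "cst (c * d) = cst c * cst d"
  by (simp add: cst_def mult_single)

lemma cst_eq_0_iff [simp]: "cst c = 0 \<longleftrightarrow> c = 0"
  by (metis cst_def lookup_single_eq lookup_zero single_zero)

lemma cst_mono_poly: "cst c * mono_poly a = single a c"
  by (simp add: cst_def mono_poly_def mult_single)

lemma mono_poly_0 [simp]: "mono_poly 0 = 1"
  by (simp add: mono_poly_def)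

lemma mono_poly_add: "mono_poly (a + b) = mono_poly a * mono_poly b"
  by (simp add: mono_poly_def mult_single)

lemma mono_poly_sum: "mono_poly (sum f A) = (\<Prod>i\<in>A. mono_poly (f i))"
  by (induction A rule: infinite_finite_induct) (simp_all add: mono_poly_add)

lemma mono_poly_single: "mono_poly (single v n) = Var v ^ n"
proof (induction n)
  case (Suc n)
  have "single v (Suc n) = single v 1 + single v n"
    by (simp flip: single_add)
  then show ?case
    using Suc by (simp add: mono_poly_add Var_def)
qed simp

lemma poly_mapping_eq_sum_single:
  assumes "finite A" "keys p \<subseteq> A"
  shows "p = (\<Sum>a\<in>A. single a (lookup p a))"
  using assms
  by (intro poly_mapping_eqI)
    (auto simp: lookup_sum lookup_single when_def sum.delta in_keys_iff)

lemma mono_poly_eq_prod: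
  fixes a :: "'v::finite \<Rightarrow>\<^sub>0 nat"
  shows "mono_poly a = (\<Prod>v\<in>UNIV. Var v ^ lookup a v)"
  by (subst poly_mapping_eq_sum_single[of UNIV a])
    (simp_all add: mono_poly_sum mono_poly_single)

lemma mpoly_induct_single [case_names single add]:
  fixes p :: "('v, 'k::field) mpoly"
  assumes single: "\<And>a c. P (single a c)"
    and add: "\<And>p q. P p \<Longrightarrow> P q \<Longrightarrow> P (p + q)"
  shows "P p"
proof -
  have "P (\<Sum>a\<in>A. single a (lookup p a))" for A
    by (induction A rule: infinite_finite_induct)
      (use single[of 0 0] in \<open>auto intro: assms\<close>)
  then show ?thesis
    by (subst poly_mapping_eq_sum_single[of "keys p" p]) simp_all
qed

lemma mpoly_induct [case_names cst Var add mult]: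
  fixes p :: "('v::finite, 'k::field) mpoly"
  assumes cst: "\<And>c. P (cst c)" and Var: "\<And>v. P (Var v)"
    and add: "\<And>p q. P p \<Longrightarrow> P q \<Longrightarrow> P (p + q)"
    and mult: "\<And>p q. P p \<Longrightarrow> P q \<Longrightarrow> P (p * q)"
  shows "P p"
proof (induction p rule: mpoly_induct_single)
  case (single a c)
  have 1: "P 1"
    using cst[of 1] by simp
  have "P (Var v ^ n)" for v n
    by (induction n) (simp_all add: 1 Var mult)
  then have "P (\<Prod>v\<in>A. Var v ^ lookup a v)" for A
    by (induction A rule: infinite_finite_induct) (simp_all add: 1 mult)
  then show ?case
    using mult[OF cst[of c], of "mono_poly a"] by (simp add: mono_poly_eq_prod flip: cst_mono_poly)
qed (rule add)

text \<open>The coefficient map \<open>h\<close> is a parameter because the target is sometimes the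
  polynomial ring itself and sometimes the univariate polynomials over it.\<close>

definition subst :: "('k::field \<Rightarrow> 'b::comm_ring_1) \<Rightarrow> ('v::finite \<Rightarrow> 'b) \<Rightarrow> ('v, 'k) mpoly \<Rightarrow> 'b" where
  "subst h \<sigma> p = (\<Sum>a\<in>keys p.
     h (lookup p a) * (\<Prod>v\<in>UNIV. \<sigma> v ^ lookup a v))"

locale coeff_hom =
  fixes h :: "'k::field \<Rightarrow> 'b::comm_ring_1"
  assumes h_0 [simp]: "h 0 = 0" and h_1 [simp]: "h 1 = 1"
    and h_add: "h (c + d) = h c + h d" and h_mult: "h (c * d) = h c * h d"
begin

lemma subst_superset:
  assumes "finite A" "keys p \<subseteq> A"
  shows "subst h \<sigma> p = (\<Sum>a\<in>A. h (lookup p a) * (\<Prod>v\<in>UNIV. \<sigma> v ^ lookup a v))"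
  unfolding subst_def using assms
  by (intro sum.mono_neutral_left) (auto simp: in_keys_iff)

lemma subst_add [simp]: "subst h \<sigma> (p + q) = subst h \<sigma> p + subst h \<sigma> q"
proof -
  let ?A = "keys p \<union> keys q"
  have "keys (p + q) \<subseteq> ?A"
    by (rule keys_add)
  then show ?thesis
    by (simp add: subst_superset[of ?A] lookup_add h_add algebra_simps sum.distrib)
qed

lemma subst_single: "subst h \<sigma> (single a c) = h c * (\<Prod>v\<in>UNIV. \<sigma> v ^ lookup a v)"
  by (subst subst_superset[of "{a}"]) auto

lemma subst_cst [simp]: "subst h \<sigma> (cst c) = h c"
  by (simp add: cst_def subst_single)

lemma subst_Var [simp]: "subst h \<sigma> (Var v) = \<sigma> v"
proof -
  have "(\<Prod>w\<in>UNIV. \<sigma> w ^ lookup (single v 1) w) = (\<Prod>w\<in>UNIV. if w = v then \<sigma> w else 1)"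
    by (rule prod.cong) (auto simp: lookup_single)
  then show ?thesis
    by (simp add: Var_def mono_poly_def subst_single)
qed

lemma subst_mult [simp]: "subst h \<sigma> (p * q) = subst h \<sigma> p * subst h \<sigma> q"
proof (induction p rule: mpoly_induct_single)
  case (single a c)
  show ?case
    by (induction q rule: mpoly_induct_single)
      (simp_all add: mult_single subst_single lookup_add power_add prod.distrib h_mult algebra_simps)
qed (simp add: algebra_simps)

lemma subst_0 [simp]: "subst h \<sigma> 0 = 0" and subst_1 [simp]: "subst h \<sigma> 1 = 1"
  using subst_cst[of \<sigma> 0] subst_cst[of \<sigma> 1] by simp_all

lemma subst_uminus [simp]: "subst h \<sigma> (- p) = - subst h \<sigma> p"
  using subst_add[of \<sigma> p "- p"] by (simp add: eq_neg_iff_add_eq_0 add.commute)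

lemma subst_diff [simp]: "subst h \<sigma> (p - q) = subst h \<sigma> p - subst h \<sigma> q"
  using subst_add[of \<sigma> p "- q"] by simp

end

interpretation cst: coeff_hom cst
  by unfold_locales (simp_all add: cst_add cst_mult)

interpretation cst_poly: coeff_hom "\<lambda>c. [:cst c:]"
  by unfold_locales (simp_all add: cst_add cst_mult)

lemma subst_cong_on:
  assumes "\<And>a. a \<in> keys p \<Longrightarrow> keys a \<subseteq> W" "\<And>v. v \<in> W \<Longrightarrow> \<sigma> v = \<tau> v"
  shows "subst h \<sigma> p = subst h \<tau> p"
proof -
  have "\<sigma> v ^ lookup a v = \<tau> v ^ lookup a v" if "a \<in> keys p" for a v
    using assms that by (cases "lookup a v = 0") (auto simp: subset_iff in_keys_iff)
  then show ?thesis
    unfolding subst_def by (intro sum.cong prod.cong arg_cong2[of _ _ _ _ "(*)"]) auto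
qed

section \<open>Polynomial rings in a subset of the variables\<close>

definition polys_in :: "'v set \<Rightarrow> ('v, 'k::field) mpoly set" where
  "polys_in W = {p. \<forall>a\<in>keys p. keys a \<subseteq> W}"

lemma polys_in_UNIV [simp]: "polys_in UNIV = UNIV"
  by (simp add: polys_in_def)

lemma is_subring_polys_in: "is_subring (polys_in W)"
proof -
  have *: "keys a \<subseteq> W" if pq: "p \<in> polys_in W" "q \<in> polys_in W" "a \<in> keys (p * q)"
    for p q :: "('a, 'b) mpoly" and a
  proof -
    obtain b c where "a = b + c" "b \<in> keys p" "c \<in> keys q"
      using pq(3) keys_mult[of p q] by blast
    then show ?thesis
      using pq(1,2) keys_add[of b c] by (fastforce simp: polys_in_def)
  qed
  have "p * q \<in> polys_in W" if "p \<in> polys_in W" "q \<in> polys_in W" for p q :: "('a, 'b) mpoly"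
    by (subst polys_in_def) (intro CollectI ballI *[OF that])
  moreover have "p + q \<in> polys_in W" if "p \<in> polys_in W" "q \<in> polys_in W" for p q :: "('a, 'b) mpoly"
    using that subsetD[OF keys_add[of p q]] unfolding polys_in_def by blast
  moreover have "0 \<in> polys_in W" "1 \<in> polys_in W"
    by (simp_all add: polys_in_def)
  moreover have "- p \<in> polys_in W" if "p \<in> polys_in W" for p :: "('a, 'b) mpoly"
  proof -
    have "keys (- p) = keys p"
      by (auto simp: in_keys_iff)
    then show ?thesis
      using that by (simp add: polys_in_def)
  qed
  ultimately show ?thesis
    unfolding is_subring_def by blast
qed

lemma cst_in_polys_in [simp]: "cst c \<in> polys_in W"
  by (simp add: polys_in_def cst_def)

lemma Var_in_polys_in [simp]: "v \<in> W \<Longrightarrow> Var v \<in> polys_in W"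
  by (simp add: polys_in_def Var_def mono_poly_def)

lemma polys_in_empty: "p \<in> polys_in {} \<Longrightarrow> p = cst (lookup p 0)"
  unfolding cst_def
  using poly_mapping_eq_sum_single[of "{0}" p] by (auto simp: polys_in_def)

text \<open>Setting the variables outside \<open>W\<close> to 0 is a retraction that fixes
  \<open>p\<close>; the unrestricted induction is applied to its values.\<close>

lemma polys_in_induct [consumes 1, case_names cst Var add mult]:
  fixes p :: "('v::finite, 'k::field) mpoly"
  assumes "p \<in> polys_in W"
    and cst: "\<And>c. P (cst c)" and Var: "\<And>v. v \<in> W \<Longrightarrow> P (Var v)"
    and add: "\<And>p q. P p \<Longrightarrow> P q \<Longrightarrow> P (p + q)"
    and mult: "\<And>p q. P p \<Longrightarrow> P q \<Longrightarrow> P (p * q)"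
  shows "P p"
proof -
  define Q where "Q = (\<lambda>p :: ('v, 'k) mpoly. P (subst cst (\<lambda>v. if v \<in> W then Var v else 0) p))"
  have "Q p"
    by (induction p rule: mpoly_induct)
      (use cst[of 0] in \<open>simp_all add: Q_def cst Var add mult\<close>)
  moreover have "subst cst (\<lambda>v. if v \<in> W then Var v else 0) p = subst cst Var p"
    using assms(1) by (intro subst_cong_on[where W = W]) (auto simp: polys_in_def)
  moreover have "subst cst Var p = p"
    by (induction p rule: mpoly_induct) simp_all
  ultimately show ?thesis
    by (simp add: Q_def)
qed

text \<open>The polynomial read as one in \<open>Var w\<close> whose coefficients involve only the
  other variables; evaluation at \<open>Var w\<close> recovers it.\<close>

definition univar :: "'v::finite \<Rightarrow> ('v, 'k::field) mpoly \<Rightarrow> ('v, 'k) mpoly poly" where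
  "univar w = subst (\<lambda>c. [:cst c:]) (\<lambda>v. if v = w then [:0, 1:] else [:Var v:])"

lemma univar_simps [simp]:
  "univar w 0 = 0" "univar w 1 = 1" "univar w (cst c) = [:cst c:]"
  "univar w (p + q) = univar w p + univar w q" "univar w (p * q) = univar w p * univar w q"
  "univar w (- p) = - univar w p" "univar w (p - q) = univar w p - univar w q"
  by (simp_all add: univar_def)

lemma univar_Var: "univar w (Var v) = (if v = w then [:0, 1:] else [:Var v:])"
  by (simp add: univar_def)

lemma poly_univar [simp]: "poly (univar w p) (Var w) = p"
  by (induction p rule: mpoly_induct) (simp_all add: univar_Var)

lemma univar_eq_0_iff [simp]: "univar w p = 0 \<longleftrightarrow> p = 0"
  by (metis poly_0 poly_univar univar_simps(1))

lemma univar_free: "p \<in> polys_in W \<Longrightarrow> w \<notin> W \<Longrightarrow> univar w p = [:p:]"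
  by (induction p rule: polys_in_induct) (auto simp: univar_Var)

lemma univar_in_polys_over:
  "p \<in> polys_in W \<Longrightarrow> univar w p \<in> polys_over (polys_in (W - {w}))"
proof (induction p rule: polys_in_induct)
  case (cst c)
  then show ?case
    by (simp add: const_in_polys_over is_subring_polys_in)
next
  case (Var v)
  then show ?case
    by (simp add: univar_Var const_in_polys_over X_in_polys_over is_subring_polys_in)
next
  case (add p q)
  then show ?case
    by (simp add: is_subringD is_subring_polys_over is_subring_polys_in)
next
  case (mult p q)
  then show ?case
    by (simp add: is_subringD is_subring_polys_over is_subring_polys_in)
qed

text \<open>The leading coefficients with respect to the new variable lie in the smaller polynomial
  ring, and their product is a coefficient of \<open>p * q\<close>.\<close>

lemma polys_in_no_zero_divisors:
  fixes p q :: "('v::finite, 'k::field) mpoly"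
  assumes "finite W" "p \<in> polys_in W" "q \<in> polys_in W" "p * q = 0"
  shows "p = 0 \<or> q = 0"
  using assms
proof (induction W arbitrary: p q rule: finite_induct)
  case empty
  then have "p = cst (lookup p 0)" "q = cst (lookup q 0)"
    by (simp_all add: polys_in_empty)
  then show ?case
    using empty by (metis cst_eq_0_iff cst_mult no_zero_divisors)
next
  case (insert w W)
  have "coeff (univar w p) i \<in> polys_in W" "coeff (univar w q) i \<in> polys_in W" for i
    using insert univar_in_polys_over[of p "insert w W" w] univar_in_polys_over[of q "insert w W" w]
    by (auto dest: polys_overD)
  moreover have "lead_coeff (univar w p) * lead_coeff (univar w q) = 0"
    using coeff_mult_degree_sum[of "univar w p" "univar w q"] insert.prems(3)
    by (simp flip: univar_simps(5))
  ultimately have "univar w p = 0 \<or> univar w q = 0"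
    using insert.IH by (metis leading_coeff_0_iff)
  then show ?case
    by simp
qed

lemma mpoly_no_zero_divisors:
  fixes p q :: "('v::finite, 'k::field) mpoly"
  shows "p * q = 0 \<longleftrightarrow> p = 0 \<or> q = 0"
  using polys_in_no_zero_divisors[of UNIV p q] by auto

section \<open>Monomial ideals and ideals generated by variables\<close>

lemma span_mono_poly:
  fixes A :: "('v \<Rightarrow>\<^sub>0 nat) set"
  shows "idl.span (mono_poly ` A :: ('v, 'k::field) mpoly set) =
    {p. \<forall>b\<in>keys p. \<exists>a\<in>A. \<exists>c. b = a + c}" (is "_ = ?M")
proof
  have "idl.subspace ?M"
  proof (rule idl.subspaceI)
    fix r p :: "('v, 'k) mpoly"
    assume p: "p \<in> ?M"
    show "r * p \<in> ?M"
    proof safe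
      fix b
      assume "b \<in> keys (r * p)"
      then obtain d e where "b = d + e" "e \<in> keys p"
        using keys_mult[of r p] by blast
      moreover from p calculation(2) have "\<exists>a\<in>A. \<exists>c. e = a + c"
        by simp
      ultimately show "\<exists>a\<in>A. \<exists>c. b = a + c"
        by (metis add.left_commute)
    qed
  qed (use keys_add in \<open>fastforce+\<close>)
  moreover have "mono_poly ` A \<subseteq> ?M"
    by (auto simp: mono_poly_def) (metis add_0_right)
  ultimately show "idl.span (mono_poly ` A) \<subseteq> ?M"
    by (rule idl.span_minimal[rotated])
  show "?M \<subseteq> idl.span (mono_poly ` A)"
  proof
    fix p :: "('v, 'k) mpoly"
    assume p: "p \<in> ?M"
    have "single b (lookup p b) \<in> idl.span (mono_poly ` A)"
      if "b \<in> keys p" for b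
    proof -
      from p that have "\<exists>a\<in>A. \<exists>c. b = a + c"
        by simp
      then obtain a c where "a \<in> A" "b = a + c"
        by (elim bexE exE)
      then have "single b (lookup p b) = (cst (lookup p b) * mono_poly c) * mono_poly a"
        by (simp add: mono_poly_add mult_ac flip: cst_mono_poly)
      then show ?thesis
        using \<open>a \<in> A\<close> by (metis idl.span_base idl.span_scale imageI)
    qed
    then show "p \<in> idl.span (mono_poly ` A)"
      by (subst poly_mapping_eq_sum_single[of "keys p" p]) (auto intro: idl.span_sum)
  qed
qed

lemma span_Var:
  "idl.span (Var ` C :: ('v, 'k::field) mpoly set) =
    {p. \<forall>b\<in>keys p. keys b \<inter> C \<noteq> {}}"
proof -
  have "(\<exists>c. b = single v 1 + c) \<longleftrightarrow> v \<in> keys b" for b :: "'v \<Rightarrow>\<^sub>0 nat" and v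
  proof
    assume "v \<in> keys b"
    then have "b = single v 1 + (b - single v 1)"
      by (intro poly_mapping_eqI) (auto simp: lookup_add lookup_minus lookup_single when_def in_keys_iff)
    then show "\<exists>c. b = single v 1 + c" ..
  qed (auto simp: in_keys_iff lookup_add)
  moreover have "Var ` C = (mono_poly ` (\<lambda>v. single v 1) ` C :: ('v, 'k) mpoly set)"
    by (auto simp: Var_def)
  ultimately show ?thesis
    by (auto simp: span_mono_poly)
qed

text \<open>The identity and the substitution agree modulo J on constants and variables, hence
  everywhere. It is applied both to setting variables to 0 and to subtracting variables that lie in
  J.\<close>

lemma diff_subst_in_ideal:
  fixes p :: "('v::finite, 'k::field) mpoly"
  assumes J: "idl.subspace J" and \<sigma>: "\<And>v. Var v - \<sigma> v \<in> J"
  shows "p - subst cst \<sigma> p \<in> J"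
proof (induction p rule: mpoly_induct)
  case (add p q)
  then show ?case
    using idl.subspace_add[OF J add] by (simp add: algebra_simps)
next
  case (mult p q)
  have "p * q - subst cst \<sigma> (p * q) = p * (q - subst cst \<sigma> q) + subst cst \<sigma> q * (p - subst cst \<sigma> p)"
    by (simp add: algebra_simps)
  then show ?case
    using mult by (simp add: idl.subspace_add[OF J] idl.subspace_scale[OF J])
qed (simp_all add: \<sigma> idl.subspace_0[OF J])

text \<open>Setting the variables of C to 0 maps into a ring without zero divisors, which gives
  primality of the ideal.\<close>

lemma span_Var_eq_kernel:
  fixes p :: "('v::finite, 'k::field) mpoly"
  shows "p \<in> idl.span (Var ` C) \<longleftrightarrow> subst cst (\<lambda>v. if v \<in> C then 0 else Var v) p = 0"
proof
  let ?\<kappa> = "subst cst (\<lambda>v. if v \<in> C then 0 else Var v) :: ('v, 'k) mpoly \<Rightarrow> _"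
  show "?\<kappa> p = 0" if "p \<in> idl.span (Var ` C)"
    using that by (induction rule: idl.span_induct_alt) auto
  have "p - ?\<kappa> p \<in> idl.span (Var ` C)"
    by (rule diff_subst_in_ideal) (auto intro: idl.span_base idl.span_zero)
  then show "p \<in> idl.span (Var ` C)" if "?\<kappa> p = 0"
    using that by simp
qed

lemma span_Var_prime:
  fixes p q :: "('v::finite, 'k::field) mpoly"
  assumes "p * q \<in> idl.span (Var ` C)"
  shows "p \<in> idl.span (Var ` C) \<or> q \<in> idl.span (Var ` C)"
  using assms by (simp add: span_Var_eq_kernel mpoly_no_zero_divisors)


section \<open>Zariski's lemma\<close>

lemma ideal_mult_right: "idl.subspace n \<Longrightarrow> x \<in> n \<Longrightarrow> x * c \<in> n"
  using idl.subspace_scale[of n x c] by (simp add: mult.commute)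

lemma poly_in_ideal:
  assumes "idl.subspace n" "p \<in> polys_over n"
  shows "poly p x \<in> n"
  using assms(2) unfolding poly_altdef polys_over_def
  by (intro idl.subspace_sum[OF assms(1)]) (auto intro: ideal_mult_right[OF assms(1)])

lemma poly_in_subring: "is_subring B \<Longrightarrow> p \<in> polys_over B \<Longrightarrow> x \<in> B \<Longrightarrow> poly p x \<in> B"
  unfolding poly_altdef
  by (intro is_subring_sum is_subringD(4) is_subring_power) (auto simp: polys_overD)

definition adjoin :: "'a::comm_ring_1 set \<Rightarrow> 'a \<Rightarrow> 'a set" where
  "adjoin B x = (\<lambda>p. poly p x) ` polys_over B"

lemma is_subring_adjoin:
  assumes "is_subring B"
  shows "is_subring (adjoin B x)"
proof -
  note * = is_subringD[OF is_subring_polys_over[OF assms]]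
  show ?thesis
    unfolding is_subring_def adjoin_def
  proof (intro conjI ballI)
    show "0 \<in> (\<lambda>p. poly p x) ` polys_over B"
      using *(1) by force
    show "1 \<in> (\<lambda>p. poly p x) ` polys_over B"
      using *(2) by force
  next
    fix y z
    assume "y \<in> (\<lambda>p. poly p x) ` polys_over B" "z \<in> (\<lambda>p. poly p x) ` polys_over B"
    then obtain p q where "p \<in> polys_over B" "q \<in> polys_over B" "y = poly p x" "z = poly q x"
      by blast
    then show "y + z \<in> (\<lambda>p. poly p x) ` polys_over B" "y * z \<in> (\<lambda>p. poly p x) ` polys_over B"
      by (auto simp flip: poly_add poly_mult intro!: imageI *)
  next
    fix y
    assume "y \<in> (\<lambda>p. poly p x) ` polys_over B"
    then show "- y \<in> (\<lambda>p. poly p x) ` polys_over B"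
      by (auto simp flip: poly_minus intro!: imageI *)
  qed
qed

lemma generator_in_adjoin: "is_subring B \<Longrightarrow> x \<in> adjoin B x"
  unfolding adjoin_def by (rule image_eqI[of _ _ "[:0, 1:]"]) (simp_all add: X_in_polys_over)

lemma polys_in_insert_eq_adjoin:
  fixes w :: "'v::finite"
  shows "polys_in (insert w W) = adjoin (polys_in (W - {w}) :: ('v, 'k::field) mpoly set) (Var w)"
proof
  have "p \<in> polys_in (insert w W) \<Longrightarrow> p \<in> adjoin (polys_in (W - {w})) (Var w)" for p :: "('v, 'k) mpoly"
    unfolding adjoin_def
    by (rule image_eqI[of _ _ "univar w p"]) (use univar_in_polys_over[of p "insert w W" w] in auto)
  then show "polys_in (insert w W) \<subseteq> adjoin (polys_in (W - {w}) :: ('v, 'k) mpoly set) (Var w)"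
    by blast
  have "p \<in> polys_over (polys_in (W - {w})) \<Longrightarrow> p \<in> polys_over (polys_in (insert w W))"
    for p :: "('v, 'k) mpoly poly"
    by (auto simp: polys_over_def polys_in_def)
  then show "adjoin (polys_in (W - {w}) :: ('v, 'k) mpoly set) (Var w) \<subseteq> polys_in (insert w W)"
    unfolding adjoin_def by (auto intro!: poly_in_subring is_subring_polys_in)
qed

text \<open>For \<open>n\<close> prime this says that some localization \<open>(B/n)\<^sub>b\<close> at a single element is a field.\<close>

definition loc_field :: "'a::comm_ring_1 set \<Rightarrow> 'a set \<Rightarrow> bool" where
  "loc_field n B \<longleftrightarrow> (\<exists>b\<in>B - n. \<forall>c\<in>B - n. \<exists>c'\<in>B. \<exists>M. c * c' - b ^ M \<in> n)"

text \<open>\<open>d\<close> is the degree of the reduction of \<open>p\<close> modulo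
  \<open>n\<close>.\<close>

lemma top_coeff:
  fixes p :: "'a::comm_ring_1 poly"
  assumes "p \<notin> polys_over n" "0 \<in> n"
  obtains d where "coeff p d \<notin> n" "\<And>i. i > d \<Longrightarrow> coeff p i \<in> n"
proof -
  let ?D = "{i. coeff p i \<notin> n}"
  have "?D \<subseteq> {..degree p}"
    using assms(2) by (force simp: not_le intro: leI dest: coeff_eq_0)
  then have "finite ?D"
    by (rule finite_subset) simp
  moreover have "?D \<noteq> {}"
    using assms(1) by (auto simp: polys_over_def)
  ultimately show ?thesis
    using that[of "Max ?D"] Max_in[of ?D] Max_ge[of ?D] by (metis (mono_tags, lifting) mem_Collect_eq not_le)
qed

text \<open>In degree d + e every other summand has a factor whose index exceeds its bound, hence a
  factor in \<open>n\<close>.\<close>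

lemma coeff_mult_top:
  fixes p q :: "'a::comm_ring_1 poly"
  assumes n: "idl.subspace n"
    and p: "\<And>i. i > d \<Longrightarrow> coeff p i \<in> n" and q: "\<And>i. i > e \<Longrightarrow> coeff q i \<in> n"
  shows "coeff (p * q) (d + e) - coeff p d * coeff q e \<in> n"
proof -
  have "coeff (p * q) (d + e) - coeff p d * coeff q e = (\<Sum>i\<in>{..d + e} - {d}. coeff p i * coeff q (d + e - i))"
    by (simp add: coeff_mult sum_diff1)
  also have "\<dots> \<in> n"
  proof (rule idl.subspace_sum[OF n])
    fix i
    assume "i \<in> {..d + e} - {d}"
    then consider "i > d" | "d + e - i > e"
      by fastforce
    then show "coeff p i * coeff q (d + e - i) \<in> n"
      by cases (simp_all add: p q ideal_mult_right[OF n] idl.subspace_scale[OF n])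
  qed
  finally show ?thesis .
qed

lemma poly_diff_in_ideal:
  assumes "idl.subspace n" "\<And>i. coeff p i - coeff q i \<in> n"
  shows "poly p x - poly q x \<in> n"
  using poly_in_ideal[OF assms(1), of "p - q" x] assms(2) by (simp add: polys_over_def)

lemma prime_idealD:
  assumes "\<And>p q. p * q \<in> n \<Longrightarrow> p \<in> n \<or> q \<in> n" "1 \<notin> n"
  shows "p ^ k \<in> n \<Longrightarrow> p \<in> n"
  using assms by (induction k) auto

text \<open>If \<open>x\<close> were transcendental over \<open>B/n\<close> and \<open>b = b(x)\<close> as in \<open>loc_field\<close>, then \<open>1 + x b(x)\<close>
  would divide a power of \<open>b(x)\<close>, hence be a unit of the polynomial ring \<open>(B/n)[x]\<close>.\<close>

lemma loc_field_adjoin_imp_algebraic: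
  fixes x :: "'a::comm_ring_1"
  assumes n: "idl.subspace n" and prime: "\<And>p q. p * q \<in> n \<Longrightarrow> p \<in> n \<or> q \<in> n" and "1 \<notin> n"
    and B: "is_subring B" and loc: "loc_field n (adjoin B x)"
  shows "\<exists>F\<in>polys_over B - polys_over n. poly F x \<in> n"
proof (rule ccontr)
  assume "\<not> ?thesis"
  then have trans: "F \<in> polys_over n" if "F \<in> polys_over B" "poly F x \<in> n" for F
    using that by blast
  note BX = is_subring_polys_over[OF B] and n0 = idl.subspace_0[OF n]
  obtain b where b: "b \<in> adjoin B x" "b \<notin> n"
    and div: "\<And>c. c \<in> adjoin B x \<Longrightarrow> c \<notin> n \<Longrightarrow> \<exists>c'\<in>adjoin B x. \<exists>M. c * c' - b ^ M \<in> n"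
    using loc by (auto simp: loc_field_def)
  obtain \<beta> where \<beta>: "\<beta> \<in> polys_over B" "b = poly \<beta> x"
    using b(1) by (auto simp: adjoin_def)
  have "\<beta> \<notin> polys_over n"
    using b(2) \<beta>(2) poly_in_ideal[OF n] by blast
  then obtain d where d: "coeff \<beta> d \<notin> n" "\<And>i. i > d \<Longrightarrow> coeff \<beta> i \<in> n"
    using top_coeff n0 by blast
  define U where "U = 1 + [:0, 1:] * \<beta>"
  have U: "U \<in> polys_over B"
    unfolding U_def by (intro is_subringD[OF BX] X_in_polys_over B \<beta>)
  have U_coeff: "coeff U (Suc i) = coeff \<beta> i" for i
    by (simp add: U_def)
  have "poly U x \<notin> n"
    using trans[OF U] d(1) by (auto simp: polys_over_def simp flip: U_coeff)
  then obtain c' M where c': "c' \<in> adjoin B x" "poly U x * c' - b ^ M \<in> n"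
    using div[of "poly U x"] U by (auto simp: adjoin_def)
  \<comment> \<open>\<open>x * b\<close> is -1 modulo \<open>poly U x\<close>, so its M-th power is
    a sign. Multiplying the relation for \<open>b ^ M\<close> by \<open>x ^ M\<close> therefore
    exhibits an inverse of \<open>poly U x\<close> modulo \<open>n\<close>, which is
    \<open>W\<close> below.\<close>
  obtain V where V: "(x * b) ^ M = poly U x * V + (- 1) ^ M" "V \<in> adjoin B x"
  proof -
    have "\<exists>V\<in>adjoin B x. (x * b) ^ M = poly U x * V + (- 1) ^ M"
    proof (induction M)
      case 0
      show ?case
        by (intro bexI[of _ 0]) (simp_all add: is_subringD is_subring_adjoin B)
    next
      case (Suc M)
      then obtain V where V: "V \<in> adjoin B x" "(x * b) ^ M = poly U x * V + (- 1) ^ M"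
        by blast
      have "x * b = poly U x - 1"
        by (simp add: U_def \<beta>)
      have "(x * b) ^ Suc M = poly U x * ((x * b) * V) + (x * b) * (- 1) ^ M"
        unfolding power_Suc V(2) by (simp add: algebra_simps)
      also have "(x * b) * (- 1) ^ M = poly U x * (- 1) ^ M + (- 1) ^ Suc M"
        unfolding \<open>x * b = poly U x - 1\<close> by (simp add: algebra_simps)
      finally have "(x * b) ^ Suc M = poly U x * ((x * b) * V + (- 1) ^ M) + (- 1) ^ Suc M"
        by (simp add: algebra_simps)
      then show ?case
        using V(1) b(1) generator_in_adjoin[OF B, of x] is_subringD[OF is_subring_adjoin[OF B]] is_subring_power[OF is_subring_adjoin[OF B]]
        by metis
    qed
    then show ?thesis using that by blast
  qed
  note x_adj = generator_in_adjoin[OF B, of x]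
  define W where "W = (- 1) ^ M * (x ^ M * c' - V)"
  have "W \<in> adjoin B x"
    unfolding W_def using c' V x_adj is_subringD[OF is_subring_adjoin[OF B]]
      is_subring_power[OF is_subring_adjoin[OF B]] by metis
  then obtain \<omega> where \<omega>: "\<omega> \<in> polys_over B" "W = poly \<omega> x"
    by (auto simp: adjoin_def)
  have "poly U x * W - 1 = (- 1) ^ M * x ^ M * (poly U x * c' - b ^ M)"
  proof -
    have "poly U x * W - 1 = (- 1) ^ M * (x ^ M * (poly U x * c')) - (- 1) ^ M * (poly U x * V + (- 1) ^ M)"
      by (simp add: W_def algebra_simps flip: power_add power_mult_distrib)
    also have "\<dots> = (- 1) ^ M * (x ^ M * (poly U x * c')) - (- 1) ^ M * (x * b) ^ M"
      by (simp only: V(1))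
    finally show ?thesis
      by (simp add: algebra_simps power_mult_distrib)
  qed
  then have UW: "poly (U * \<omega> - 1) x \<in> n"
    using idl.subspace_scale[OF n c'(2)] by (simp add: \<omega>)
  \<comment> \<open>Transcendence lifts the relation between values at x to one between
    polynomials.\<close>
  have "U * \<omega> - 1 \<in> polys_over n"
    by (rule trans[OF _ UW]) (intro is_subringD[OF BX] U \<omega>)
  then have UW1: "coeff (U * \<omega> - 1) i \<in> n" for i
    by (rule polys_overD)
  have "\<omega> \<notin> polys_over n"
  proof
    assume "\<omega> \<in> polys_over n"
    then have "poly U x * W \<in> n"
      using poly_in_ideal[OF n] \<omega> idl.subspace_scale[OF n] by blast
    then have "poly U x * W - poly (U * \<omega> - 1) x \<in> n"
      using UW idl.subspace_diff[OF n] by blast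
    then show False
      using \<open>1 \<notin> n\<close> by (simp add: \<omega>)
  qed
  then obtain e where e: "coeff \<omega> e \<notin> n" "\<And>i. i > e \<Longrightarrow> coeff \<omega> i \<in> n"
    using top_coeff n0 by blast
  \<comment> \<open>The index is positive, so subtracting 1 does not touch this coefficient: it lies
    in \<open>n\<close>, yet it is the product of two leading coefficients outside
    \<open>n\<close>.\<close>
  have "coeff (U * \<omega>) (Suc d + e) - coeff U (Suc d) * coeff \<omega> e \<in> n"
  proof (rule coeff_mult_top[OF n _ e(2)])
    show "coeff U i \<in> n" if "i > Suc d" for i
      using that d(2)[of "i - 1"] U_coeff[of "i - 1"] by simp
  qed
  moreover have "coeff (U * \<omega>) (Suc d + e) \<in> n"
    using UW1[of "Suc d + e"] by simp
  ultimately have "coeff U (Suc d) * coeff \<omega> e \<in> n"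
    using idl.subspace_diff[OF n] by fastforce
  then show False
    using prime d(1) e(1) U_coeff by metis
qed

text \<open>Division without inverting the leading coefficient: \<open>F\<close> is scaled by
  \<open>coeff G e\<close> before its coefficient in degree d is cancelled. The numbers d and e act
  as formal degrees; e > 0 makes d drop in every step.\<close>

lemma pseudo_division:
  fixes F G :: "'a::comm_ring_1 poly"
  assumes B: "is_subring B" and G: "G \<in> polys_over B" "degree G \<le> e" and "e > 0"
    and F: "F \<in> polys_over B" "degree F \<le> d"
  obtains M q r where "q \<in> polys_over B" "r \<in> polys_over B"
    "smult (coeff G e ^ M) F = q * G + r" "\<And>i. i \<ge> e \<Longrightarrow> coeff r i = 0" "degree q \<le> d - e"
proof -
  note BX = is_subringD[OF is_subring_polys_over[OF B]]
  have "\<exists>M. \<exists>q\<in>polys_over B. \<exists>r\<in>polys_over B. smult (coeff G e ^ M) F = q * G + r \<and>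
    (\<forall>i\<ge>e. coeff r i = 0) \<and> degree q \<le> d - e"
    using F
  proof (induction d arbitrary: F rule: less_induct)
    case (less d)
    show ?case
    proof (cases "d < e")
      case True
      then show ?thesis
        using less.prems BX(1)
        by (intro exI[of _ 0] bexI[of _ 0] bexI[of _ F]) (auto intro!: coeff_eq_0)
    next
      case False
      define T where "T = monom (coeff F d) (d - e)"
      define F' where "F' = smult (coeff G e) F - T * G"
      have T: "T \<in> polys_over B"
        unfolding T_def using less.prems(1) by (intro monom_in_polys_over B polys_overD)
      have F'B: "F' \<in> polys_over B"
        unfolding F'_def using less.prems(1) G(1) T
        by (intro BX smult_in_polys_over B polys_overD)
      have "coeff F' i = 0" if "i > d - 1" for i
      proof (cases "i = d")
        case True
        then show ?thesis
          using False by (simp add: F'_def T_def coeff_monom_mult)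
      next
        case i: False
        then have "i > d"
          using that by simp
        then have "coeff F i = 0" "coeff G (i - (d - e)) = 0"
          using less.prems(2) G(2) False by (auto intro!: coeff_eq_0)
        then show ?thesis
          by (simp add: F'_def T_def coeff_monom_mult)
      qed
      then have "degree F' \<le> d - 1"
        by (intro degree_le) auto
      then obtain M q r where qr: "q \<in> polys_over B" "r \<in> polys_over B"
        "smult (coeff G e ^ M) F' = q * G + r" "\<forall>i\<ge>e. coeff r i = 0" "degree q \<le> d - 1 - e"
        using less.IH[of "d - 1" F'] F'B False \<open>e > 0\<close> by auto
      show ?thesis
      proof (rule exI[of _ "Suc M"], rule bexI[of _ "q + smult (coeff G e ^ M) T"], rule bexI[of _ r], intro conjI)
        have "smult (coeff G e ^ Suc M) F = smult (coeff G e ^ M) F' + smult (coeff G e ^ M) T * G"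
          by (simp add: F'_def smult_diff_right mult.commute)
        then show "smult (coeff G e ^ Suc M) F = (q + smult (coeff G e ^ M) T) * G + r"
          by (simp add: qr(3) algebra_simps)
        have "degree (smult (coeff G e ^ M) T) \<le> d - e"
          unfolding T_def by (rule order_trans[OF degree_smult_le degree_monom_le])
        then show "degree (q + smult (coeff G e ^ M) T) \<le> d - e"
          using qr(5) by (intro degree_add_le) auto
        show "q + smult (coeff G e ^ M) T \<in> polys_over B"
          using qr(1) T G(1) by (intro BX smult_in_polys_over B is_subring_power polys_overD)
      qed (use qr in auto)
    qed
  qed
  then show ?thesis
    using that by blast
qed

text \<open>Dropping the top coefficients that lie in \<open>n\<close> changes the value at x only
  modulo \<open>n\<close>, and makes the formal degree the degree modulo \<open>n\<close>.\<close>

lemma truncate_mod: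
  fixes H :: "'a::comm_ring_1 poly"
  assumes n: "idl.subspace n" and B: "is_subring B" and H: "H \<in> polys_over B" "H \<notin> polys_over n"
  obtains e H' where "H' \<in> polys_over B" "degree H' \<le> e" "coeff H' e \<notin> n" "coeff H e = coeff H' e"
    "poly H x - poly H' x \<in> n"
proof -
  obtain e where e: "coeff H e \<notin> n" "\<And>i. i > e \<Longrightarrow> coeff H i \<in> n"
    using top_coeff[OF H(2) idl.subspace_0[OF n]] by blast
  define H' where "H' = (\<Sum>i\<le>e. monom (coeff H i) i)"
  have c: "coeff H' i = (if i \<le> e then coeff H i else 0)" for i
    by (auto simp: H'_def coeff_sum coeff_monom)
  show ?thesis
  proof (rule that[of H' e])
    show "H' \<in> polys_over B"
      using H(1) is_subringD(1)[OF B] by (auto simp: polys_over_def c)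
    show "degree H' \<le> e"
      by (intro degree_le) (simp add: c)
    show "poly H x - poly H' x \<in> n"
      using e(2) idl.subspace_0[OF n] by (intro poly_diff_in_ideal[OF n]) (auto simp: c)
  qed (use e in \<open>auto simp: c\<close>)
qed

lemma power_diff_in_ideal:
  assumes "idl.subspace n" "y - z \<in> n"
  shows "y ^ M - z ^ M \<in> n"
proof (induction M)
  case (Suc M)
  have "y ^ Suc M - z ^ Suc M = y * (y ^ M - z ^ M) + (y - z) * z ^ M"
    by (simp add: algebra_simps)
  then show ?case
    using Suc assms by (simp add: idl.subspace_add idl.subspace_scale ideal_mult_right)
qed (simp add: idl.subspace_0[OF assms(1)])

text \<open>Modulo \<open>n\<close>, x is algebraic over B. Let r be the leading coefficient of a
  relation of least degree, and s a nonzero multiple of b that lies in B. Inverting s*r makes b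
  invertible and reduces every element of B[x] below that degree; comparing constant coefficients
  then turns inverses in B[x] into inverses over B.\<close>

lemma loc_field_of_adjoin:
  fixes x :: "'a::comm_ring_1"
  assumes n: "idl.subspace n" and prime: "\<And>p q. p * q \<in> n \<Longrightarrow> p \<in> n \<or> q \<in> n" and "1 \<notin> n"
    and B: "is_subring B" and loc: "loc_field n (adjoin B x)"
  shows "loc_field n B"
proof -
  note BX = is_subring_polys_over[OF B]
  have adj: "poly p x \<in> adjoin B x" if "p \<in> polys_over B" for p
    using that by (auto simp: adjoin_def)
  \<comment> \<open>Algebraic relations of x modulo \<open>n\<close> with their degrees; d below is
    the degree of x over the fraction field of B/n.\<close>
  define isF where "isF = (\<lambda>F d. F \<in> polys_over B \<and> degree F \<le> d \<and> coeff F d \<notin> n \<and> poly F x \<in> n)"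
  define d where "d = (LEAST d. \<exists>F. isF F d)"
  have "\<exists>d F. isF F d"
  proof -
    obtain F where F: "F \<in> polys_over B" "F \<notin> polys_over n" "poly F x \<in> n"
      using loc_field_adjoin_imp_algebraic[OF n prime \<open>1 \<notin> n\<close> B loc] by blast
    obtain e H where H: "H \<in> polys_over B" "degree H \<le> e" "coeff H e \<notin> n" "poly F x - poly H x \<in> n"
      using truncate_mod[OF n B F(1,2), of x] by metis
    then have "isF H e"
      using idl.subspace_diff[OF n F(3) H(4)] by (simp add: isF_def)
    then show ?thesis by blast
  qed
  then have "\<exists>F. isF F d"
    unfolding d_def by (rule LeastI_ex)
  then obtain F where "isF F d" ..
  then have F: "F \<in> polys_over B" "degree F \<le> d" "coeff F d \<notin> n" "poly F x \<in> n"
    by (simp_all add: isF_def)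
  define r where "r = coeff F d"
  have r: "r \<in> B" "r \<notin> n"
    using F by (simp_all add: r_def polys_overD)
  have d_le: "d \<le> e" if "isF H e" for H e
    unfolding d_def by (rule Least_le) (use that in blast)
  \<comment> \<open>By minimality of d the powers of x below d are linearly independent over
    B/n.\<close>
  have small: "H \<in> polys_over n" if H: "H \<in> polys_over B" "poly H x \<in> n" and small: "\<And>i. i \<ge> d \<Longrightarrow> coeff H i = 0" for H
  proof (rule ccontr)
    assume "H \<notin> polys_over n"
    then obtain e H' where H': "H' \<in> polys_over B" "degree H' \<le> e" "coeff H' e \<notin> n"
      "coeff H e = coeff H' e" "poly H x - poly H' x \<in> n"
      using truncate_mod[OF n B H(1), of x] by blast
    then have "isF H' e"
      using idl.subspace_diff[OF n H(2) H'(5)] by (simp add: isF_def)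
    then have "coeff H e = 0"
      by (intro small d_le)
    then show False
      using H' idl.subspace_0[OF n] by simp
  qed
  have "d > 0"
  proof (rule ccontr)
    assume "\<not> d > 0"
    then have "F = [:r:]"
      using F(2) by (auto simp: r_def elim!: degree_eq_zeroE)
    then show False
      using F(4) r by simp
  qed
  obtain b where b: "b \<in> adjoin B x" "b \<notin> n"
    and div: "\<And>c. c \<in> adjoin B x \<Longrightarrow> c \<notin> n \<Longrightarrow> \<exists>c'\<in>adjoin B x. \<exists>M. c * c' - b ^ M \<in> n"
    using loc by (auto simp: loc_field_def)
  \<comment> \<open>Pseudo-division by F: up to a power of r, every element of B[x] has degree below
    d in x.\<close>
  have reduce: "\<exists>\<rho>\<in>polys_over B. \<exists>N. r ^ N * c - poly \<rho> x \<in> n \<and> (\<forall>i\<ge>d. coeff \<rho> i = 0)"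
    if c: "c \<in> adjoin B x" for c
  proof -
    obtain \<gamma> where \<gamma>: "\<gamma> \<in> polys_over B" "c = poly \<gamma> x"
      using c by (auto simp: adjoin_def)
    obtain N :: nat and q \<rho> where \<rho>: "q \<in> polys_over B" "\<rho> \<in> polys_over B" "smult (coeff F d ^ N) \<gamma> = q * F + \<rho>"
      "\<And>i. i \<ge> d \<Longrightarrow> coeff \<rho> i = 0" "degree q \<le> degree \<gamma> - d"
      by (rule pseudo_division[OF B F(1,2) \<open>d > 0\<close> \<gamma>(1) order_refl]) blast
    have "r ^ N * c - poly \<rho> x = poly q x * poly F x"
      using arg_cong[OF \<rho>(3), of "\<lambda>p. poly p x"] by (simp add: r_def \<gamma>(2))
    then show ?thesis
      using \<rho>(2,4) idl.subspace_scale[OF n F(4)] by metis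
  qed
  text \<open>A nonzero multiple of \<open>b\<close> of least degree in \<open>x\<close> is a constant.\<close>
  define isG where "isG = (\<lambda>G e. G \<in> polys_over B \<and> degree G \<le> e \<and> coeff G e \<notin> n \<and> e < d \<and>
    (\<exists>h\<in>adjoin B x. poly G x - b * h \<in> n))"
  have isG: "\<exists>G e'. isG G e' \<and> e' < e" if hyps: "H \<in> polys_over B" "poly H x \<notin> n" "h \<in> adjoin B x" "poly H x - b * h \<in> n"
    "\<And>i. i \<ge> e \<Longrightarrow> coeff H i = 0" "e \<le> d" for H h e
  proof -
    have "H \<notin> polys_over n"
      using hyps(2) poly_in_ideal[OF n] by blast
    then obtain e' H' where H': "H' \<in> polys_over B" "degree H' \<le> e'" "coeff H' e' \<notin> n"
      "coeff H e' = coeff H' e'" "poly H x - poly H' x \<in> n"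
      using truncate_mod[OF n B hyps(1), of x] by blast
    have "e' < e"
      using H'(3,4) hyps(5) idl.subspace_0[OF n] by (metis not_le)
    moreover have "poly H' x - b * h \<in> n"
      using idl.subspace_diff[OF n hyps(4) H'(5)] by simp
    ultimately show ?thesis
      using H'(1-3) hyps(3,6) unfolding isG_def by (intro exI[of _ H'] exI[of _ e']) auto
  qed
  define e where "e = (LEAST e. \<exists>G. isG G e)"
  have "\<exists>e G. isG G e"
  proof -
    obtain \<rho> N where \<rho>: "\<rho> \<in> polys_over B" "r ^ N * b - poly \<rho> x \<in> n" "\<forall>i\<ge>d. coeff \<rho> i = 0"
      using reduce[OF b(1)] by blast
    have "poly \<rho> x \<notin> n"
    proof
      assume "poly \<rho> x \<in> n"
      then have "r ^ N * b \<in> n"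
        using idl.subspace_add[OF n \<rho>(2)] by fastforce
      then show False
        using prime r(2) b(2) prime_idealD[OF prime \<open>1 \<notin> n\<close>] by blast
    qed
    moreover have "r ^ N \<in> adjoin B x"
      using adj[OF const_in_polys_over[OF B is_subring_power[OF B r(1), of N]]] by simp
    moreover have "poly \<rho> x - b * r ^ N \<in> n"
      using idl.subspace_neg[OF n \<rho>(2)] by (simp add: mult.commute)
    ultimately show ?thesis
      using isG[of \<rho> "r ^ N" d] \<rho> by blast
  qed
  then have "\<exists>G. isG G e"
    unfolding e_def by (rule LeastI_ex)
  then obtain G where "isG G e" ..
  then obtain h where G: "G \<in> polys_over B" "degree G \<le> e" "coeff G e \<notin> n" "e < d"
    and h: "h \<in> adjoin B x" "poly G x - b * h \<in> n"
    by (auto simp: isG_def)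
  have e_le: "e \<le> e'" if "isG H e'" for H e'
    unfolding e_def by (rule Least_le) (use that in blast)
  have Gx: "poly G x \<notin> n"
  proof
    assume "poly G x \<in> n"
    then have "isF G e"
      using G by (simp add: isF_def)
    then show False
      using d_le G(4) by fastforce
  qed
  have "e = 0"
  proof (rule ccontr)
    assume "e \<noteq> 0"
    then have "e > 0"
      by simp
    \<comment> \<open>The remainder is again a multiple of b modulo \<open>n\<close>, so it vanishes
      at x by minimality of e. Then q vanishes at x as well, and since both q and the remainder have
      degree below d, all their coefficients lie in \<open>n\<close>; hence so does the leading
      coefficient of the scaled F.\<close>
    obtain M q \<rho> where \<rho>: "q \<in> polys_over B" "\<rho> \<in> polys_over B" "smult (coeff G e ^ M) F = q * G + \<rho>"
      "\<And>i. i \<ge> e \<Longrightarrow> coeff \<rho> i = 0" "degree q \<le> d - e"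
      by (rule pseudo_division[OF B G(1,2) \<open>e > 0\<close> F(1,2)]) blast
    have eq: "coeff G e ^ M * poly F x = poly q x * poly G x + poly \<rho> x"
      using arg_cong[OF \<rho>(3), of "\<lambda>p. poly p x"] by simp
    have "poly \<rho> x \<in> n"
    proof (rule ccontr)
      assume "poly \<rho> x \<notin> n"
      moreover have "poly \<rho> x - b * (- (poly q x * h)) \<in> n"
      proof -
        have "poly \<rho> x - b * (- (poly q x * h)) = coeff G e ^ M * poly F x - poly q x * (poly G x - b * h)"
          unfolding eq by (simp add: algebra_simps)
        then show ?thesis
          using F(4) h(2) by (simp add: idl.subspace_diff[OF n] idl.subspace_scale[OF n])
      qed
      moreover have "- (poly q x * h) \<in> adjoin B x"
        by (intro is_subringD[OF is_subring_adjoin[OF B]] adj \<rho>(1) h(1))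
      ultimately have "\<exists>H e'. isG H e' \<and> e' < e"
        using isG[of \<rho> "- (poly q x * h)" e] \<rho>(2,4) G(4) by auto
      then show False
        using e_le by (meson not_le)
    qed
    then have "poly q x * poly G x \<in> n"
      using idl.subspace_diff[OF n idl.subspace_scale[OF n F(4), of "coeff G e ^ M"], of "poly \<rho> x"] by (simp add: eq)
    then have "poly q x \<in> n"
      using prime Gx by blast
    then have "q \<in> polys_over n"
      using \<rho>(1,5) \<open>e \<noteq> 0\<close> \<open>d > 0\<close> by (intro small) (auto intro!: coeff_eq_0)
    moreover have "\<rho> \<in> polys_over n"
      using \<rho>(2,4) G(4) \<open>poly \<rho> x \<in> n\<close> by (intro small) auto
    ultimately have "coeff (q * G + \<rho>) d \<in> n"
      by (auto simp: coeff_mult polys_over_def intro!: idl.subspace_add[OF n] idl.subspace_sum[OF n] ideal_mult_right[OF n])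
    then have "coeff G e ^ M * r \<in> n"
      by (simp add: r_def flip: \<rho>(3))
    then show False
      using prime r(2) G(3) prime_idealD[OF prime \<open>1 \<notin> n\<close>] by blast
  qed
  define s where "s = coeff G 0"
  have s: "s \<in> B" "s \<notin> n" "poly G x = s"
    using G \<open>e = 0\<close> by (auto simp: s_def polys_overD elim!: degree_eq_zeroE)
  \<comment> \<open>\<open>s\<close> is \<open>b * h\<close> modulo \<open>n\<close>, the multiple
    of b that became constant in x.\<close>
  show ?thesis
    unfolding loc_field_def
  proof (rule bexI[of _ "s * r"], intro ballI)
    show "s * r \<in> B - n"
      using s r prime is_subringD[OF B] by blast
  next
    fix c
    assume c: "c \<in> B - n"
    have "c \<in> adjoin B x"
      using adj[OF const_in_polys_over[OF B, of c]] c by simp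
    then obtain c' M where c': "c' \<in> adjoin B x" "c * c' - b ^ M \<in> n"
      using div c by blast
    have "c' * h ^ M \<in> adjoin B x"
      by (intro is_subringD[OF is_subring_adjoin[OF B]] is_subring_power[OF is_subring_adjoin[OF B]] c' h)
    then obtain \<rho> N where \<rho>: "\<rho> \<in> polys_over B" "r ^ N * (c' * h ^ M) - poly \<rho> x \<in> n" "\<forall>i\<ge>d. coeff \<rho> i = 0"
      using reduce by blast
    \<comment> \<open>From \<open>c * c'\<close> = \<open>b ^ M\<close> follows c*\<rho>(x) =
      \<open>s ^ M * r ^ N\<close>, all modulo \<open>n\<close>. Both sides have degree below d in
      x, so by \<open>small\<close> they agree coefficientwise, in particular in degree 0.\<close>
    define H where "H = smult c \<rho> - [:s ^ M * r ^ N:]"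
    have "poly H x = r ^ N * (h ^ M * (c * c' - b ^ M)) - r ^ N * (s ^ M - (b * h) ^ M)
        - c * (r ^ N * (c' * h ^ M) - poly \<rho> x)"
      by (simp add: H_def algebra_simps power_mult_distrib)
    also have "\<dots> \<in> n"
    proof -
      have "s ^ M - (b * h) ^ M \<in> n"
        using h(2) s(3) by (intro power_diff_in_ideal[OF n]) simp
      note idl.subspace_scale[OF n idl.subspace_scale[OF n c'(2)]] idl.subspace_scale[OF n this]
      from idl.subspace_diff[OF n idl.subspace_diff[OF n this] idl.subspace_scale[OF n \<rho>(2)]]
      show ?thesis .
    qed
    finally have Hx: "poly H x \<in> n" .
    have "H \<in> polys_over B"
      using \<rho>(1) c unfolding H_def
      by (intro is_subringD[OF BX] smult_in_polys_over B const_in_polys_over is_subringD(4)[OF B] is_subring_power s r) auto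
    then have "H \<in> polys_over n"
      using \<rho>(3) \<open>d > 0\<close> Hx
      by (intro small) (auto simp: H_def coeff_pCons split: nat.split)
    then have "coeff H 0 \<in> n"
      by (rule polys_overD)
    \<comment> \<open>The extra factor balances the exponents, to give a power of
      \<open>s * r\<close>.\<close>
    then have "s ^ N * r ^ M * (c * coeff \<rho> 0 - s ^ M * r ^ N) \<in> n"
      using idl.subspace_scale[OF n] by (simp add: H_def)
    then have "c * (coeff \<rho> 0 * s ^ N * r ^ M) - (s * r) ^ (M + N) \<in> n"
      by (simp add: algebra_simps power_add power_mult_distrib)
    moreover have "coeff \<rho> 0 * s ^ N * r ^ M \<in> B"
      by (intro is_subringD(4)[OF B] is_subring_power[OF B] polys_overD[OF \<rho>(1)] s r)
    ultimately show "\<exists>c'\<in>B. \<exists>M. c * c' - (s * r) ^ M \<in> n"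
      by blast
  qed
qed

text \<open>Zariski's lemma: the residue field of a maximal ideal is algebraic over the coefficient field.\<close>

lemma maximal_contains_univariate:
  fixes n :: "('v::finite, 'k::field) mpoly set"
  assumes n: "idl.subspace n" and "1 \<notin> n" and max: "\<And>u. u \<notin> n \<Longrightarrow> \<exists>w. u * w - 1 \<in> n"
  shows "\<exists>F\<in>polys_over (polys_in {}). F \<noteq> 0 \<and> poly F (Var v) \<in> n"
proof -
  have prime: "p \<in> n \<or> q \<in> n" if pq: "p * q \<in> n" for p q
  proof (rule ccontr)
    assume "\<not> ?thesis"
    then obtain w where w: "p * w - 1 \<in> n" and "q \<notin> n"
      using max by blast
    have "w * (p * q) - q * (p * w - 1) \<in> n"
      by (intro idl.subspace_diff[OF n] idl.subspace_scale[OF n] w pq)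
    then show False
      using \<open>q \<notin> n\<close> by (simp add: algebra_simps)
  qed
  \<comment> \<open>\<open>A\<close> collects the variables already removed. At the start R/n is a
    field, with b = 1; one variable is removed at a time until only v is left.\<close>
  have "loc_field n (polys_in (insert v W))" if "finite A" "W = UNIV - A" "v \<notin> A" for A W
    using that
  proof (induction A arbitrary: W rule: finite_induct)
    case (empty W)
    show ?case
      unfolding loc_field_def
    proof (rule bexI[of _ 1], intro ballI)
      fix c
      assume "c \<in> polys_in (insert v W) - n"
      then show "\<exists>c'\<in>polys_in (insert v W). \<exists>M. c * c' - 1 ^ M \<in> n"
        using max[of c] empty by (auto simp: insert_UNIV)
    qed (use \<open>1 \<notin> n\<close> empty in \<open>auto simp: insert_UNIV\<close>)
  next
    case (insert w A W)
    have 1: "insert v (UNIV - A) = insert w (insert v W)" and 2: "insert v W - {w} = insert v W"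
      using insert.hyps insert.prems by auto
    have "loc_field n (polys_in (insert v (UNIV - A)))"
      by (rule insert.IH) (use insert.prems in simp_all)
    then have "loc_field n (adjoin (polys_in (insert v W)) (Var w))"
      unfolding 1 polys_in_insert_eq_adjoin[of w] 2 .
    then show ?case
      by (rule loc_field_of_adjoin[OF n _ \<open>1 \<notin> n\<close> is_subring_polys_in, rotated]) (rule prime)
  qed
  from this[of "- {v}" "{v}"] have "loc_field n (polys_in (insert v {}))"
    by simp
  then have "loc_field n (adjoin (polys_in {}) (Var v))"
    unfolding polys_in_insert_eq_adjoin by simp
  then obtain F where F: "F \<in> polys_over (polys_in {})" "F \<notin> polys_over n" "poly F (Var v) \<in> n"
    using loc_field_adjoin_imp_algebraic[OF n prime \<open>1 \<notin> n\<close> is_subring_polys_in] by blast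
  then show ?thesis
    using idl.subspace_0[OF n] by (intro bexI[of _ F]) (auto simp: polys_over_def)
qed


section \<open>Hilbert's basis theorem\<close>

text \<open>Ideals relative to a subring, as the induction on the variables passes through smaller
  polynomial rings inside the same type. Negatives are covered because -1 lies in a subring.\<close>

definition ideal_of :: "'a::comm_ring_1 set \<Rightarrow> 'a set \<Rightarrow> bool" where
  "ideal_of B J \<longleftrightarrow> J \<subseteq> B \<and> 0 \<in> J \<and> (\<forall>x\<in>J. \<forall>y\<in>J. x + y \<in> J) \<and> (\<forall>b\<in>B. \<forall>x\<in>J. b * x \<in> J)"

definition ideal_gen :: "'a::comm_ring_1 set \<Rightarrow> 'a set \<Rightarrow> 'a set" where
  "ideal_gen B A = \<Inter> {J. ideal_of B J \<and> A \<subseteq> J}"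

definition noetherian_subring :: "'a::comm_ring_1 set \<Rightarrow> bool" where
  "noetherian_subring B \<longleftrightarrow> (\<forall>J. ideal_of B J \<longrightarrow> (\<exists>A. finite A \<and> A \<subseteq> J \<and> J \<subseteq> ideal_gen B A))"

lemma ideal_of_self: "is_subring B \<Longrightarrow> ideal_of B B"
  by (auto simp: ideal_of_def is_subringD)

lemma ideal_gen_ideal: "is_subring B \<Longrightarrow> A \<subseteq> B \<Longrightarrow> ideal_of B (ideal_gen B A)"
  unfolding ideal_of_def[of B "ideal_gen B A"]
proof (intro conjI ballI)
  assume "is_subring B" "A \<subseteq> B"
  then show "ideal_gen B A \<subseteq> B"
    using ideal_of_self[of B] unfolding ideal_gen_def by blast
qed (auto simp: ideal_gen_def ideal_of_def)

lemma ideal_gen_superset: "A \<subseteq> ideal_gen B A"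
  by (auto simp: ideal_gen_def)

lemma ideal_gen_minimal: "ideal_of B J \<Longrightarrow> A \<subseteq> J \<Longrightarrow> ideal_gen B A \<subseteq> J"
  by (auto simp: ideal_gen_def)

lemma ideal_gen_mono: "A \<subseteq> A' \<Longrightarrow> ideal_gen B A \<subseteq> ideal_gen B A'"
  by (auto simp: ideal_gen_def)

lemma ideal_ofD:
  assumes "ideal_of B J"
  shows "J \<subseteq> B" "0 \<in> J" "\<And>x y. x \<in> J \<Longrightarrow> y \<in> J \<Longrightarrow> x + y \<in> J" "\<And>b x. b \<in> B \<Longrightarrow> x \<in> J \<Longrightarrow> b * x \<in> J"
  using assms by (auto simp: ideal_of_def)

lemma ideal_of_diff:
  assumes "is_subring B" "ideal_of B J" "x \<in> J" "y \<in> J"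
  shows "x - y \<in> J"
  using ideal_ofD(3)[OF assms(2,3) ideal_ofD(4)[OF assms(2) is_subringD(5)[OF assms(1) is_subringD(2)[OF assms(1)]] assms(4)]]
  by simp

text \<open>The union of the ideals generated by initial segments has finitely many generators,
  which all occur at some finite stage.\<close>

lemma noetherian_subring_sequence:
  assumes B: "is_subring B" and "noetherian_subring B" and a: "\<And>i::nat. a i \<in> B"
  shows "\<exists>N. a N \<in> ideal_gen B (a ` {..<N})"
proof -
  let ?U = "\<Union>N. ideal_gen B (a ` {..<N})"
  have id: "ideal_of B (ideal_gen B (a ` S))" for S
    using a by (intro ideal_gen_ideal B) auto
  have mono: "ideal_gen B (a ` {..<i}) \<subseteq> ideal_gen B (a ` {..<max i j})" "ideal_gen B (a ` {..<j}) \<subseteq> ideal_gen B (a ` {..<max i j})" for i j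
    by (intro ideal_gen_mono image_mono; auto)+
  have U: "ideal_of B ?U"
    unfolding ideal_of_def
  proof (intro conjI ballI)
    show "?U \<subseteq> B"
      using ideal_ofD(1)[OF id] by blast
    show "0 \<in> ?U"
      using ideal_ofD(2)[OF id] by blast
    fix y assume "y \<in> ?U"
    then obtain i where i: "y \<in> ideal_gen B (a ` {..<i})" by blast
    show "b * y \<in> ?U" if "b \<in> B" for b
      using ideal_ofD(4)[OF id that i] by blast
    fix z assume "z \<in> ?U"
    then obtain j where "z \<in> ideal_gen B (a ` {..<j})" by blast
    then have "y + z \<in> ideal_gen B (a ` {..<max i j})"
      using i by (intro ideal_ofD(3)[OF id]) (rule subsetD[OF mono(1)] subsetD[OF mono(2)], assumption)+
    then show "y + z \<in> ?U"
      by blast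
  qed
  then obtain A where A: "finite A" "A \<subseteq> ?U" "?U \<subseteq> ideal_gen B A"
    using \<open>noetherian_subring B\<close> by (auto simp: noetherian_subring_def)
  have "\<exists>N. A \<subseteq> ideal_gen B (a ` {..<N})"
    using A(1,2)
  proof (induction A rule: finite_induct)
    case (insert y A)
    then obtain i j where "A \<subseteq> ideal_gen B (a ` {..<i})" "y \<in> ideal_gen B (a ` {..<j})"
      by auto
    then show ?case
      using mono(1)[of i j] mono(2)[of j i] by (intro exI[of _ "max i j"]) blast
  qed simp
  then obtain N where "A \<subseteq> ideal_gen B (a ` {..<N})" ..
  then have "?U \<subseteq> ideal_gen B (a ` {..<N})"
    using ideal_gen_minimal[OF id] A(3) by blast
  moreover have "a N \<in> ?U"
    using ideal_gen_superset[of "a ` {..<Suc N}" B] by blast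
  ultimately show ?thesis by blast
qed

text \<open>Hilbert's argument: from an ideal without finite generation choose successively elements
  of least degree outside the ideal of the earlier ones. Some leading coefficient lies in the ideal
  of the earlier ones, and cancelling it contradicts minimality.\<close>

lemma noetherian_subring_adjoin:
  fixes x :: "'a::comm_ring_1"
  assumes B: "is_subring B" and "noetherian_subring B"
  shows "noetherian_subring (adjoin B x)"
proof (rule ccontr)
  assume "\<not> noetherian_subring (adjoin B x)"
  then obtain J where J: "ideal_of (adjoin B x) J"
    and not_fg: "\<And>A. finite A \<Longrightarrow> A \<subseteq> J \<Longrightarrow> \<not> J \<subseteq> ideal_gen (adjoin B x) A"
    by (auto simp: noetherian_subring_def)
  let ?R = "adjoin B x"
  note R = is_subring_adjoin[OF B, of x] and BX = is_subringD[OF is_subring_polys_over[OF B]]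
  \<comment> \<open>x may satisfy relations over B, so an element has many representing polynomials;
    \<open>deg\<close> takes the least possible degree bound.\<close>
  define rep where "rep = (\<lambda>y d p. p \<in> polys_over B \<and> degree p \<le> d \<and> y = poly p x)"
  define deg where "deg = (\<lambda>y. LEAST d. \<exists>p. rep y d p)"
  have rep: "\<exists>p. rep y (deg y) p" if "y \<in> ?R" for y
  proof -
    have "\<exists>d p. rep y d p"
      using that by (auto simp: rep_def adjoin_def)
    then show ?thesis
      unfolding deg_def by (rule LeastI_ex)
  qed
  have deg_le: "deg y \<le> d" if "rep y d p" for y d p
    unfolding deg_def by (rule Least_le) (use that in blast)
  define good where "good = (\<lambda>f (n::nat) y. y \<in> J - ideal_gen ?R (f ` {..<n}) \<and>
    (\<forall>z\<in>J - ideal_gen ?R (f ` {..<n}). deg y \<le> deg z))"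
  have "\<exists>f. \<forall>n. good f n (f n)"
  proof (rule dependent_wf_choice[OF wf_less])
    show "good f n y = good g n y" if "\<And>m. (m, n) \<in> {(x, y). x < y} \<Longrightarrow> f m = g m" for f g n y
    proof -
      have "f ` {..<n} = g ` {..<n}"
        using that by (intro image_cong) auto
      then show ?thesis by (simp add: good_def)
    qed
  next
    fix n f
    assume "\<And>m. (m, n) \<in> {(x, y). x < y} \<Longrightarrow> good f m (f m)"
    then have "f ` {..<n} \<subseteq> J"
      by (auto simp: good_def)
    then have "J - ideal_gen ?R (f ` {..<n}) \<noteq> {}"
      using not_fg[of "f ` {..<n}"] by blast
    then obtain y where "y \<in> J - ideal_gen ?R (f ` {..<n})"
      by blast
    then show "\<exists>y. good f n y"
      unfolding good_def Ball_def
      by (rule ex_has_least_nat[of "\<lambda>y. y \<in> J - ideal_gen ?R (f ` {..<n})" y deg])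
  qed
  then obtain f where f: "\<And>n. good f n (f n)" by blast
  have fJ: "f n \<in> J" and f_new: "f n \<notin> ideal_gen ?R (f ` {..<n})"
    and f_min: "\<And>z. z \<in> J \<Longrightarrow> z \<notin> ideal_gen ?R (f ` {..<n}) \<Longrightarrow> deg (f n) \<le> deg z" for n
    using f[of n] by (auto simp: good_def)
  have fR: "f n \<in> ?R" for n
    using fJ ideal_ofD(1)[OF J] by blast
  have deg_mono: "deg (f i) \<le> deg (f n)" if "i \<le> n" for i n
    using that ideal_gen_mono[of "f ` {..<i}" "f ` {..<n}" ?R] by (intro f_min fJ) (use f_new in fastforce)
  obtain p where p: "\<And>n. rep (f n) (deg (f n)) (p n)"
    using rep[OF fR] by metis
  define a where "a = (\<lambda>n. coeff (p n) (deg (f n)))"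
  have a: "a n \<in> B" for n
    using p[of n] by (auto simp: a_def rep_def polys_overD)
  obtain N where N: "a N \<in> ideal_gen B (a ` {..<N})"
    using noetherian_subring_sequence[OF B \<open>noetherian_subring B\<close>, of a] a by blast
  have genR: "ideal_of ?R (ideal_gen ?R (f ` {..<N}))"
    using fR by (intro ideal_gen_ideal R) blast
  \<comment> \<open>The coefficients in degree \<open>deg (f N)\<close> that the ideal of the
    earlier elements can produce. It contains each earlier leading coefficient, since degrees do not
    decrease and a power of x makes up the difference.\<close>
  define L where "L = {c \<in> B. \<exists>y\<in>ideal_gen ?R (f ` {..<N}). \<exists>q. rep y (deg (f N)) q \<and> coeff q (deg (f N)) = c}"
  have "ideal_of B L"
    unfolding ideal_of_def
  proof (intro conjI ballI)
    show "L \<subseteq> B" by (auto simp: L_def)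
    show "0 \<in> L"
      unfolding L_def using ideal_ofD(2)[OF genR] is_subringD(1)[OF B] BX(1)
      by (auto simp: rep_def intro!: bexI[of _ 0] exI[of _ 0])
  next
    fix c c' assume "c \<in> L" "c' \<in> L"
    then obtain y q y' q' where "c \<in> B" "c' \<in> B" "y \<in> ideal_gen ?R (f ` {..<N})" "rep y (deg (f N)) q" "coeff q (deg (f N)) = c"
      "y' \<in> ideal_gen ?R (f ` {..<N})" "rep y' (deg (f N)) q'" "coeff q' (deg (f N)) = c'"
      by (auto simp: L_def)
    then show "c + c' \<in> L"
      unfolding L_def
      using ideal_ofD(3)[OF genR, of y y'] is_subringD(3)[OF B, of c c'] BX(3)[of q q']
      by (auto simp: rep_def intro!: bexI[of _ "y + y'"] exI[of _ "q + q'"] degree_add_le)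
  next
    fix b c assume "b \<in> B" "c \<in> L"
    then obtain y q where "c \<in> B" "y \<in> ideal_gen ?R (f ` {..<N})" "rep y (deg (f N)) q" "coeff q (deg (f N)) = c"
      by (auto simp: L_def)
    moreover have "b \<in> ?R"
      unfolding adjoin_def by (rule image_eqI[of _ _ "[:b:]"]) (auto simp: const_in_polys_over B \<open>b \<in> B\<close>)
    ultimately show "b * c \<in> L"
      unfolding L_def
      using ideal_ofD(4)[OF genR, of b y] is_subringD(4)[OF B, of b c] smult_in_polys_over[OF B \<open>b \<in> B\<close>, of q] \<open>b \<in> B\<close>
      by (auto simp: rep_def intro!: bexI[of _ "b * y"] exI[of _ "smult b q"] order_trans[OF degree_smult_le])
  qed
  moreover have "a i \<in> L" if "i < N" for i
  proof -
    let ?q = "monom 1 (deg (f N) - deg (f i)) * p i"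
    have d: "deg (f i) \<le> deg (f N)"
      using that by (intro deg_mono) simp
    have pi: "p i \<in> polys_over B" "degree (p i) \<le> deg (f i)" "f i = poly (p i) x"
      using p[of i] by (auto simp: rep_def)
    have m: "monom 1 (deg (f N) - deg (f i)) \<in> polys_over B"
      by (intro monom_in_polys_over B is_subringD)
    have "rep (poly (monom 1 (deg (f N) - deg (f i))) x * f i) (deg (f N)) ?q"
      unfolding rep_def
    proof (intro conjI)
      show "?q \<in> polys_over B"
        by (intro BX pi m)
      have "degree ?q \<le> deg (f N) - deg (f i) + deg (f i)"
        by (intro order_trans[OF degree_mult_le] add_mono degree_monom_le pi)
      then show "degree ?q \<le> deg (f N)"
        using d by simp
    qed (simp add: pi)
    moreover have "coeff ?q (deg (f N)) = a i"
      using d by (simp add: coeff_monom_mult a_def)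
    moreover have "poly (monom 1 (deg (f N) - deg (f i))) x * f i \<in> ideal_gen ?R (f ` {..<N})"
      using ideal_gen_superset[of "f ` {..<N}" ?R] that m by (intro ideal_ofD(4)[OF genR]) (auto simp: adjoin_def)
    ultimately show ?thesis
      unfolding L_def using a by blast
  qed
  ultimately have "ideal_gen B (a ` {..<N}) \<subseteq> L"
    by (intro ideal_gen_minimal) auto
  then obtain y q where y: "y \<in> ideal_gen ?R (f ` {..<N})" and q: "rep y (deg (f N)) q" "coeff q (deg (f N)) = a N"
    using N by (auto simp: L_def)
  have "y \<in> J"
    using y ideal_gen_minimal[OF J, of "f ` {..<N}"] fJ by blast
  then have "f N - y \<in> J"
    using ideal_of_diff[OF R J fJ] by blast
  moreover have notin: "f N - y \<notin> ideal_gen ?R (f ` {..<N})"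
    using ideal_ofD(3)[OF genR _ y, of "f N - y"] f_new[of N] by auto
  ultimately have le: "deg (f N) \<le> deg (f N - y)"
    by (rule f_min)
  have P: "p N - q \<in> polys_over B" "f N - y = poly (p N - q) x" "degree (p N - q) \<le> deg (f N)" "coeff (p N - q) (deg (f N)) = 0"
    using p[of N] q by (auto simp: rep_def a_def intro: BX degree_diff_le)
  \<comment> \<open>In degree 0 no smaller degree exists, but there the cancelled representative is
    0 and lies in the ideal outright.\<close>
  show False
  proof (cases "deg (f N) = 0")
    case True
    then have "p N - q = 0"
      using P(3,4) by (metis bot_nat_0.extremum_uniqueI leading_coeff_0_iff)
    then show False
      using P(2) notin ideal_ofD(2)[OF genR] by (metis poly_0)
  next
    case False
    then have "degree (p N - q) < deg (f N)"
      using P(3,4) by (metis eq_zero_or_degree_less degree_0 neq0_conv)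
    then have "rep (f N - y) (deg (f N) - 1) (p N - q)"
      using P by (auto simp: rep_def)
    then show False
      using deg_le le False by fastforce
  qed
qed

lemma noetherian_subring_polys_in:
  fixes W :: "'v::finite set"
  shows "noetherian_subring (polys_in W :: ('v, 'k::field) mpoly set)"
  using finite[of W]
proof (induction W rule: finite_induct)
  case empty
  show ?case
    unfolding noetherian_subring_def
  proof (intro allI impI)
    fix J :: "('v, 'k) mpoly set"
    assume J: "ideal_of (polys_in {}) J"
    show "\<exists>A. finite A \<and> A \<subseteq> J \<and> J \<subseteq> ideal_gen (polys_in {}) A"
    proof (cases "J \<subseteq> {0}")
      case True
      have "0 \<in> ideal_gen (polys_in {}) {}"
        by (rule ideal_ofD(2)[OF ideal_gen_ideal[OF is_subring_polys_in]]) simp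
      then show ?thesis
        using True by (intro exI[of _ "{}"]) auto
    next
      case False
      then obtain y where y: "y \<in> J" "y \<noteq> 0" by blast
      then obtain c where c: "y = cst c"
        using ideal_ofD(1)[OF J] polys_in_empty by blast
      have "z \<in> ideal_gen (polys_in {}) {y}" if z: "z \<in> J" for z
      proof -
        obtain d where d: "z = cst d"
          using ideal_ofD(1)[OF J] polys_in_empty z by blast
        have "cst (d / c) * y = z"
          using y(2) by (simp add: c d flip: cst_mult)
        moreover have "cst (d / c) * y \<in> ideal_gen (polys_in {}) {y}"
          using ideal_gen_superset[of "{y}" "polys_in {}"]
          by (intro ideal_ofD(4)[OF ideal_gen_ideal[OF is_subring_polys_in]]) (auto simp: c)
        ultimately show ?thesis by simp
      qed
      then show ?thesis
        using y by (intro exI[of _ "{y}"]) auto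
    qed
  qed
next
  case (insert w W)
  then have "noetherian_subring (adjoin (polys_in W) (Var w) :: ('v, 'k) mpoly set)"
    by (intro noetherian_subring_adjoin is_subring_polys_in)
  moreover have "W - {w} = W"
    using insert by auto
  ultimately show ?case
    by (simp add: polys_in_insert_eq_adjoin)
qed

lemma mpoly_ideal_fg:
  fixes J :: "('v::finite, 'k::field) mpoly set"
  assumes "idl.subspace J"
  shows "\<exists>A. finite A \<and> J = idl.span A"
proof -
  have *: "ideal_of UNIV J \<longleftrightarrow> idl.subspace J" for J :: "('v, 'k) mpoly set"
    by (auto simp: ideal_of_def idl.subspace_def)
  obtain A where A: "finite A" "A \<subseteq> J" "J \<subseteq> ideal_gen UNIV A"
    using noetherian_subring_polys_in[of "UNIV :: 'v set", where 'k = 'k] assms *[of J] unfolding noetherian_subring_def polys_in_UNIV by blast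
  have "ideal_gen UNIV A \<subseteq> idl.span A"
    by (rule ideal_gen_minimal) (auto simp: * idl.span_base)
  moreover have "idl.span A \<subseteq> J"
    using A(2) assms by (rule idl.span_minimal)
  ultimately show ?thesis
    using A by (intro exI[of _ A]) auto
qed


section \<open>Length of chains of primes\<close>

definition is_prime_ideal :: "'a::comm_ring_1 set \<Rightarrow> bool" where
  "is_prime_ideal Q \<longleftrightarrow> idl.subspace Q \<and> 1 \<notin> Q \<and> (\<forall>p q. p * q \<in> Q \<longrightarrow> p \<in> Q \<or> q \<in> Q)"

lemma is_prime_idealD:
  assumes "is_prime_ideal Q"
  shows "idl.subspace Q" "1 \<notin> Q" "\<And>p q. p * q \<in> Q \<Longrightarrow> p \<in> Q \<or> q \<in> Q"
  using assms by (auto simp: is_prime_ideal_def)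

definition indep_mod :: "('v, 'k::field) mpoly set \<Rightarrow> 'i set \<Rightarrow> ('i \<Rightarrow> ('v, 'k) mpoly) \<Rightarrow> bool" where
  "indep_mod Q I u \<longleftrightarrow> (\<forall>c. (\<Sum>i\<in>I. cst (c i) * u i) \<in> Q \<longrightarrow> (\<forall>i\<in>I. c i = 0))"

fun power_prod :: "'a::comm_ring_1 list \<Rightarrow> nat list \<Rightarrow> 'a" where
  "power_prod (y # ys) (k # ks) = y ^ k * power_prod ys ks"
| "power_prod _ _ = 1"

definition box :: "nat \<Rightarrow> nat \<Rightarrow> nat list set" where
  "box N m = {ks. set ks \<subseteq> {..<N} \<and> length ks = m}"

lemma finite_box [simp]: "finite (box N m)"
  unfolding box_def by (rule finite_lists_length_eq) simp

lemma card_box: "card (box N m) = N ^ m"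
  unfolding box_def by (subst card_lists_length_eq) simp_all

lemma sum_box_Suc: "(\<Sum>ks\<in>box N (Suc m). f ks) = (\<Sum>k<N. \<Sum>ks\<in>box N m. f (k # ks))"
proof -
  have "box N (Suc m) = (\<lambda>(k, ks). k # ks) ` ({..<N} \<times> box N m)"
    by (auto simp: box_def length_Suc_conv image_iff)
  moreover have "inj_on (\<lambda>(k, ks). k # ks) ({..<N} \<times> box N m)"
    by (auto simp: inj_on_def)
  ultimately show ?thesis
    by (simp add: sum.reindex sum.cartesian_product case_prod_unfold)
qed

lemma unit_not_in_prime:
  assumes "is_prime_ideal Q" "cst c \<in> Q"
  shows "c = 0"
proof (rule ccontr)
  assume "c \<noteq> 0"
  then have "cst (inverse c) * cst c = 1"
    by (simp flip: cst_mult)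
  then show False
    using idl.subspace_scale[OF is_prime_idealD(1)[OF assms(1)] assms(2)] is_prime_idealD(2)[OF assms(1)] by metis
qed

text \<open>Modulo Q' only the terms with k = 0 survive, so their coefficients vanish; the remaining
  sum is divisible by y, which cancels modulo the prime Q.\<close>

lemma indep_mod_powers:
  assumes Q: "is_prime_ideal Q" and Q': "is_prime_ideal Q'" and "Q \<subseteq> Q'" "y \<in> Q'" "y \<notin> Q"
    and indep: "indep_mod Q' I u" and "(\<Sum>k<N. \<Sum>i\<in>I. cst (c k i) * (y ^ k * u i)) \<in> Q"
  shows "\<forall>k<N. \<forall>i\<in>I. c k i = 0"
  using assms(7)
proof (induction N arbitrary: c)
  case (Suc N)
  let ?G = "\<Sum>i\<in>I. cst (c 0 i) * u i" and ?H = "\<Sum>k<N. \<Sum>i\<in>I. cst (c (Suc k) i) * (y ^ k * u i)"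
  have "(\<Sum>k<Suc N. \<Sum>i\<in>I. cst (c k i) * (y ^ k * u i)) = ?G + y * ?H"
    by (simp only: sum.lessThan_Suc_shift) (simp add: sum_distrib_left mult_ac)
  then have GH: "?G + y * ?H \<in> Q"
    using Suc.prems by simp
  have "?G + y * ?H - y * ?H \<in> Q'"
    using GH assms(3,4) by (intro idl.subspace_diff[OF is_prime_idealD(1)[OF Q']] ideal_mult_right[OF is_prime_idealD(1)[OF Q']]) auto
  then have c0: "\<forall>i\<in>I. c 0 i = 0"
    using indep by (simp add: indep_mod_def)
  then have "y * ?H \<in> Q"
    using GH by simp
  then have "?H \<in> Q"
    using is_prime_idealD(3)[OF Q] assms(5) by blast
  then have "\<forall>k<N. \<forall>i\<in>I. c (Suc k) i = 0"
    by (rule Suc.IH)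
  then show ?case
    using c0 by (auto simp: less_Suc_eq_0_disj)
qed simp

text \<open>One element from each strict step of the chain gives a family that is algebraically
  independent modulo the bottom prime.\<close>

lemma indep_mod_chain:
  assumes "\<And>i. i \<le> length ys \<Longrightarrow> is_prime_ideal (Q i)"
    and "\<And>i. i < length ys \<Longrightarrow> Q i \<subseteq> Q (Suc i) \<and> ys ! i \<in> Q (Suc i) - Q i"
  shows "indep_mod (Q 0) (box N (length ys)) (power_prod ys)"
  using assms
proof (induction ys arbitrary: Q)
  case Nil
  have "box N 0 = {[]}"
    by (auto simp: box_def)
  then show ?case
    using unit_not_in_prime[of "Q 0"] Nil by (auto simp: indep_mod_def)
next
  case (Cons y ys)
  have IH: "indep_mod (Q (Suc 0)) (box N (length ys)) (power_prod ys)"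
  proof (rule Cons.IH[of "\<lambda>i. Q (Suc i)"])
    fix i assume "i < length ys"
    then show "Q (Suc i) \<subseteq> Q (Suc (Suc i)) \<and> ys ! i \<in> Q (Suc (Suc i)) - Q (Suc i)"
      using Cons.prems(2)[of "Suc i"] by simp
  qed (use Cons.prems(1) in auto)
  show ?case
    unfolding indep_mod_def
  proof (intro allI impI ballI)
    fix c ks
    assume *: "(\<Sum>ks\<in>box N (length (y # ys)). cst (c ks) * power_prod (y # ys) ks) \<in> Q 0"
      and ks: "ks \<in> box N (length (y # ys))"
    obtain k ks' where ks': "ks = k # ks'" "k < N" "ks' \<in> box N (length ys)"
      using ks by (auto simp: box_def length_Suc_conv)
    have "\<forall>k<N. \<forall>ks\<in>box N (length ys). c (k # ks) = 0"
    proof (rule indep_mod_powers[OF _ _ _ _ _ IH])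
      show "(\<Sum>k<N. \<Sum>i\<in>box N (length ys). cst (c (k # i)) * (y ^ k * power_prod ys i)) \<in> Q 0"
        using * by (simp add: sum_box_Suc)
    qed (use Cons.prems(1)[of 0] Cons.prems(1)[of 1] Cons.prems(2)[of 0] in auto)
    then show "c ks = 0"
      using ks' by blast
  qed
qed

text \<open>A bound on each exponent separately, not on the total degree: this matches a box of
  monomials, which is counted by a plain power.\<close>

definition exp_le :: "nat \<Rightarrow> ('v, 'k::field) mpoly set" where
  "exp_le \<delta> = {p. \<forall>a\<in>keys p. \<forall>v. lookup a v \<le> \<delta>}"

lemma exp_le_mult: "p \<in> exp_le \<delta> \<Longrightarrow> q \<in> exp_le \<epsilon> \<Longrightarrow> p * q \<in> exp_le (\<delta> + \<epsilon>)"
  using keys_mult[of p q] by (fastforce simp: exp_le_def lookup_add intro: add_mono)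

lemma exp_le_power: "p \<in> exp_le \<delta> \<Longrightarrow> p ^ n \<in> exp_le (n * \<delta>)"
proof (induction n)
  case 0
  show ?case by (simp add: exp_le_def)
next
  case (Suc n)
  then show ?case
    using exp_le_mult[of p \<delta> "p ^ n" "n * \<delta>"] by simp
qed

lemma exp_le_mono: "p \<in> exp_le \<delta> \<Longrightarrow> \<delta> \<le> \<epsilon> \<Longrightarrow> p \<in> exp_le \<epsilon>"
  unfolding exp_le_def by (blast intro: order_trans)

lemma exp_le_exists:
  fixes p :: "('v::finite, 'k::field) mpoly"
  shows "\<exists>\<delta>. p \<in> exp_le \<delta>"
proof -
  let ?S = "(\<lambda>(a, v). lookup a v) ` (keys p \<times> UNIV)"
  have "finite ?S" by simp
  then have "p \<in> exp_le (Max ?S)"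
    by (auto simp: exp_le_def intro!: Max_ge)
  then show ?thesis ..
qed

lemma exp_le_power_prod:
  assumes "\<And>y. y \<in> set ys \<Longrightarrow> y \<in> exp_le \<delta>" "ks \<in> box N (length ys)"
  shows "power_prod ys ks \<in> exp_le (length ys * (N * \<delta>))"
  using assms
proof (induction ys ks rule: power_prod.induct)
  case (1 y ys k ks)
  have "power_prod ys ks \<in> exp_le (length ys * (N * \<delta>))"
    using 1 by (auto simp: box_def)
  moreover have "y ^ k \<in> exp_le (N * \<delta>)"
    using 1 by (intro exp_le_mono[OF exp_le_power[of y \<delta> k]]) (auto simp: box_def)
  ultimately show ?case
    using exp_le_mult[of "y ^ k" "N * \<delta>" "power_prod ys ks" "length ys * (N * \<delta>)"] by simp
qed (simp_all add: exp_le_def)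

lemma power_prod_hom:
  "power_prod (map (subst cst \<sigma>) ys) ks = subst cst \<sigma> (power_prod ys ks)"
proof -
  have pow: "subst cst \<sigma> (p ^ n) = subst cst \<sigma> p ^ n" for p n
    by (induction n) simp_all
  show ?thesis
    by (induction ys ks rule: power_prod.induct) (simp_all add: pow)
qed

interpretation vs: vector_space "\<lambda>c p. cst c * p :: ('v, 'k::field) mpoly"
  by unfold_locales (simp_all add: algebra_simps cst_add cst_mult)

text \<open>The library speaks of independent sets and would not notice repeated members of a
  family; injectivity of \<open>u\<close> is therefore extracted from independence first.\<close>

lemma indep_mod_zero_card_le:
  assumes indep: "indep_mod {0} I u" and I: "finite I" and T: "finite T" and "u ` I \<subseteq> vs.span T"
  shows "card I \<le> card T"
proof -
  have inj: "inj_on u I"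
  proof (rule inj_onI, rule ccontr)
    fix i j
    assume ij: "i \<in> I" "j \<in> I" "u i = u j" "i \<noteq> j"
    let ?c = "\<lambda>l. (if l = i then 1 else 0) - (if l = j then 1 else 0 :: 'b)"
    have "(cst (- 1) :: ('a, 'b) mpoly) = - 1"
      using cst_add[of 1 "- 1 :: 'b"] by (simp add: eq_neg_iff_add_eq_0 add.commute)
    then have "cst (?c l) * u l = (if l = i then u l else 0) - (if l = j then u l else 0)" for l
      by auto
    then have "(\<Sum>l\<in>I. cst (?c l) * u l) = 0"
      using ij I by (simp add: sum_subtractf sum.delta)
    then have "\<forall>l\<in>I. ?c l = 0"
      using indep[unfolded indep_mod_def, THEN spec, of ?c] by simp
    from bspec[OF this ij(1)] show False
      using ij(4) by simp
  qed
  have "vs.independent (u ` I)"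
  proof (subst vs.independent_explicit_finite_subsets, intro allI impI ballI)
    fix A c v
    assume A: "A \<subseteq> u ` I" "finite A" "(\<Sum>v\<in>A. cst (c v) * v) = 0" "v \<in> A"
    let ?c = "\<lambda>i. if u i \<in> A then c (u i) else 0"
    have "(\<Sum>i\<in>I. cst (?c i) * u i) = (\<Sum>w\<in>u ` I. cst (if w \<in> A then c w else 0) * w)"
      by (simp add: sum.reindex[OF inj])
    also have "\<dots> = (\<Sum>w\<in>A. cst (if w \<in> A then c w else 0) * w)"
      using A(1) I by (intro sum.mono_neutral_right) auto
    also have "\<dots> = 0"
      using A(3) by simp
    finally have "\<forall>i\<in>I. ?c i = 0"
      using indep[unfolded indep_mod_def, THEN spec, of ?c] by simp
    then show "c v = 0"
      using A(1,4) by force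
  qed
  then have "card (u ` I) \<le> card T"
    using vs.independent_span_bound[OF T _ assms(4)] by blast
  then show ?thesis
    by (simp add: card_image[OF inj])
qed

lemma card_exponents_le:
  fixes V :: "'v::finite set" and \<delta> :: nat
  defines "E \<equiv> {a :: 'v \<Rightarrow>\<^sub>0 nat. keys a \<subseteq> V \<and> (\<forall>v. lookup a v \<le> \<delta>)}"
  shows "finite E" "card E \<le> (\<delta> + 1) ^ card V"
proof -
  let ?F = "PiE V (\<lambda>_. {..\<delta>})"
  have inj: "inj_on (\<lambda>a. restrict (lookup a) V) E"
  proof (rule inj_onI, rule poly_mapping_eqI)
    fix a b v
    assume ab: "a \<in> E" "b \<in> E" "restrict (lookup a) V = restrict (lookup b) V"
    show "lookup a v = lookup b v"
    proof (cases "v \<in> V")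
      case True
      then show ?thesis
        using fun_cong[OF ab(3), of v] by simp
    next
      case False
      then have "v \<notin> keys a" "v \<notin> keys b"
        using ab(1,2) by (auto simp: E_def)
      then show ?thesis
        by (simp add: in_keys_iff)
    qed
  qed
  have im: "(\<lambda>a. restrict (lookup a) V) ` E \<subseteq> ?F"
    by (auto simp: E_def)
  have fin: "finite ?F"
    by (simp add: finite_PiE)
  show "finite E"
    using inj_on_finite[OF inj im fin] .
  show "card E \<le> (\<delta> + 1) ^ card V"
    using card_inj_on_le[OF inj im fin] by (simp add: card_PiE)
qed

lemma subst_kill_in_polys_in:
  fixes p :: "('v::finite, 'k::field) mpoly"
  shows "subst cst (\<lambda>v. if v \<in> C then 0 else Var v) p \<in> polys_in (- C)"
  by (induction p rule: mpoly_induct) (auto simp: is_subringD[OF is_subring_polys_in])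

lemma subst_kill_diff:
  fixes p :: "('v::finite, 'k::field) mpoly"
  shows "p - subst cst (\<lambda>v. if v \<in> C then 0 else Var v) p \<in> idl.span (Var ` C)"
  by (rule diff_subst_in_ideal) (auto intro: idl.span_base idl.span_zero)

text \<open>The images in \<open>K[x\<^sub>v | v \<notin> C]\<close> of the \<open>N\<^sup>r\<close> power products are linearly independent, but they
  lie in a space whose dimension is a polynomial in \<open>N\<close> of degree at most \<open>|V - C|\<close>.\<close>

lemma prime_chain_length_le:
  fixes Q :: "nat \<Rightarrow> ('v::finite, 'k::field) mpoly set"
  assumes prime: "\<And>i. i \<le> r \<Longrightarrow> is_prime_ideal (Q i)" and strict: "\<And>i. i < r \<Longrightarrow> Q i \<subset> Q (Suc i)"
    and C: "Var ` C \<subseteq> Q 0"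
  shows "r \<le> card (- C)"
proof (rule ccontr)
  assume "\<not> r \<le> card (- C)"
  then have r: "Suc (card (- C)) \<le> r"
    by simp
  have "\<forall>i<r. \<exists>y. y \<in> Q (Suc i) - Q i"
    using strict by blast
  then obtain y where y: "\<And>i. i < r \<Longrightarrow> y i \<in> Q (Suc i) - Q i"
    by metis
  define ys where "ys = map y [0..<r]"
  have ys: "length ys = r"
    by (simp add: ys_def)
  let ?\<kappa> = "subst cst (\<lambda>v. if v \<in> C then 0 else Var v) :: ('v, 'k) mpoly \<Rightarrow> _"
  define zs where "zs = map ?\<kappa> ys"
  have PC: "idl.span (Var ` C) \<subseteq> Q 0"
    using C is_prime_idealD(1)[OF prime[of 0]] by (intro idl.span_minimal) auto
  have indep: "indep_mod {0} (box N r) (power_prod zs)" for N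
    unfolding indep_mod_def
  proof (intro allI impI)
    fix c :: "nat list \<Rightarrow> 'k"
    assume "(\<Sum>ks\<in>box N r. cst (c ks) * power_prod zs ks) \<in> {0}"
    moreover have "(\<Sum>ks\<in>box N r. cst (c ks) * power_prod ys ks) - (\<Sum>ks\<in>box N r. cst (c ks) * power_prod zs ks)
        = (\<Sum>ks\<in>box N r. cst (c ks) * (power_prod ys ks - ?\<kappa> (power_prod ys ks)))"
      by (simp add: zs_def power_prod_hom algebra_simps sum_subtractf)
    moreover have "\<dots> \<in> Q 0"
      using PC subst_kill_diff[of _ C]
      by (intro idl.subspace_sum[OF is_prime_idealD(1)[OF prime[of 0]]] idl.subspace_scale[OF is_prime_idealD(1)[OF prime[of 0]]]) auto
    ultimately have "(\<Sum>ks\<in>box N r. cst (c ks) * power_prod ys ks) \<in> Q 0"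
      by simp
    moreover have "indep_mod (Q 0) (box N (length ys)) (power_prod ys)"
      using prime strict y by (intro indep_mod_chain) (auto simp: ys_def)
    ultimately show "\<forall>i\<in>box N r. c i = 0"
      by (simp add: indep_mod_def ys)
  qed
  obtain d where d: "\<And>z. z \<in> set zs \<Longrightarrow> z \<in> exp_le (d z)"
    using exp_le_exists by metis
  define \<delta> where "\<delta> = (\<Sum>z\<in>set zs. d z)"
  have \<delta>: "z \<in> exp_le \<delta>" if "z \<in> set zs" for z
    using that unfolding \<delta>_def by (intro exp_le_mono[OF d] member_le_sum) auto
  have bound: "N ^ r \<le> (r * (N * \<delta>) + 1) ^ card (- C)" for N
  proof -
    let ?E = "{a :: 'v \<Rightarrow>\<^sub>0 nat. keys a \<subseteq> - C \<and> (\<forall>v. lookup a v \<le> r * (N * \<delta>))}"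
    note E = card_exponents_le[of "- C" "r * (N * \<delta>)"]
    have "power_prod zs ks \<in> vs.span (mono_poly ` ?E)" if "ks \<in> box N r" for ks
    proof -
      let ?p = "power_prod zs ks"
      have "?p \<in> exp_le (r * (N * \<delta>))"
        using exp_le_power_prod[of zs \<delta> ks N] \<delta> that by (simp add: zs_def ys)
      moreover have "?p \<in> polys_in (- C)"
        by (simp add: zs_def power_prod_hom subst_kill_in_polys_in)
      ultimately have "keys ?p \<subseteq> ?E"
        by (auto simp: exp_le_def polys_in_def)
      then have "(\<Sum>a\<in>keys ?p. cst (lookup ?p a) * mono_poly a) \<in> vs.span (mono_poly ` ?E)"
        by (intro vs.span_sum vs.span_scale vs.span_base) auto
      then show ?thesis
        using poly_mapping_eq_sum_single[of "keys ?p" ?p] by (simp add: cst_mono_poly)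
    qed
    then have "card (box N r) \<le> card (mono_poly ` ?E :: ('v, 'k) mpoly set)"
      using E(1) by (intro indep_mod_zero_card_le[OF indep]) auto
    also have "\<dots> \<le> card ?E"
      using E(1) by (rule card_image_le)
    finally show ?thesis
      using E(2) by (simp add: card_box)
  qed
  \<comment> \<open>With c = \<open>card (- C)\<close>, the bound gives N^(c+1) \<le>
    (N*(r*\<delta>+1))^c, hence N \<le> (r*\<delta>+1)^c; this N exceeds that value by one.\<close>
  define N where "N = (r * \<delta> + 1) ^ card (- C) + 1"
  have "N > 0"
    by (simp add: N_def)
  have "N ^ Suc (card (- C)) \<le> N ^ r"
    using r \<open>N > 0\<close> by (intro power_increasing) auto
  also have "\<dots> \<le> (r * (N * \<delta>) + 1) ^ card (- C)"
    by (rule bound)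
  also have "\<dots> \<le> (N * (r * \<delta> + 1)) ^ card (- C)"
    using \<open>N > 0\<close> by (intro power_mono) (auto simp: algebra_simps)
  also have "\<dots> = (r * \<delta> + 1) ^ card (- C) * N ^ card (- C)"
    by (simp only: power_mult_distrib mult.commute)
  finally have "N * N ^ card (- C) \<le> (r * \<delta> + 1) ^ card (- C) * N ^ card (- C)"
    by (simp only: power_Suc)
  then have "N \<le> (r * \<delta> + 1) ^ card (- C)"
    by (rule mult_right_le_imp_le) (use \<open>N > 0\<close> in simp)
  then show False
    by (simp add: N_def)
qed


section \<open>Depth and dimension\<close>

text \<open>An ideal maximal among those disjoint from a multiplicative set is prime: if a and b lie
  outside it, adding either one makes it meet T, and the product of the two elements found would lie
  in T and in the ideal.\<close>

lemma (in cring) prime_avoiding_exists: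
  assumes "noetherian_ring R" "ideal I R"
    and T: "\<one> \<in> T" "T \<subseteq> carrier R" "\<And>s t. s \<in> T \<Longrightarrow> t \<in> T \<Longrightarrow> s \<otimes> t \<in> T" and "T \<inter> I = {}"
  shows "\<exists>Q. primeideal Q R \<and> I \<subseteq> Q \<and> T \<inter> Q = {}"
proof -
  interpret noetherian_ring R by fact
  define F where "F = {J. ideal J R \<and> I \<subseteq> J \<and> T \<inter> J = {}}"
  have "\<exists>M\<in>F. \<forall>X\<in>F. M \<subseteq> X \<longrightarrow> X = M"
  proof (rule subset_Zorn_nonempty)
    show "F \<noteq> {}"
      using assms by (auto simp: F_def)
    fix \<C> assume \<C>: "\<C> \<noteq> {}" "subset.chain F \<C>"
    then have "subset.chain {I. ideal I R} \<C>"
      by (auto simp: subset.chain_def F_def)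
    then have "\<Union>\<C> \<in> \<C>"
      using ideal_chain_is_trivial[OF \<C>(1)] by simp
    then show "\<Union>\<C> \<in> F"
      using \<C>(2) by (auto simp: subset.chain_def)
  qed
  then obtain Q where Q: "ideal Q R" "I \<subseteq> Q" "T \<inter> Q = {}"
    and max: "\<And>X. ideal X R \<Longrightarrow> Q \<subseteq> X \<Longrightarrow> T \<inter> X = {} \<Longrightarrow> X = Q"
    by (auto simp: F_def)
  interpret Q: ideal Q R by fact
  have grow: "\<exists>q\<in>Q. \<exists>r\<in>carrier R. q \<oplus> r \<otimes> a \<in> T" if a: "a \<in> carrier R" "a \<notin> Q" for a
  proof -
    have id: "ideal (Q <+>\<^bsub>R\<^esub> PIdl a) R"
      using a by (intro add_ideals Q cgenideal_ideal)
    have sub: "Q \<subseteq> Q <+>\<^bsub>R\<^esub> PIdl a"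
    proof
      fix q assume "q \<in> Q"
      moreover have "\<zero> \<in> PIdl a"
        using additive_subgroup.zero_closed[OF ideal.axioms(1)[OF cgenideal_ideal[OF a(1)]]] .
      ultimately show "q \<in> Q <+>\<^bsub>R\<^esub> PIdl a"
        unfolding set_add_def' using Q.Icarr by force
    qed
    have "a \<in> Q <+>\<^bsub>R\<^esub> PIdl a"
    proof -
      have "\<zero> \<oplus> a \<in> Q <+>\<^bsub>R\<^esub> PIdl a"
        unfolding set_add_def' using cgenideal_self[OF a(1)] Q.zero_closed by blast
      then show ?thesis
        using a(1) by simp
    qed
    then have "Q <+>\<^bsub>R\<^esub> PIdl a \<noteq> Q"
      using a(2) by blast
    then have "T \<inter> (Q <+>\<^bsub>R\<^esub> PIdl a) \<noteq> {}"
      using max[OF id sub] by blast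
    then show ?thesis
      by (auto simp: set_add_def' cgenideal_def)
  qed
  have "primeideal Q R"
  proof (rule primeidealI)
    show "carrier R \<noteq> Q"
      using T(1) Q(3) by auto
    fix a b
    assume ab: "a \<in> carrier R" "b \<in> carrier R" "a \<otimes> b \<in> Q"
    show "a \<in> Q \<or> b \<in> Q"
    proof (rule ccontr)
      assume "\<not> ?thesis"
      then obtain q r q' r' where *: "q \<in> Q" "r \<in> carrier R" "q \<oplus> r \<otimes> a \<in> T"
        "q' \<in> Q" "r' \<in> carrier R" "q' \<oplus> r' \<otimes> b \<in> T"
        using grow ab(1,2) by meson
      have qc: "q \<in> carrier R" "q' \<in> carrier R"
        using * Q.Icarr by auto
      have "(q \<oplus> r \<otimes> a) \<otimes> (q' \<oplus> r' \<otimes> b) = q \<otimes> (q' \<oplus> r' \<otimes> b) \<oplus> ((r \<otimes> a) \<otimes> q' \<oplus> (r \<otimes> r') \<otimes> (a \<otimes> b))"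
        using qc *(2,5) ab(1,2) by algebra
      moreover have "\<dots> \<in> Q"
        by (rule Q.a_closed[OF Q.I_r_closed Q.a_closed[OF Q.I_l_closed Q.I_l_closed]])
          (use qc *(1,2,4,5) ab in auto)
      ultimately show False
        using T(3)[OF *(3,6)] Q(3) by auto
    qed
  qed (use Q is_cring in auto)
  then show ?thesis
    using Q by blast
qed

text \<open>The products s*x^n with s outside Q form a multiplicative set. It misses J, since s*x^n
  in J would put s into J and so into Q. A prime avoiding it lies inside Q and does not contain
  x.\<close>

lemma (in cring) regular_step:
  assumes "noetherian_ring R" "ideal J R" "x \<in> carrier R" "primeideal Q R" "J \<subseteq> Q" "x \<in> Q"
    and reg: "\<And>r. r \<in> carrier R \<Longrightarrow> r \<otimes> x \<in> J \<Longrightarrow> r \<in> J"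
  shows "\<exists>Q'. primeideal Q' R \<and> J \<subseteq> Q' \<and> Q' \<subset> Q"
proof -
  interpret Q: primeideal Q R by fact
  have regn: "r \<in> J" if "r \<in> carrier R" "r \<otimes> x [^] n \<in> J" for r and n :: nat
    using that(2)
  proof (induction n)
    case 0
    then show ?case using that(1) by simp
  next
    case (Suc n)
    have "(r \<otimes> x [^] n) \<otimes> x \<in> J"
      using Suc.prems that(1) assms(3) by (simp add: m_assoc)
    then have "r \<otimes> x [^] n \<in> J"
      using reg that(1) assms(3) by simp
    then show ?case by (rule Suc.IH)
  qed
  define T where "T = {s \<otimes> x [^] n | s n. s \<in> carrier R - Q \<and> (n::nat) \<in> UNIV}"
  have in_T: "s \<otimes> x [^] n \<in> T" if "s \<in> carrier R - Q" for s and n :: nat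
    using that by (auto simp: T_def)
  have one: "\<one> \<in> carrier R - Q"
    using Q.I_notcarr Q.one_imp_carrier by auto
  have "\<exists>Q'. primeideal Q' R \<and> J \<subseteq> Q' \<and> T \<inter> Q' = {}"
  proof (rule prime_avoiding_exists[OF assms(1,2)])
    show "\<one> \<in> T"
      using in_T[OF one, of 0] by simp
    show "T \<subseteq> carrier R"
      using assms(3) by (auto simp: T_def)
    show "T \<inter> J = {}"
      using regn assms(5) by (auto simp: T_def)
    fix t t' assume "t \<in> T" "t' \<in> T"
    then obtain s n s' n' where *: "t = s \<otimes> x [^] (n::nat)" "t' = s' \<otimes> x [^] (n'::nat)" "s \<in> carrier R - Q" "s' \<in> carrier R - Q"
      by (auto simp: T_def)
    have "s \<otimes> s' \<in> carrier R - Q"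
      using *(3,4) Q.I_prime by auto
    moreover have "t \<otimes> t' = (s \<otimes> s') \<otimes> (x [^] n \<otimes> x [^] n')"
    proof -
      have "x [^] n \<in> carrier R" "x [^] n' \<in> carrier R" "s \<in> carrier R" "s' \<in> carrier R"
        using *(3,4) assms(3) by auto
      then show ?thesis unfolding *(1,2) by algebra
    qed
    ultimately show "t \<otimes> t' \<in> T"
      using in_T[of "s \<otimes> s'" "n + n'"] assms(3) by (simp add: nat_pow_mult)
  qed
  then obtain Q' where Q': "primeideal Q' R" "J \<subseteq> Q'" "T \<inter> Q' = {}" by blast
  have "Q' \<subseteq> Q"
  proof
    fix y assume "y \<in> Q'"
    moreover have "y \<in> carrier R"
      using calculation ideal.Icarr[OF primeideal.axioms(1)[OF Q'(1)]] by blast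
    ultimately show "y \<in> Q"
      using in_T[of y 0] Q'(3) by auto
  qed
  moreover have "x \<in> T"
    using in_T[OF one, of 1] assms(3) by simp
  ultimately show ?thesis
    using Q' assms(6) by blast
qed

text \<open>The sequence is taken off from its end: each removed element makes room for one more
  prime at the bottom of the chain.\<close>

lemma (in cring) regular_sequence_chain:
  assumes "noetherian_ring R" "regular_sequence R xs" "primeideal P R" "set xs \<subseteq> P" "n \<le> length xs"
  shows "\<exists>Q. (\<forall>i\<le>n. primeideal (Q i) R) \<and> (\<forall>i<n. Q i \<subset> Q (Suc i)) \<and> Q n \<subseteq> P \<and>
    Idl (set (take (length xs - n) xs)) \<subseteq> Q 0"
  using assms(5)
proof (induction n)
  case 0
  have "Idl (set xs) \<subseteq> P"
    using assms by (intro genideal_minimal primeideal.axioms(1)) auto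
  then show ?case
    using assms by (intro exI[of _ "\<lambda>_. P"]) auto
next
  case (Suc n)
  then obtain Q where Q: "\<And>i. i \<le> n \<Longrightarrow> primeideal (Q i) R" "\<And>i. i < n \<Longrightarrow> Q i \<subset> Q (Suc i)" "Q n \<subseteq> P"
    "Idl (set (take (length xs - n) xs)) \<subseteq> Q 0"
    by auto
  define k where "k = length xs - Suc n"
  have k: "k < length xs" "length xs - n = Suc k"
    using Suc.prems by (auto simp: k_def)
  have xs: "set xs \<subseteq> carrier R"
    using assms(2) by (simp add: regular_sequence_def)
  have tk: "set (take j xs) \<subseteq> carrier R" for j
    using xs set_take_subset by fast
  have "Idl (set (take k xs)) \<subseteq> Q 0" "xs ! k \<in> Q 0"
  proof -
    have "set (take k xs) \<subseteq> set (take (Suc k) xs)" "xs ! k \<in> set (take (Suc k) xs)"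
      using k by (auto simp: take_Suc_conv_app_nth)
    moreover have "set (take (Suc k) xs) \<subseteq> Q 0"
      using Q(4) genideal_self[OF tk, of "Suc k"] k by auto
    ultimately show "xs ! k \<in> Q 0" and "Idl (set (take k xs)) \<subseteq> Q 0"
      using primeideal.axioms(1)[OF Q(1)[of 0]] by (blast, intro genideal_minimal) auto
  qed
  moreover have "\<forall>r\<in>carrier R. r \<otimes> xs ! k \<in> Idl (set (take k xs)) \<longrightarrow> r \<in> Idl (set (take k xs))"
    using assms(2) k(1) by (simp add: regular_sequence_def)
  ultimately obtain Q' where Q': "primeideal Q' R" "Idl (set (take k xs)) \<subseteq> Q'" "Q' \<subset> Q 0"
    using regular_step[OF assms(1) genideal_ideal[OF tk[of k]], of "xs ! k" "Q 0"] Q(1)[of 0] xs k(1)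
    by (metis le0 nth_mem subsetD)
  show ?case
    using Q Q' by (intro exI[of _ "\<lambda>i. case i of 0 \<Rightarrow> Q' | Suc i \<Rightarrow> Q i"])
      (auto simp: k_def[symmetric] split: nat.split)
qed

lemma (in cring) depth_le_krull_dim:
  assumes "noetherian_ring R" "primeideal P R"
  shows "depth R P \<le> krull_dim R"
  unfolding depth_def
proof (rule Sup_least)
  fix z assume "z \<in> {enat (length xs) | xs. regular_sequence R xs \<and> set xs \<subseteq> P}"
  then obtain xs where xs: "z = enat (length xs)" "regular_sequence R xs" "set xs \<subseteq> P"
    by blast
  obtain Q where "\<forall>i\<le>length xs. primeideal (Q i) R" "\<forall>i<length xs. Q i \<subset> Q (Suc i)"
    using regular_sequence_chain[OF assms(1) xs(2) assms(2) xs(3) order_refl] by blast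
  then have "enat (length xs) \<le> prime_height R (Q (length xs))" "primeideal (Q (length xs)) R"
    unfolding prime_height_def by (auto intro!: Sup_upper)
  then show "z \<le> krull_dim R"
    unfolding krull_dim_def xs(1) by (auto intro!: Sup_upper2)
qed


section \<open>Localizations of a quotient ring\<close>

text \<open>The bridge from type-class rings to ring records; \<open>mpoly_ring\<close> is an
  instance, and ideals and primes translate to \<open>idl.subspace\<close> and
  \<open>is_prime_ideal\<close>.\<close>

definition type_ring :: "'a::comm_ring_1 ring" where
  "type_ring = \<lparr>carrier = UNIV, mult = (*), one = 1, zero = 0, add = (+)\<rparr>"

lemma type_ring_simps [simp]:
  "carrier type_ring = UNIV" "mult type_ring = (*)" "one type_ring = 1" "zero type_ring = 0" "add type_ring = (+)"
  by (simp_all add: type_ring_def)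

lemma mpoly_ring_eq_type_ring: "mpoly_ring = type_ring"
  by (simp add: mpoly_ring_def type_ring_def)

interpretation type_ring: cring type_ring
proof (rule cringI)
  show "abelian_group type_ring"
  proof (rule abelian_groupI)
    show "\<exists>y\<in>carrier type_ring. y \<oplus>\<^bsub>type_ring\<^esub> x = \<zero>\<^bsub>type_ring\<^esub>" for x
      by (intro bexI[of _ "- x"]) simp_all
  qed (auto simp: algebra_simps)
  show "comm_monoid type_ring"
    by (rule comm_monoidI) (auto simp: algebra_simps)
qed (auto simp: algebra_simps)

lemma (in cring) cring_idealI:
  assumes "I \<subseteq> carrier R" "\<zero> \<in> I" "\<And>a b. a \<in> I \<Longrightarrow> b \<in> I \<Longrightarrow> a \<oplus> b \<in> I"
    "\<And>a x. a \<in> I \<Longrightarrow> x \<in> carrier R \<Longrightarrow> x \<otimes> a \<in> I"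
  shows "ideal I R"
proof (rule idealI[OF ring_axioms])
  show "subgroup I (add_monoid R)"
  proof (rule group.subgroupI[OF add.group_axioms])
    show "inv\<^bsub>add_monoid R\<^esub> a \<in> I" if "a \<in> I" for a
    proof -
      have "a \<in> carrier R"
        using that assms(1) by blast
      then have "(\<ominus> \<one>) \<otimes> a = \<ominus> a"
        by algebra
      moreover have "(\<ominus> \<one>) \<otimes> a \<in> I"
        by (rule assms(4)[OF that]) simp
      ultimately show ?thesis
        by (simp add: a_inv_def)
    qed
  qed (use assms in auto)
  show "a \<otimes> x \<in> I" if "a \<in> I" "x \<in> carrier R" for a x
    using assms(1) assms(4)[OF that] that m_comm by (metis subsetD)
qed (use assms in auto)

lemma ideal_type_ring_iff: "ideal I type_ring \<longleftrightarrow> idl.subspace I"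
proof
  assume "ideal I type_ring"
  then interpret ideal I type_ring .
  show "idl.subspace I"
    using I_l_closed zero_closed a_closed by (auto intro!: idl.subspaceI)
next
  assume "idl.subspace I"
  then show "ideal I type_ring"
    by (intro type_ring.cring_idealI) (auto simp: idl.subspace_0 idl.subspace_add idl.subspace_scale)
qed

lemma Idl_type_ring: "Idl\<^bsub>type_ring\<^esub> A = idl.span A"
proof
  show "Idl\<^bsub>type_ring\<^esub> A \<subseteq> idl.span A"
    by (rule type_ring.genideal_minimal) (simp_all add: ideal_type_ring_iff idl.span_superset)
  have "idl.subspace (Idl\<^bsub>type_ring\<^esub> A)"
    using type_ring.genideal_ideal[of A] by (simp add: ideal_type_ring_iff)
  then show "idl.span A \<subseteq> Idl\<^bsub>type_ring\<^esub> A"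
    using type_ring.genideal_self[of A] by (intro idl.span_minimal) auto
qed

lemma primeideal_type_ring_iff: "primeideal Q type_ring \<longleftrightarrow> is_prime_ideal Q"
proof
  assume *: "primeideal Q type_ring"
  then interpret primeideal Q type_ring .
  have "idl.subspace Q"
    using is_ideal by (simp add: ideal_type_ring_iff)
  moreover have "1 \<notin> Q"
    using one_imp_carrier I_notcarr by auto
  ultimately show "is_prime_ideal Q"
    using I_prime by (simp add: is_prime_ideal_def)
next
  assume *: "is_prime_ideal Q"
  show "primeideal Q type_ring"
    by (rule primeidealI) (use * in \<open>auto simp: ideal_type_ring_iff is_prime_ideal_def type_ring.is_cring\<close>)
qed

text \<open>The localization of \<open>R/I\<close> at the image of the prime ideal \<open>m\<close>.\<close>

locale quotient_localization =
  fixes I m :: "'a::comm_ring_1 set"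
  assumes I: "idl.subspace I" and m: "is_prime_ideal m" and Im: "I \<subseteq> m"
begin

definition q :: "'a \<Rightarrow> 'a set" where
  "q a = I +>\<^bsub>type_ring\<^esub> a"

abbreviation Q :: "'a set ring" where
  "Q \<equiv> type_ring Quot I"

definition S :: "'a set set" where
  "S = carrier Q - q ` m"

abbreviation B :: "('a set \<times> 'a set) set ring" where
  "B \<equiv> localization Q S"

text \<open>Numerators and denominators are represented by elements of R, not by cosets, so that
  identities in the localization become congruences modulo I up to a factor outside m.\<close>

definition frac :: "'a \<Rightarrow> 'a \<Rightarrow> ('a set \<times> 'a set) set" where
  "frac a s = fraction Q S (q a) (q s)"

sublocale I: ideal I type_ring
  using I by (simp add: ideal_type_ring_iff)

sublocale Q: cring Q
  by (rule I.quotient_is_cring[OF type_ring.is_cring])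

lemma q_eq_iff: "q a = q b \<longleftrightarrow> a - b \<in> I"
proof -
  have "q c = (\<lambda>x. x + c) ` I" for c
    by (auto simp: q_def a_r_coset_def')
  moreover have "(\<lambda>x. x + a) ` I = (\<lambda>x. x + b) ` I \<longleftrightarrow> a - b \<in> I"
  proof
    assume "(\<lambda>x. x + a) ` I = (\<lambda>x. x + b) ` I"
    moreover have "0 + a \<in> (\<lambda>x. x + a) ` I"
      using idl.subspace_0[OF I] by blast
    ultimately show "a - b \<in> I"
      by force
  next
    have *: "(\<lambda>x. x + a) ` I \<subseteq> (\<lambda>x. x + b) ` I" if "a - b \<in> I" for a b
    proof safe
      fix x assume "x \<in> I"
      then show "x + a \<in> (\<lambda>x. x + b) ` I"
        using idl.subspace_add[OF I _ that] by (intro image_eqI[of _ _ "x + (a - b)"]) auto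
    qed
    assume "a - b \<in> I"
    moreover have "b - a \<in> I"
      using idl.subspace_neg[OF I calculation] by simp
    ultimately show "(\<lambda>x. x + a) ` I = (\<lambda>x. x + b) ` I"
      using * by blast
  qed
  ultimately show ?thesis by simp
qed

lemma carrier_Q: "carrier Q = range q"
  by (auto simp: FactRing_def A_RCOSETS_def' q_def)

lemma q_mult [simp]: "q a \<otimes>\<^bsub>Q\<^esub> q b = q (a * b)"
  using I.rcoset_mult_add[of a b] by (simp add: FactRing_def q_def)

lemma q_add [simp]: "q a \<oplus>\<^bsub>Q\<^esub> q b = q (a + b)"
  using I.a_rcos_sum[of a b] by (simp add: FactRing_def q_def)

lemma q_1: "\<one>\<^bsub>Q\<^esub> = q 1"
  by (simp add: FactRing_def q_def)

lemma q_0: "\<zero>\<^bsub>Q\<^esub> = q 0"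
proof -
  have "\<zero>\<^bsub>Q\<^esub> = I"
    by (simp add: FactRing_def)
  also have "I = q 0"
    using type_ring.a_rcos_zero[OF I.is_ideal, of 0] idl.subspace_0[OF I] by (simp add: q_def)
  finally show ?thesis .
qed

lemma q_in_carrier [simp]: "q a \<in> carrier Q"
  by (simp add: carrier_Q)

lemma q_minus [simp]: "q a \<ominus>\<^bsub>Q\<^esub> q b = q (a - b)"
proof -
  have "q (- b) \<oplus>\<^bsub>Q\<^esub> q b = \<zero>\<^bsub>Q\<^esub>"
    by (simp add: q_0)
  then have "\<ominus>\<^bsub>Q\<^esub> q b = q (- b)"
    by (intro Q.minus_equality) simp_all
  then show ?thesis
    by (simp add: a_minus_def)
qed

lemma q_mem_iff: "q a \<in> q ` m \<longleftrightarrow> a \<in> m"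
proof
  assume "q a \<in> q ` m"
  then obtain b where "b \<in> m" "a - b \<in> I"
    by (auto simp: q_eq_iff)
  then show "a \<in> m"
    using idl.subspace_add[OF is_prime_idealD(1)[OF m], of "a - b" b] Im by auto
qed auto

lemma S_iff [simp]: "q a \<in> S \<longleftrightarrow> a \<notin> m"
  by (simp add: S_def q_mem_iff)

lemma S_subset: "S \<subseteq> carrier Q"
  by (auto simp: S_def)

lemma S_eq: "S = q ` (- m)"
proof -
  have "q a \<in> S \<longleftrightarrow> q a \<in> q ` (- m)" for a
  proof
    assume "q a \<in> q ` (- m)"
    then obtain b where "q a = q b" "b \<notin> m" by auto
    then show "q a \<in> S"
      by simp
  qed simp
  moreover have "S \<subseteq> range q" "q ` (- m) \<subseteq> range q"
    using S_subset unfolding carrier_Q by blast+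
  ultimately show ?thesis
    by blast
qed

lemma bex_S_iff: "(\<exists>u\<in>S. P u) \<longleftrightarrow> (\<exists>u. u \<notin> m \<and> P (q u))"
  by (auto simp: S_eq)

lemma m_mult: "s \<notin> m \<Longrightarrow> t \<notin> m \<Longrightarrow> s * t \<notin> m"
  using is_prime_idealD(3)[OF m] by blast

lemma one_notin_m: "1 \<notin> m"
  by (rule is_prime_idealD(2)[OF m])

lemma frac_rel_iff:
  "((q a, q s), (q b, q t)) \<in> frac_rel Q S \<longleftrightarrow> s \<notin> m \<and> t \<notin> m \<and> (\<exists>u. u \<notin> m \<and> u * (t * a - s * b) \<in> I)"
  by (simp add: frac_rel_def bex_S_iff q_0 q_eq_iff)

lemma equiv_frac_rel: "equiv (carrier Q \<times> S) (frac_rel Q S)"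
proof (rule equivI)
  show "refl_on (carrier Q \<times> S) (frac_rel Q S)"
  proof (rule refl_onI)
    fix z assume "z \<in> carrier Q \<times> S"
    then obtain a s where "z = (q a, q s)" "s \<notin> m"
      by (auto simp: carrier_Q S_eq)
    then show "(z, z) \<in> frac_rel Q S"
      using idl.subspace_0[OF I] one_notin_m by (auto simp: frac_rel_iff)
  qed
  show "frac_rel Q S \<subseteq> (carrier Q \<times> S) \<times> carrier Q \<times> S"
    by (auto simp: frac_rel_def)
  show "sym (frac_rel Q S)"
  proof (rule symI)
    fix x y assume *: "(x, y) \<in> frac_rel Q S"
    then obtain a s b t where xy: "x = (q a, q s)" "y = (q b, q t)"
      unfolding frac_rel_def carrier_Q S_eq by auto
    show "(y, x) \<in> frac_rel Q S"
      using * unfolding xy frac_rel_iff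
      by (metis idl.subspace_neg[OF I] minus_diff_eq mult_minus_right)
  qed
  show "trans (frac_rel Q S)"
  proof (rule transI)
    fix x y z assume *: "(x, y) \<in> frac_rel Q S" "(y, z) \<in> frac_rel Q S"
    obtain a s b t where xy: "x = (q a, q s)" "y = (q b, q t)"
      using *(1) unfolding frac_rel_def carrier_Q S_eq by auto
    obtain c r where z: "z = (q c, q r)"
      using *(2) unfolding frac_rel_def carrier_Q S_eq by auto
    obtain u v where uv: "s \<notin> m" "t \<notin> m" "r \<notin> m" "u \<notin> m" "v \<notin> m" "u * (t * a - s * b) \<in> I" "v * (r * b - t * c) \<in> I"
      using * unfolding xy z frac_rel_iff by blast
    have "(v * r) * (u * (t * a - s * b)) + (u * s) * (v * (r * b - t * c)) \<in> I"
      by (intro idl.subspace_add[OF I] idl.subspace_scale[OF I] uv)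
    then have "(u * v * t) * (r * a - s * c) \<in> I"
      by (simp add: algebra_simps)
    then show "(x, z) \<in> frac_rel Q S"
      unfolding xy z frac_rel_iff by (intro conjI exI[of _ "u * v * t"] m_mult uv)
  qed
qed

lemma frac_eq_iff:
  assumes "s \<notin> m" "t \<notin> m"
  shows "frac a s = frac b t \<longleftrightarrow> (\<exists>u. u \<notin> m \<and> u * (t * a - s * b) \<in> I)"
proof -
  have "frac a s = frac b t \<longleftrightarrow> ((q a, q s), (q b, q t)) \<in> frac_rel Q S"
    unfolding frac_def fraction_def
    using assms by (intro eq_equiv_class_iff[OF equiv_frac_rel]) auto
  then show ?thesis
    using assms by (simp add: frac_rel_iff)
qed

lemma frac_eqI:
  assumes "s \<notin> m" "t \<notin> m" "t * a = s * b"
  shows "frac a s = frac b t"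
  using assms idl.subspace_0[OF I] one_notin_m by (auto simp: frac_eq_iff)

lemma carrier_B: "carrier B = {frac a s | a s. s \<notin> m}"
  by (auto simp: localization_def quotient_def carrier_Q S_eq frac_def fraction_def)

lemma frac_in_carrier [simp]: "s \<notin> m \<Longrightarrow> frac a s \<in> carrier B"
  by (auto simp: carrier_B)

lemma frac_eqI_mod:
  assumes "s \<notin> m" "t \<notin> m" "u \<notin> m" "u * (t * a - s * b) \<in> I"
  shows "frac a s = frac b t"
  using assms by (auto simp: frac_eq_iff)

lemma mem_frac_iff:
  assumes "s \<notin> m"
  shows "z \<in> frac a s \<longleftrightarrow> (\<exists>a' s'. z = (q a', q s') \<and> s' \<notin> m \<and> frac a' s' = frac a s)"
proof
  assume *: "z \<in> frac a s"
  then obtain a' s' where z: "z = (q a', q s')" "s' \<notin> m"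
    unfolding frac_def fraction_def frac_rel_def carrier_Q S_eq by auto
  then have "((q a, q s), (q a', q s')) \<in> frac_rel Q S"
    using * by (simp add: frac_def fraction_def)
  then have "frac a s = frac a' s'"
    using assms z(2) by (simp add: frac_eq_iff frac_rel_iff)
  then show "\<exists>a' s'. z = (q a', q s') \<and> s' \<notin> m \<and> frac a' s' = frac a s"
    using z by metis
next
  assume "\<exists>a' s'. z = (q a', q s') \<and> s' \<notin> m \<and> frac a' s' = frac a s"
  then obtain a' s' where z: "z = (q a', q s')" "s' \<notin> m" "frac a s = frac a' s'"
    by metis
  then have "((q a, q s), (q a', q s')) \<in> frac_rel Q S"
    using assms by (simp add: frac_eq_iff frac_rel_iff)
  then show "z \<in> frac a s"
    by (simp add: frac_def fraction_def z(1))
qed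

text \<open>The operations of \<open>localization\<close> are unions over all representatives; once
  the class does not depend on them, the union is that class.\<close>

lemma Union_frac_const:
  assumes "s \<notin> m" "t \<notin> m"
    and "\<And>a' s' b' t'. s' \<notin> m \<Longrightarrow> t' \<notin> m \<Longrightarrow> frac a' s' = frac a s \<Longrightarrow> frac b' t' = frac b t
      \<Longrightarrow> f (q a') (q s') (q b') (q t') = c"
  shows "(\<Union>(x, y)\<in>frac a s. \<Union>(z, w)\<in>frac b t. f x y z w) = c"
proof -
  have "(q a, q s) \<in> frac a s" "(q b, q t) \<in> frac b t"
    using assms(1,2) by (auto simp: mem_frac_iff)
  moreover have "f x y z w = c" if "(x, y) \<in> frac a s" "(z, w) \<in> frac b t" for x y z w
    using that assms(3) unfolding mem_frac_iff[OF assms(1)] mem_frac_iff[OF assms(2)] by blast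
  ultimately show ?thesis
    by fastforce
qed

lemma frac_mult:
  assumes "s \<notin> m" "t \<notin> m"
  shows "frac a s \<otimes>\<^bsub>B\<^esub> frac b t = frac (a * b) (s * t)"
proof -
  have "(\<Union>(x, y)\<in>frac a s. \<Union>(z, w)\<in>frac b t. fraction Q S (x \<otimes>\<^bsub>Q\<^esub> z) (y \<otimes>\<^bsub>Q\<^esub> w)) = frac (a * b) (s * t)"
  proof (rule Union_frac_const[OF assms])
    fix a' s' b' t'
    assume *: "s' \<notin> m" "t' \<notin> m" "frac a' s' = frac a s" "frac b' t' = frac b t"
    then obtain u v where uv: "u \<notin> m" "u * (s * a' - s' * a) \<in> I" "v \<notin> m" "v * (t * b' - t' * b) \<in> I"
      using assms by (auto simp: frac_eq_iff)
    have "(v * t * b') * (u * (s * a' - s' * a)) + (u * s' * a) * (v * (t * b' - t' * b)) \<in> I"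
      by (intro idl.subspace_add[OF I] idl.subspace_scale[OF I] uv)
    then have "(u * v) * ((s * t) * (a' * b') - (s' * t') * (a * b)) \<in> I"
      by (simp add: algebra_simps)
    then have "frac (a' * b') (s' * t') = frac (a * b) (s * t)"
      by (rule frac_eqI_mod[rotated 3]) (intro m_mult * assms uv)+
    then show "fraction Q S (q a' \<otimes>\<^bsub>Q\<^esub> q b') (q s' \<otimes>\<^bsub>Q\<^esub> q t') = frac (a * b) (s * t)"
      by (simp add: frac_def)
  qed
  then show ?thesis
    by (simp add: localization_def)
qed

lemma frac_add:
  assumes "s \<notin> m" "t \<notin> m"
  shows "frac a s \<oplus>\<^bsub>B\<^esub> frac b t = frac (t * a + s * b) (s * t)"
proof -
  have "(\<Union>(x, y)\<in>frac a s. \<Union>(z, w)\<in>frac b t. fraction Q S (w \<otimes>\<^bsub>Q\<^esub> x \<oplus>\<^bsub>Q\<^esub> y \<otimes>\<^bsub>Q\<^esub> z) (y \<otimes>\<^bsub>Q\<^esub> w))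
      = frac (t * a + s * b) (s * t)"
  proof (rule Union_frac_const[OF assms])
    fix a' s' b' t'
    assume *: "s' \<notin> m" "t' \<notin> m" "frac a' s' = frac a s" "frac b' t' = frac b t"
    then obtain u v where uv: "u \<notin> m" "u * (s * a' - s' * a) \<in> I" "v \<notin> m" "v * (t * b' - t' * b) \<in> I"
      using assms by (auto simp: frac_eq_iff)
    have "(v * t * t') * (u * (s * a' - s' * a)) + (u * s * s') * (v * (t * b' - t' * b)) \<in> I"
      by (intro idl.subspace_add[OF I] idl.subspace_scale[OF I] uv)
    then have "(u * v) * ((s * t) * (t' * a' + s' * b') - (s' * t') * (t * a + s * b)) \<in> I"
      by (simp add: algebra_simps)
    then have "frac (t' * a' + s' * b') (s' * t') = frac (t * a + s * b) (s * t)"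
      by (rule frac_eqI_mod[rotated 3]) (intro m_mult * assms uv)+
    then show "fraction Q S (q t' \<otimes>\<^bsub>Q\<^esub> q a' \<oplus>\<^bsub>Q\<^esub> q s' \<otimes>\<^bsub>Q\<^esub> q b') (q s' \<otimes>\<^bsub>Q\<^esub> q t') = frac (t * a + s * b) (s * t)"
      by (simp add: frac_def)
  qed
  then show ?thesis
    by (simp add: localization_def)
qed

lemma one_B: "\<one>\<^bsub>B\<^esub> = frac 1 1" and zero_B: "\<zero>\<^bsub>B\<^esub> = frac 0 1"
  by (simp_all add: localization_def frac_def q_0 q_1)

sublocale B: cring B
proof (rule cringI)
  show "abelian_group B"
  proof (rule abelian_groupI)
    fix x y z assume "x \<in> carrier B" "y \<in> carrier B" "z \<in> carrier B"
    then obtain a s b t c r where *: "x = frac a s" "y = frac b t" "z = frac c r" "s \<notin> m" "t \<notin> m" "r \<notin> m"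
      by (auto simp: carrier_B)
    show "x \<oplus>\<^bsub>B\<^esub> y \<oplus>\<^bsub>B\<^esub> z = x \<oplus>\<^bsub>B\<^esub> (y \<oplus>\<^bsub>B\<^esub> z)"
      by (simp add: * frac_add m_mult) (intro frac_eqI m_mult *; simp add: algebra_simps)
    show "x \<oplus>\<^bsub>B\<^esub> y \<in> carrier B"
      by (simp add: * frac_add m_mult)
    show "x \<oplus>\<^bsub>B\<^esub> y = y \<oplus>\<^bsub>B\<^esub> x"
      by (simp add: * frac_add m_mult) (intro frac_eqI m_mult *; simp add: algebra_simps)
    show "\<zero>\<^bsub>B\<^esub> \<oplus>\<^bsub>B\<^esub> x = x"
      by (simp add: * zero_B frac_add one_notin_m)
    show "\<exists>y\<in>carrier B. y \<oplus>\<^bsub>B\<^esub> x = \<zero>\<^bsub>B\<^esub>"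
    proof (rule bexI[of _ "frac (- a) s"])
      have "frac 0 (s * s) = frac 0 1"
        by (rule frac_eqI) (simp_all add: * m_mult one_notin_m)
      then show "frac (- a) s \<oplus>\<^bsub>B\<^esub> x = \<zero>\<^bsub>B\<^esub>"
        using * by (simp add: zero_B frac_add)
    qed (use * in simp)
  qed (simp add: zero_B one_notin_m)
  show "comm_monoid B"
  proof (rule comm_monoidI)
    fix x y z assume "x \<in> carrier B" "y \<in> carrier B" "z \<in> carrier B"
    then obtain a s b t c r where *: "x = frac a s" "y = frac b t" "z = frac c r" "s \<notin> m" "t \<notin> m" "r \<notin> m"
      by (auto simp: carrier_B)
    show "x \<otimes>\<^bsub>B\<^esub> y \<in> carrier B"
      by (simp add: * frac_mult m_mult)
    show "x \<otimes>\<^bsub>B\<^esub> y \<otimes>\<^bsub>B\<^esub> z = x \<otimes>\<^bsub>B\<^esub> (y \<otimes>\<^bsub>B\<^esub> z)"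
      by (simp add: * frac_mult m_mult mult.assoc)
    show "x \<otimes>\<^bsub>B\<^esub> y = y \<otimes>\<^bsub>B\<^esub> x"
      by (simp add: * frac_mult m_mult mult.commute)
    show "\<one>\<^bsub>B\<^esub> \<otimes>\<^bsub>B\<^esub> x = x"
      by (simp add: * one_B frac_mult one_notin_m)
  qed (simp add: one_B one_notin_m)
  fix x y z assume "x \<in> carrier B" "y \<in> carrier B" "z \<in> carrier B"
  then obtain a s b t c r where *: "x = frac a s" "y = frac b t" "z = frac c r" "s \<notin> m" "t \<notin> m" "r \<notin> m"
    by (auto simp: carrier_B)
  show "(x \<oplus>\<^bsub>B\<^esub> y) \<otimes>\<^bsub>B\<^esub> z = x \<otimes>\<^bsub>B\<^esub> z \<oplus>\<^bsub>B\<^esub> y \<otimes>\<^bsub>B\<^esub> z"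
    by (simp add: * frac_mult frac_add m_mult) (intro frac_eqI m_mult *; simp add: algebra_simps)
qed

end

section \<open>Ideals of the localization and their contractions to R\<close>

context quotient_localization
begin

abbreviation \<iota> :: "'a \<Rightarrow> ('a set \<times> 'a set) set" where
  "\<iota> a \<equiv> frac a 1"

definition contract :: "('a set \<times> 'a set) set set \<Rightarrow> 'a set" where
  "contract H = {a. \<iota> a \<in> H}"

lemma \<iota>_hom: "\<iota> a \<otimes>\<^bsub>B\<^esub> \<iota> b = \<iota> (a * b)" "\<iota> a \<oplus>\<^bsub>B\<^esub> \<iota> b = \<iota> (a + b)"
  by (simp_all add: frac_mult frac_add one_notin_m)

lemma \<iota>_eq_zero: "a \<in> I \<Longrightarrow> \<iota> a = \<zero>\<^bsub>B\<^esub>"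
  unfolding zero_B by (rule frac_eqI_mod[of _ _ 1]) (simp_all add: one_notin_m)

lemma frac_in_ideal_iff:
  assumes "ideal H B" "s \<notin> m"
  shows "frac a s \<in> H \<longleftrightarrow> a \<in> contract H"
proof
  interpret H: ideal H B by fact
  show "a \<in> contract H" if "frac a s \<in> H"
  proof -
    have "frac a s \<otimes>\<^bsub>B\<^esub> frac s 1 = frac a 1"
      using assms(2) by (simp add: frac_mult one_notin_m) (rule frac_eqI; simp add: one_notin_m mult.commute)
    then show ?thesis
      using H.I_r_closed[OF that, of "frac s 1"] by (simp add: contract_def one_notin_m)
  qed
  show "frac a s \<in> H" if "a \<in> contract H"
  proof -
    have "frac a 1 \<otimes>\<^bsub>B\<^esub> frac 1 s = frac a s"
      using assms(2) by (simp add: frac_mult one_notin_m)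
    then show ?thesis
      using that H.I_r_closed[of "frac a 1" "frac 1 s"] assms(2) by (simp add: contract_def)
  qed
qed

lemma contract_subspace:
  assumes "ideal H B"
  shows "idl.subspace (contract H)" "I \<subseteq> contract H"
proof -
  interpret H: ideal H B by fact
  show I': "I \<subseteq> contract H"
    using \<iota>_eq_zero H.zero_closed by (auto simp: contract_def)
  show "idl.subspace (contract H)"
  proof (rule idl.subspaceI)
    show "0 \<in> contract H"
      using I' idl.subspace_0[OF I] by blast
    show "x + y \<in> contract H" if "x \<in> contract H" "y \<in> contract H" for x y
      using H.a_closed[of "\<iota> x" "\<iota> y"] that by (simp add: contract_def \<iota>_hom)
    show "c * x \<in> contract H" if "x \<in> contract H" for c x
      using H.I_l_closed[of "\<iota> x" "\<iota> c"] that by (simp add: contract_def \<iota>_hom one_notin_m)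
  qed
qed

text \<open>Denominators are units, so a fraction lies in an ideal exactly when its numerator lies
  in the contraction.\<close>

lemma ideal_eqI_contract:
  assumes "ideal H B" "ideal H' B" "contract H \<subseteq> contract H'"
  shows "H \<subseteq> H'"
proof
  fix z assume z: "z \<in> H"
  then have "z \<in> carrier B"
    using ideal.Icarr[OF assms(1)] by blast
  then obtain a s where "z = frac a s" "s \<notin> m"
    by (auto simp: carrier_B)
  then show "z \<in> H'"
    using z frac_in_ideal_iff[OF assms(1)] frac_in_ideal_iff[OF assms(2)] assms(3) by blast
qed

lemma proper_contract:
  assumes "ideal H B" "H \<noteq> carrier B"
  shows "contract H \<subseteq> m"
proof (rule ccontr)
  assume "\<not> ?thesis"
  then obtain s where s: "s \<in> contract H" "s \<notin> m" by blast
  then have "frac s s \<in> H"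
    using frac_in_ideal_iff[OF assms(1)] by blast
  moreover have "frac s s = \<one>\<^bsub>B\<^esub>"
    unfolding one_B by (rule frac_eqI) (simp_all add: s one_notin_m)
  ultimately show False
    using ideal.one_imp_carrier[OF assms(1)] assms(2) by simp
qed

lemma contract_prime:
  assumes "primeideal H B"
  shows "is_prime_ideal (contract H)"
proof -
  interpret H: primeideal H B by fact
  have "1 \<notin> contract H"
    using proper_contract[OF H.is_ideal] H.I_notcarr one_notin_m by blast
  moreover have "p \<in> contract H \<or> r \<in> contract H" if "p * r \<in> contract H" for p r
    using H.I_prime[of "\<iota> p" "\<iota> r"] that by (simp add: contract_def \<iota>_hom one_notin_m)
  ultimately show ?thesis
    using contract_subspace[OF H.is_ideal] by (simp add: is_prime_ideal_def)
qed

lemma extension_ideal: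
  assumes J: "idl.subspace J"
  shows "ideal {frac a s | a s. s \<notin> m \<and> a \<in> J} B"
proof (rule B.cring_idealI)
  show "\<zero>\<^bsub>B\<^esub> \<in> {frac a s | a s. s \<notin> m \<and> a \<in> J}"
    unfolding zero_B using one_notin_m idl.subspace_0[OF J] by blast
  fix x assume "x \<in> {frac a s | a s. s \<notin> m \<and> a \<in> J}"
  then obtain a s where x: "x = frac a s" "s \<notin> m" "a \<in> J" by blast
  show "y \<otimes>\<^bsub>B\<^esub> x \<in> {frac a s | a s. s \<notin> m \<and> a \<in> J}" if y: "y \<in> carrier B" for y
  proof -
    obtain b t where "y = frac b t" "t \<notin> m"
      using y by (auto simp: carrier_B)
    then have "y \<otimes>\<^bsub>B\<^esub> x = frac (b * a) (t * s)" "t * s \<notin> m" "b * a \<in> J"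
      using x idl.subspace_scale[OF J] by (simp_all add: frac_mult m_mult)
    then show ?thesis by blast
  qed
  fix y assume "y \<in> {frac a s | a s. s \<notin> m \<and> a \<in> J}"
  then obtain b t where y: "y = frac b t" "t \<notin> m" "b \<in> J" by blast
  have "x \<oplus>\<^bsub>B\<^esub> y = frac (t * a + s * b) (s * t)" "s * t \<notin> m"
    using x y by (simp_all add: frac_add m_mult)
  moreover have "t * a + s * b \<in> J"
    by (intro idl.subspace_add[OF J] idl.subspace_scale[OF J] x y)
  ultimately show "x \<oplus>\<^bsub>B\<^esub> y \<in> {frac a s | a s. s \<notin> m \<and> a \<in> J}"
    by blast
qed auto

text \<open>Extending and contracting an ideal amounts to saturating it with respect to the
  complement of m.\<close>

lemma contract_Idl:
  "a \<in> contract (Idl\<^bsub>B\<^esub> (\<iota> ` A)) \<longleftrightarrow> (\<exists>u. u \<notin> m \<and> u * a \<in> idl.span (I \<union> A))"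
proof
  let ?J = "idl.span (I \<union> A)"
  have "Idl\<^bsub>B\<^esub> (\<iota> ` A) \<subseteq> {frac a s | a s. s \<notin> m \<and> a \<in> ?J}"
    using one_notin_m by (intro B.genideal_minimal extension_ideal) (auto intro: idl.span_base)
  moreover assume "a \<in> contract (Idl\<^bsub>B\<^esub> (\<iota> ` A))"
  ultimately obtain b t where b: "frac a 1 = frac b t" "t \<notin> m" "b \<in> ?J"
    by (auto simp: contract_def)
  then obtain u where u: "u \<notin> m" "u * (t * a - 1 * b) \<in> I"
    using frac_eq_iff[OF one_notin_m b(2)] by blast
  have "u * (t * a - 1 * b) + u * b \<in> ?J"
    by (rule idl.span_add[OF idl.span_base idl.span_scale[OF b(3)]]) (use u(2) in simp)
  then have "(u * t) * a \<in> ?J"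
    by (simp add: algebra_simps)
  then show "\<exists>u. u \<notin> m \<and> u * a \<in> ?J"
    using m_mult[OF u(1) b(2)] by blast
next
  have carr: "\<iota> ` A \<subseteq> carrier B"
    by (auto simp: one_notin_m)
  note id = B.genideal_ideal[OF carr]
  have "idl.span (I \<union> A) \<subseteq> contract (Idl\<^bsub>B\<^esub> (\<iota> ` A))"
    using contract_subspace[OF id] B.genideal_self[OF carr] by (intro idl.span_minimal) (auto simp: contract_def)
  moreover assume "\<exists>u. u \<notin> m \<and> u * a \<in> idl.span (I \<union> A)"
  ultimately obtain u where u: "u \<notin> m" "u * a \<in> contract (Idl\<^bsub>B\<^esub> (\<iota> ` A))"
    by blast
  then have "frac (u * a) u \<in> Idl\<^bsub>B\<^esub> (\<iota> ` A)"
    using frac_in_ideal_iff[OF id] by blast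
  moreover have "frac (u * a) u = \<iota> a"
    by (rule frac_eqI) (simp_all add: u one_notin_m)
  ultimately show "a \<in> contract (Idl\<^bsub>B\<^esub> (\<iota> ` A))"
    by (simp add: contract_def)
qed

text \<open>Generators of the contraction generate the ideal of the localization.\<close>

lemma noetherian_B:
  assumes "\<And>J :: 'a set. idl.subspace J \<Longrightarrow> \<exists>A. finite A \<and> J = idl.span A"
  shows "noetherian_ring B"
proof (rule B.noetherian_ringI)
  fix H assume H: "ideal H B"
  obtain A where A: "finite A" "contract H = idl.span A"
    using assms[OF contract_subspace(1)[OF H]] by blast
  have carr: "\<iota> ` A \<subseteq> carrier B"
    by (auto simp: one_notin_m)
  have "A \<subseteq> contract H"
    using A(2) idl.span_superset by blast
  then have "Idl\<^bsub>B\<^esub> (\<iota> ` A) \<subseteq> H"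
    by (intro B.genideal_minimal H) (auto simp: contract_def)
  moreover have "H \<subseteq> Idl\<^bsub>B\<^esub> (\<iota> ` A)"
  proof (rule ideal_eqI_contract[OF H B.genideal_ideal[OF carr]], rule subsetI)
    fix a assume "a \<in> contract H"
    then have "a \<in> idl.span (I \<union> A)"
      using A(2) idl.span_mono[of A "I \<union> A"] by blast
    then show "a \<in> contract (Idl\<^bsub>B\<^esub> (\<iota> ` A))"
      unfolding contract_Idl using one_notin_m by (intro exI[of _ 1]) simp
  qed
  ultimately show "\<exists>A\<subseteq>carrier B. finite A \<and> H = Idl\<^bsub>B\<^esub> A"
    using carr A(1) by blast
qed

definition max_B :: "('a set \<times> 'a set) set set" where
  "max_B = {frac a s | a s. s \<notin> m \<and> a \<in> m}"

lemma max_B_ideal: "ideal max_B B"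
  unfolding max_B_def by (rule extension_ideal[OF is_prime_idealD(1)[OF m]])

lemma contract_max_B: "contract max_B = m"
proof
  show "m \<subseteq> contract max_B"
    using one_notin_m by (auto simp: contract_def max_B_def)
  have "max_B \<noteq> carrier B"
  proof
    assume "max_B = carrier B"
    then have "\<iota> 1 \<in> max_B"
      by (simp add: one_notin_m)
    then obtain a s where as: "frac 1 1 = frac a s" "s \<notin> m" "a \<in> m"
      by (auto simp: max_B_def)
    then obtain u where u: "u \<notin> m" "u * (s * 1 - 1 * a) \<in> I"
      using frac_eq_iff[OF one_notin_m as(2)] by blast
    have "u * (s * 1 - 1 * a) + u * a \<in> m"
      by (rule idl.subspace_add[OF is_prime_idealD(1)[OF m] _ idl.subspace_scale[OF is_prime_idealD(1)[OF m] as(3)]])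
        (use u(2) Im in blast)
    then show False
      using m_mult[OF u(1) as(2)] by (simp add: algebra_simps)
  qed
  then show "contract max_B \<subseteq> m"
    by (rule proper_contract[OF max_B_ideal])
qed

lemma proper_subset_max_B:
  assumes "ideal H B" "H \<noteq> carrier B"
  shows "H \<subseteq> max_B"
  using ideal_eqI_contract[OF assms(1) max_B_ideal] proper_contract[OF assms] contract_max_B by simp

lemma max_B_maximal: "maximalideal max_B B"
proof (rule maximalidealI[OF max_B_ideal])
  show "carrier B \<noteq> max_B"
    using contract_max_B one_notin_m by (auto simp: contract_def)
  show "H = max_B \<or> H = carrier B" if "ideal H B" "max_B \<subseteq> H" "H \<subseteq> carrier B" for H
    using that proper_subset_max_B[of H] by blast
qed

lemma maximalideals_B: "{M. maximalideal M B} = {max_B}"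
proof -
  have "M = max_B" if "maximalideal M B" for M
  proof -
    interpret M: maximalideal M B by fact
    have "M \<subseteq> max_B"
      using proper_subset_max_B[OF M.is_ideal] M.I_notcarr by blast
    moreover have "max_B \<noteq> carrier B" "max_B \<subseteq> carrier B"
    proof -
      have "\<iota> 1 \<notin> max_B"
        using contract_max_B one_notin_m by (auto simp: contract_def)
      then show "max_B \<noteq> carrier B"
        using frac_in_carrier[OF one_notin_m] by metis
      show "max_B \<subseteq> carrier B"
        using ideal.Icarr[OF max_B_ideal] by blast
    qed
    ultimately show ?thesis
      using M.I_maximal[OF max_B_ideal] by blast
  qed
  then have "{M. maximalideal M B} \<subseteq> {max_B}"
    by blast
  moreover have "max_B \<in> {M. maximalideal M B}"
    using max_B_maximal by (rule CollectI)
  ultimately show ?thesis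
    by blast
qed

text \<open>A relation in the localization becomes one in R after multiplication by some u outside
  m; regularity is then used with \<open>u * a\<close> in place of a. Properness holds because the
  sequence lies in m.\<close>

lemma regular_sequence_B:
  assumes "weakly_regular I xs" "set xs \<subseteq> m"
  shows "regular_sequence B (map \<iota> xs)"
  unfolding regular_sequence_def
proof (intro conjI allI impI ballI)
  have carr: "\<iota> ` A \<subseteq> carrier B" for A
    by (auto simp: one_notin_m)
  show "set (map \<iota> xs) \<subseteq> carrier B"
    using carr by simp
  show "Idl\<^bsub>B\<^esub> (set (map \<iota> xs)) \<noteq> carrier B"
  proof
    assume "Idl\<^bsub>B\<^esub> (set (map \<iota> xs)) = carrier B"
    moreover have "Idl\<^bsub>B\<^esub> (set (map \<iota> xs)) \<subseteq> max_B"
      using assms(2) one_notin_m by (intro B.genideal_minimal max_B_ideal) (auto simp: max_B_def)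
    ultimately have "\<iota> 1 \<in> max_B"
      using frac_in_carrier[OF one_notin_m] by blast
    then show False
      using contract_max_B one_notin_m by (auto simp: contract_def)
  qed
next
  fix i r
  assume i: "i < length (map \<iota> xs)" and r: "r \<in> carrier B"
    and *: "r \<otimes>\<^bsub>B\<^esub> map \<iota> xs ! i \<in> Idl\<^bsub>B\<^esub> (set (take i (map \<iota> xs)))"
  have carr: "\<iota> ` set (take i xs) \<subseteq> carrier B"
    by (auto simp: one_notin_m)
  have tk: "set (take i (map \<iota> xs)) = \<iota> ` set (take i xs)"
    by (simp add: take_map)
  obtain a s where a: "r = frac a s" "s \<notin> m"
    using r by (auto simp: carrier_B)
  have "frac (a * xs ! i) s \<in> Idl\<^bsub>B\<^esub> (\<iota> ` set (take i xs))"
    using * i a(2) by (simp add: tk a(1) frac_mult one_notin_m)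
  then have "a * xs ! i \<in> contract (Idl\<^bsub>B\<^esub> (\<iota> ` set (take i xs)))"
    using frac_in_ideal_iff[OF B.genideal_ideal[OF carr] a(2)] by blast
  then obtain u where u: "u \<notin> m" "u * (a * xs ! i) \<in> idl.span (I \<union> set (take i xs))"
    by (auto simp: contract_Idl)
  then have "u * a \<in> idl.span (I \<union> set (take i xs))"
    using assms(1) i unfolding weakly_regular_def by (metis length_map mult.assoc)
  then have "a \<in> contract (Idl\<^bsub>B\<^esub> (\<iota> ` set (take i xs)))"
    using u(1) by (auto simp: contract_Idl)
  then show "r \<in> Idl\<^bsub>B\<^esub> (set (take i (map \<iota> xs)))"
    unfolding tk a(1) using frac_in_ideal_iff[OF B.genideal_ideal[OF carr] a(2)] by blast
qed

text \<open>Contraction sends chains of primes to chains of primes above I and keeps inclusions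
  strict.\<close>

lemma krull_dim_B_le:
  assumes chains: "\<And>Q n. \<forall>i\<le>n. is_prime_ideal (Q i) \<Longrightarrow> \<forall>i<n. Q i \<subset> Q (Suc i) \<Longrightarrow> I \<subseteq> Q 0 \<Longrightarrow> n \<le> D"
  shows "krull_dim B \<le> enat D"
proof -
  have bound: "n \<le> D" if Q: "\<forall>i\<le>n. primeideal (H i) B" "\<forall>i<n. H i \<subset> H (Suc i)" for n H
  proof (rule chains[of n "\<lambda>i. contract (H i)"])
    have id: "ideal (H i) B" if "i \<le> n" for i
      using Q(1) that by (blast intro: primeideal.axioms(1))
    show "\<forall>i\<le>n. is_prime_ideal (contract (H i))"
      using Q(1) contract_prime by blast
    show "\<forall>i<n. contract (H i) \<subset> contract (H (Suc i))"
    proof (intro allI impI psubsetI)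
      fix i assume i: "i < n"
      show "contract (H i) \<subseteq> contract (H (Suc i))"
        using Q(2) i by (auto simp: contract_def)
      show "contract (H i) \<noteq> contract (H (Suc i))"
        using ideal_eqI_contract[OF id[of "Suc i"] id[of i]] Q(2) i by auto
    qed
    show "I \<subseteq> contract (H 0)"
      by (rule contract_subspace[OF id]) simp
  qed
  then have "prime_height B P \<le> enat D" for P
    unfolding prime_height_def by (intro Sup_least) (auto dest: bound)
  then show ?thesis
    unfolding krull_dim_def by (intro Sup_least) auto
qed

text \<open>The inequalities length \<le> depth \<le> dimension \<le> length close up, the same
  number bounding the chains and counting the sequence.\<close>

lemma CM_local_B:
  assumes fg: "\<And>J :: 'a set. idl.subspace J \<Longrightarrow> \<exists>A. finite A \<and> J = idl.span A"
    and chains: "\<And>Q n. \<forall>i\<le>n. is_prime_ideal (Q i) \<Longrightarrow> \<forall>i<n. Q i \<subset> Q (Suc i) \<Longrightarrow> I \<subseteq> Q 0 \<Longrightarrow> n \<le> length xs"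
    and xs: "weakly_regular I xs" "set xs \<subseteq> m"
  shows "CM_local_ring B"
proof -
  have "depth B max_B \<le> krull_dim B"
    by (rule B.depth_le_krull_dim[OF noetherian_B[OF fg] B.maximalideal_prime[OF max_B_maximal]])
  moreover have "krull_dim B \<le> enat (length (map \<iota> xs))"
    unfolding length_map by (rule krull_dim_B_le[OF chains])
  moreover have "enat (length (map \<iota> xs)) \<le> depth B max_B"
    unfolding depth_def
    using regular_sequence_B[OF xs] xs(2) contract_max_B
    by (intro Sup_upper CollectI exI[of _ "map \<iota> xs"]) (auto simp: contract_def)
  ultimately have "depth B max_B = krull_dim B"
    by (meson antisym order_trans)
  then show ?thesis
    unfolding CM_local_ring_def
    using B.is_cring noetherian_B[OF fg] maximalideals_B by blast
qed

end

lemma noetherian_Quot: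
  fixes I :: "'a::comm_ring_1 set"
  assumes fg: "\<And>J :: 'a set. idl.subspace J \<Longrightarrow> \<exists>A. finite A \<and> J = idl.span A" and I: "idl.subspace I"
  shows "noetherian_ring (type_ring Quot I)"
proof -
  let ?Q = "type_ring Quot I"
  interpret I: ideal I type_ring
    using I by (simp add: ideal_type_ring_iff)
  interpret Q: cring "?Q"
    by (rule I.quotient_is_cring[OF type_ring.is_cring])
  interpret h: ring_hom_ring type_ring "?Q" "(+>\<^bsub>type_ring\<^esub>) I"
    by (rule I.rcos_ring_hom_ring)
  have carr: "carrier (?Q) = range ((+>\<^bsub>type_ring\<^esub>) I)"
    by (auto simp: FactRing_def A_RCOSETS_def')
  show ?thesis
  proof (rule Q.noetherian_ringI)
    fix H assume H: "ideal H (?Q)"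
    have "idl.subspace {a. I +>\<^bsub>type_ring\<^esub> a \<in> H}"
      using h.ideal_vimage[OF H] by (simp add: ideal_type_ring_iff)
    then obtain A where A: "finite A" "{a. I +>\<^bsub>type_ring\<^esub> a \<in> H} = idl.span A"
      using fg by blast
    let ?A = "(+>\<^bsub>type_ring\<^esub>) I ` A"
    have sub: "?A \<subseteq> carrier (?Q)"
      unfolding carr by blast
    have "?A \<subseteq> H"
      using A(2) idl.span_superset[of A] by blast
    then have "Idl\<^bsub>?Q\<^esub> ?A \<subseteq> H"
      by (intro Q.genideal_minimal H)
    moreover have "H \<subseteq> Idl\<^bsub>?Q\<^esub> ?A"
    proof
      fix z assume z: "z \<in> H"
      then obtain a where a: "z = I +>\<^bsub>type_ring\<^esub> a"
        using ideal.Icarr[OF H] carr by blast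
      have "idl.subspace {a. I +>\<^bsub>type_ring\<^esub> a \<in> Idl\<^bsub>?Q\<^esub> ?A}"
        using h.ideal_vimage[OF Q.genideal_ideal[OF sub]] by (simp add: ideal_type_ring_iff)
      then have "idl.span A \<subseteq> {a. I +>\<^bsub>type_ring\<^esub> a \<in> Idl\<^bsub>?Q\<^esub> ?A}"
        using Q.genideal_self[OF sub] by (intro idl.span_minimal) auto
      then show "z \<in> Idl\<^bsub>?Q\<^esub> ?A"
        using z A(2) a by blast
    qed
    ultimately show "\<exists>A\<subseteq>carrier (?Q). finite A \<and> H = Idl\<^bsub>?Q\<^esub> A"
      using sub A(1) by blast
  qed
qed

text \<open>A single \<open>D\<close> serves all maximal ideals: every localization has depth and
  dimension \<open>D\<close>.\<close>

lemma CM_ring_QuotI: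
  fixes I :: "'a::comm_ring_1 set"
  assumes fg: "\<And>J :: 'a set. idl.subspace J \<Longrightarrow> \<exists>A. finite A \<and> J = idl.span A" and I: "idl.subspace I"
    and chains: "\<And>Q n. \<forall>i\<le>n. is_prime_ideal (Q i) \<Longrightarrow> \<forall>i<n. Q i \<subset> Q (Suc i) \<Longrightarrow> I \<subseteq> Q 0 \<Longrightarrow> n \<le> D"
    and seq: "\<And>m. is_prime_ideal m \<Longrightarrow> (\<And>u. u \<notin> m \<Longrightarrow> \<exists>w. u * w - 1 \<in> m) \<Longrightarrow> I \<subseteq> m
      \<Longrightarrow> \<exists>xs. weakly_regular I xs \<and> set xs \<subseteq> m \<and> length xs = D"
  shows "CM_ring (type_ring Quot I)"
  unfolding CM_ring_def
proof (intro conjI allI impI)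
  let ?Q = "type_ring Quot I"
  interpret I: ideal I type_ring
    using I by (simp add: ideal_type_ring_iff)
  interpret Q: cring "?Q"
    by (rule I.quotient_is_cring[OF type_ring.is_cring])
  interpret h: ring_hom_ring type_ring "?Q" "(+>\<^bsub>type_ring\<^esub>) I"
    by (rule I.rcos_ring_hom_ring)
  show "cring (?Q)"
    by (rule Q.is_cring)
  show "noetherian_ring (?Q)"
    by (rule noetherian_Quot[OF fg I])
  fix M assume M: "maximalideal M (?Q)"
  interpret M: maximalideal M "?Q" by fact
  have carr: "carrier (?Q) = range ((+>\<^bsub>type_ring\<^esub>) I)"
    by (auto simp: FactRing_def A_RCOSETS_def')
  define m where "m = {a. I +>\<^bsub>type_ring\<^esub> a \<in> M}"
  have "primeideal m type_ring"
    using h.primeideal_vimage[OF type_ring.is_cring Q.maximalideal_prime[OF M]] by (simp add: m_def)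
  then have m: "is_prime_ideal m"
    by (simp add: primeideal_type_ring_iff)
  have Im: "I \<subseteq> m"
  proof
    fix a assume "a \<in> I"
    then have "I +>\<^bsub>type_ring\<^esub> a = \<zero>\<^bsub>?Q\<^esub>"
      using type_ring.a_rcos_zero[OF I.is_ideal] by (simp add: FactRing_def)
    then show "a \<in> m"
      using M.zero_closed by (simp add: m_def)
  qed
  interpret L: quotient_localization I m
    by unfold_locales (use I m Im in auto)
  have Mq: "M = L.q ` m"
    using M.Icarr carr by (fastforce simp: m_def L.q_def)
  \<comment> \<open>Maximality in elementwise form, R/m being a field; Zariski's lemma takes it as a
    hypothesis in this form.\<close>
  have max: "\<exists>w. u * w - 1 \<in> m" if "u \<notin> m" for u
  proof -
    let ?P = "PIdl\<^bsub>?Q\<^esub> (L.q u)"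
    have id: "ideal (M <+>\<^bsub>?Q\<^esub> ?P) (?Q)"
      by (intro Q.add_ideals M.is_ideal Q.cgenideal_ideal L.q_in_carrier)
    have 0: "\<zero>\<^bsub>?Q\<^esub> \<in> ?P"
      by (rule additive_subgroup.zero_closed[OF ideal.axioms(1)[OF Q.cgenideal_ideal[OF L.q_in_carrier]]])
    have "M \<subseteq> M <+>\<^bsub>?Q\<^esub> ?P"
    proof
      fix z assume "z \<in> M"
      then have "z \<oplus>\<^bsub>?Q\<^esub> \<zero>\<^bsub>?Q\<^esub> \<in> M <+>\<^bsub>?Q\<^esub> ?P"
        unfolding set_add_def' using 0 by blast
      then show "z \<in> M <+>\<^bsub>?Q\<^esub> ?P"
        using M.Icarr[OF \<open>z \<in> M\<close>] by simp
    qed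
    moreover have "L.q u \<in> M <+>\<^bsub>?Q\<^esub> ?P"
    proof -
      have "\<zero>\<^bsub>?Q\<^esub> \<oplus>\<^bsub>?Q\<^esub> L.q u \<in> M <+>\<^bsub>?Q\<^esub> ?P"
        unfolding set_add_def' using M.zero_closed Q.cgenideal_self[OF L.q_in_carrier] by blast
      then show ?thesis by simp
    qed
    moreover have "L.q u \<notin> M"
      using that by (simp add: m_def L.q_def)
    ultimately have "M <+>\<^bsub>?Q\<^esub> ?P = carrier (?Q)"
      using M.I_maximal[OF id] ideal.Icarr[OF id] by blast
    then have "L.q 1 \<in> M <+>\<^bsub>?Q\<^esub> ?P"
      by simp
    then obtain z y where "z \<in> M" "y \<in> carrier (?Q)" "L.q 1 = z \<oplus>\<^bsub>?Q\<^esub> y \<otimes>\<^bsub>?Q\<^esub> L.q u"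
      by (auto simp: set_add_def' cgenideal_def)
    then obtain a w where "a \<in> m" "L.q 1 = L.q (a + w * u)"
      by (auto simp: Mq L.carrier_Q)
    then have "1 - (a + w * u) \<in> m"
      using Im by (auto simp: L.q_eq_iff)
    then have "- ((1 - (a + w * u)) + a) \<in> m"
      using \<open>a \<in> m\<close> by (intro idl.subspace_neg idl.subspace_add is_prime_idealD(1)[OF m])
    then show ?thesis
      by (intro exI[of _ w]) (simp add: algebra_simps)
  qed
  obtain xs where xs: "weakly_regular I xs" "set xs \<subseteq> m" "length xs = D"
    using seq[OF m max Im] by blast
  have "CM_local_ring (localization (?Q) L.S)"
    by (rule L.CM_local_B[OF fg _ xs(1,2)]) (use chains xs(3) in auto)
  then show "CM_local_ring (localization (?Q) (carrier (?Q) - M))"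
    by (simp add: L.S_def Mq)
qed


section \<open>Ideals of shellable covers\<close>

lemma subst_span_image:
  assumes "r \<in> idl.span A" "\<And>x. x \<in> A \<Longrightarrow> subst cst \<sigma> x \<in> idl.span A'"
  shows "subst cst \<sigma> r \<in> idl.span A'"
  using assms(1)
  by (induction rule: idl.span_induct_alt)
    (auto intro!: idl.span_add idl.span_scale assms(2) idl.span_zero)

text \<open>The ideal is extended from the polynomial ring without \<open>Var w\<close>, hence
  closed under taking coefficients with respect to that variable.\<close>

lemma coeff_univar_in_span:
  assumes "G \<subseteq> polys_in (- {w})" "r \<in> idl.span G"
  shows "coeff (univar w r) i \<in> idl.span G"
  using assms(2)
proof (induction rule: idl.span_induct_alt)
  case (step c x y)
  have "univar w x = [:x:]"
    using step(1) assms(1) by (intro univar_free[of _ "- {w}"]) auto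
  then have "coeff (univar w (c * x + y)) i = coeff (univar w c) i * x + coeff (univar w y) i"
    by (simp add: mult.commute[of _ "[:x:]"] mult.commute)
  then show ?case
    using step by (simp add: idl.span_add idl.span_scale idl.span_base)
qed (simp add: idl.span_zero)

text \<open>The leading coefficient of F is a nonzero constant, hence a unit. So the coefficients of
  r with respect to \<open>Var w\<close> fall into the ideal one after the other, from the top
  downwards.\<close>

lemma univariate_regular:
  fixes w :: "'v::finite" and G :: "('v, 'k::field) mpoly set"
  assumes G: "G \<subseteq> polys_in (- {w})" and F: "F \<in> polys_over (polys_in {})" "F \<noteq> 0"
    and r: "r * poly F (Var w) \<in> idl.span G"
  shows "r \<in> idl.span G"
proof -
  define R where "R = univar w r"
  have const: "univar w c = [:c:]" if "c \<in> polys_in {}" for c :: "('v, 'k) mpoly"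
    using that by (intro univar_free[of _ "{}"]) auto
  have pw: "univar w (p ^ n) = univar w p ^ n" for p :: "('v, 'k) mpoly" and n
    by (induction n) simp_all
  have sm: "univar w (sum f A) = (\<Sum>i\<in>A. univar w (f i))" for f :: "nat \<Rightarrow> ('v, 'k) mpoly" and A
    by (induction A rule: infinite_finite_induct) simp_all
  have "univar w (poly F (Var w)) = (\<Sum>i\<le>degree F. monom (coeff F i) i)"
    unfolding poly_altdef sm
  proof (rule sum.cong)
    fix i
    have "univar w (coeff F i * Var w ^ i) = [:coeff F i:] * [:0, 1:] ^ i"
      using const[OF polys_overD[OF F(1)]] by (simp add: pw univar_Var)
    also have "\<dots> = monom (coeff F i) i"
      by (simp add: monom_altdef)
    finally show "univar w (coeff F i * Var w ^ i) = monom (coeff F i) i" .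
  qed simp
  then have F': "univar w (poly F (Var w)) = F"
    by (simp add: poly_as_sum_of_monoms)
  have RF: "coeff (R * F) i \<in> idl.span G" for i
    using coeff_univar_in_span[OF G r, of i] by (simp add: R_def F')
  define d where "d = degree F"
  have "coeff F d \<noteq> 0"
    using F(2) by (simp add: d_def)
  moreover obtain c where c: "coeff F d = cst c"
    using polys_in_empty polys_overD[OF F(1)] by blast
  ultimately have unit: "cst (inverse c) * coeff F d = 1"
    by (simp flip: cst_mult)
  have "coeff R i \<in> idl.span G" for i
  proof (induction "degree R - i" arbitrary: i rule: less_induct)
    case less
    show ?case
    proof (cases "i > degree R")
      case True
      then show ?thesis
        by (simp add: coeff_eq_0 idl.span_zero)
    next
      case False
      have IH: "coeff R j \<in> idl.span G" if "j > i" for j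
      proof (cases "j > degree R")
        case True
        then show ?thesis
          by (simp add: coeff_eq_0 idl.span_zero)
      next
        case False
        then show ?thesis
          using that by (intro less) auto
      qed
      have "coeff (R * F) (i + d) - coeff R i * coeff F d \<in> idl.span G"
        using IH by (intro coeff_mult_top) (auto simp: d_def coeff_eq_0 idl.span_zero)
      then have "coeff R i * coeff F d \<in> idl.span G"
        using idl.span_diff[OF RF[of "i + d"]] by fastforce
      then have "cst (inverse c) * (coeff R i * coeff F d) \<in> idl.span G"
        by (rule idl.span_scale)
      then show ?thesis
        using unit by (metis mult.left_commute mult_1_right)
    qed
  qed
  then have "poly R (Var w) \<in> idl.span G"
    by (intro poly_in_ideal) (auto simp: polys_over_def)
  then show ?thesis
    by (simp add: R_def)
qed

lemma poly_const_coeffs_in_polys_in: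
  "F \<in> polys_over (polys_in {}) \<Longrightarrow> v \<in> W \<Longrightarrow> poly F (Var v) \<in> polys_in W"
proof (rule poly_in_subring[OF is_subring_polys_in])
  have "polys_in {} \<subseteq> polys_in W"
    by (auto simp: polys_in_def)
  then show "F \<in> polys_over (polys_in {}) \<Longrightarrow> F \<in> polys_over (polys_in W)"
    by (auto simp: polys_over_def)
qed simp

text \<open>\<open>\<psi> t\<close> is a retraction of R with kernel P_C onto the ring A generated
  by the differences of variables in one fibre of \<rho>, and A is the same for every t. Regularity
  modulo P_C is therefore a question about A, and A is also R/P_C0, where the sequence becomes one
  of univariate polynomials in distinct variables.\<close>

lemma transversal_ideal_regular:
  fixes \<rho> :: "'v::finite \<Rightarrow> 'b" and t t0 :: "'b \<Rightarrow> 'v"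
  assumes t: "\<And>v. \<rho> (t (\<rho> v)) = \<rho> v" and t0: "\<And>v. \<rho> (t0 (\<rho> v)) = \<rho> v"
    and C: "C = t ` range \<rho>" and C0: "C0 = t0 ` range \<rho>"
    and vs: "distinct vs" "set vs = - C0"
    and F: "\<And>v. F v \<in> polys_over (polys_in {})" "\<And>v. F v \<noteq> 0"
  defines "\<psi> \<equiv> \<lambda>t. subst cst (\<lambda>v. Var v - Var (t (\<rho> v))) :: ('v, 'k::field) mpoly \<Rightarrow> ('v, 'k) mpoly"
  shows "weakly_regular (idl.span (Var ` C)) (map (\<lambda>v. \<psi> t0 (poly (F v) (Var v))) vs)"
  unfolding weakly_regular_def
proof (intro allI impI)
  let ?p = "\<lambda>v. poly (F v) (Var v)" and ?q = "\<lambda>v. \<psi> t0 (poly (F v) (Var v))"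
  let ?P = "idl.span (Var ` C)"
  have \<psi>_diff: "p - \<psi> s p \<in> idl.span (Var ` s ` range \<rho>)" for s p
    unfolding \<psi>_def by (rule diff_subst_in_ideal) (auto intro: idl.span_base)
  have \<psi>_kill: "\<psi> s p = 0" if "p \<in> idl.span (Var ` s ` range \<rho>)" and s: "\<And>v. \<rho> (s (\<rho> v)) = \<rho> v" for s p
    using that(1) by (induction rule: idl.span_induct_alt) (auto simp: \<psi>_def s)
  \<comment> \<open>Every \<open>\<psi> s\<close> fixes A: the two variables of a difference lie in
    one fibre of \<rho>, so the same variable is subtracted from both and cancels.\<close>
  have \<psi>_\<psi>: "\<psi> s (\<psi> s' p) = \<psi> s' p" if "\<And>v. \<rho> (s' (\<rho> v)) = \<rho> v" for s s' p
    using that by (induction p rule: mpoly_induct) (auto simp: \<psi>_def)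
  fix i r
  assume i: "i < length (map ?q vs)" and r: "r * map ?q vs ! i \<in> idl.span (?P \<union> set (take i (map ?q vs)))"
  define Ps where "Ps = ?p ` set (take i vs)"
  define Qs where "Qs = \<psi> t0 ` Ps"
  have Qs: "set (take i (map ?q vs)) = Qs"
    by (simp add: Qs_def Ps_def take_map image_image)
  have vi: "map ?q vs ! i = ?q (vs ! i)"
    using i by simp
  from r obtain y z where yz: "r * ?q (vs ! i) = y + z" "y \<in> ?P" "z \<in> idl.span Qs"
    unfolding Qs vi idl.span_Un by (auto simp: idl.span_span)
  \<comment> \<open>Applying \<open>\<psi> t\<close> moves the relation into A, since it kills the
    part y from P_C.\<close>
  have "\<psi> t r * ?q (vs ! i) = \<psi> t z"
  proof -
    have "\<psi> t (r * ?q (vs ! i)) = \<psi> t r * \<psi> t (?q (vs ! i))"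
      by (simp add: \<psi>_def)
    also have "\<psi> t (?q (vs ! i)) = ?q (vs ! i)"
      by (rule \<psi>_\<psi>[OF t0])
    finally show ?thesis
    proof -
      have "\<psi> t y = 0"
        by (rule \<psi>_kill[OF _ t]) (use yz(2) in \<open>simp add: C\<close>)
      then show "\<psi> t (r * ?q (vs ! i)) = \<psi> t r * ?q (vs ! i) \<Longrightarrow> \<psi> t r * ?q (vs ! i) = \<psi> t z"
        by (simp add: yz(1)) (simp add: \<psi>_def)
    qed
  qed
  moreover have "\<psi> t z \<in> idl.span Qs"
  proof -
    have "\<psi> t x \<in> idl.span Qs" if "x \<in> Qs" for x
      using that \<psi>_\<psi>[OF t0] by (auto simp: Qs_def intro: idl.span_base)
    then show ?thesis
      unfolding \<psi>_def by (intro subst_span_image[OF yz(3)])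
  qed
  ultimately have 1: "\<psi> t r * ?q (vs ! i) \<in> idl.span Qs"
    by simp
  \<comment> \<open>Now A is viewed as R/P_C0: modulo the variables of \<open>C0\<close> each
    \<open>?q v\<close> equals the univariate \<open>?p v\<close>.\<close>
  let ?G = "Var ` C0 \<union> Ps"
  have qp: "?q v \<in> idl.span (Var ` C0 \<union> A) \<longleftrightarrow> ?p v \<in> idl.span (Var ` C0 \<union> A)" for v A
  proof -
    have "?p v - ?q v \<in> idl.span (Var ` C0 \<union> A)"
      using \<psi>_diff[of "?p v" t0] idl.span_mono[of "Var ` C0" "Var ` C0 \<union> A"] by (auto simp: C0)
    then show ?thesis
      using idl.span_diff[of "?p v"] idl.span_add[of "?q v"] by fastforce
  qed
  have "Qs \<subseteq> idl.span ?G"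
  proof -
    have "?q v \<in> idl.span ?G" if "v \<in> set (take i vs)" for v
      unfolding qp using that by (intro idl.span_base) (auto simp: Ps_def)
    then show ?thesis
      by (auto simp: Qs_def Ps_def)
  qed
  then have "idl.span Qs \<subseteq> idl.span ?G"
    by (rule idl.span_minimal) simp
  then have "\<psi> t r * ?q (vs ! i) \<in> idl.span ?G"
    using 1 by blast
  moreover have "\<psi> t r * (?p (vs ! i) - ?q (vs ! i)) \<in> idl.span ?G"
    using \<psi>_diff[of "?p (vs ! i)" t0] idl.span_mono[of "Var ` C0" ?G] by (intro idl.span_scale) (auto simp: C0)
  ultimately have "\<psi> t r * ?p (vs ! i) \<in> idl.span ?G"
    using idl.span_add by (fastforce simp: algebra_simps)
  moreover have "?G \<subseteq> polys_in (- {vs ! i})"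
  proof -
    have "vs ! i \<notin> C0" "vs ! i \<notin> set (take i vs)"
      using i vs nth_mem[of i vs] by (auto simp: distinct_conv_nth in_set_conv_nth)
    then show ?thesis
      by (auto simp: Ps_def intro!: poly_const_coeffs_in_polys_in Var_in_polys_in F)
  qed
  ultimately have "\<psi> t r \<in> idl.span ?G"
    using univariate_regular[of ?G "vs ! i" "F (vs ! i)"] F by blast
  \<comment> \<open>Return to A: \<open>\<psi> t0\<close> kills \<open>C0\<close>, carries
    \<open>Ps\<close> to \<open>Qs\<close> and fixes \<open>\<psi> t r\<close>.\<close>
  then have "\<psi> t0 (\<psi> t r) \<in> idl.span Qs"
    unfolding \<psi>_def
  proof (rule subst_span_image)
    fix x assume "x \<in> ?G"
    then consider "x \<in> Var ` C0" | "x \<in> Ps"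
      by blast
    then have "\<psi> t0 x \<in> idl.span Qs"
    proof cases
      case 1
      then have "\<psi> t0 x = 0"
        by (intro \<psi>_kill[OF idl.span_base t0]) (simp add: C0)
      then show ?thesis
        by (simp add: idl.span_zero)
    next
      case 2
      then show ?thesis
        unfolding Qs_def by (intro idl.span_base imageI)
    qed
    then show "subst cst (\<lambda>v. Var v - Var (t0 (\<rho> v))) x \<in> idl.span Qs"
      by (simp add: \<psi>_def)
  qed
  then have "\<psi> t r \<in> idl.span Qs"
    by (simp add: \<psi>_\<psi>[OF t])
  moreover have "r - \<psi> t r \<in> ?P"
    using \<psi>_diff[of r t] by (simp add: C)
  ultimately have "(r - \<psi> t r) + \<psi> t r \<in> idl.span (?P \<union> Qs)"
    using idl.span_mono[of Qs "?P \<union> Qs"] by (intro idl.span_add) (auto intro: idl.span_base)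
  then show "r \<in> idl.span (?P \<union> set (take i (map ?q vs)))"
    by (simp add: Qs)
qed

text \<open>The facets shelled are the complements F of the covers: C_l - C_i is F_i - F_l, so this
  is the usual condition for a shelling order of facets.\<close>

definition shelling :: "'v set list \<Rightarrow> bool" where
  "shelling Cs \<longleftrightarrow> (\<forall>i<length Cs. \<forall>j<i. \<exists>l<i. \<exists>v. Cs ! l - Cs ! i = {v} \<and> v \<in> Cs ! j)"

definition cover_ideal :: "'v::finite set set \<Rightarrow> ('v, 'k::field) mpoly set" where
  "cover_ideal \<C> = (\<Inter>C\<in>\<C>. idl.span (Var ` C))"

lemma subspace_cover_ideal: "idl.subspace (cover_ideal \<C>)"
  unfolding cover_ideal_def by (intro idl.subspace_Int) simp

lemma mem_cover_ideal_iff: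
  "p \<in> cover_ideal \<C> \<longleftrightarrow> (\<forall>C\<in>\<C>. \<forall>b\<in>keys p. keys b \<inter> C \<noteq> {})"
  by (auto simp: cover_ideal_def span_Var)

definition sqfree :: "'v set \<Rightarrow> 'v \<Rightarrow>\<^sub>0 nat" where
  "sqfree C = (\<Sum>v\<in>C. single v 1)"

lemma lookup_sqfree: "finite C \<Longrightarrow> lookup (sqfree C) v = (if v \<in> C then 1 else 0)"
  by (auto simp: sqfree_def lookup_sum lookup_single when_def sum.delta)

lemma keys_sqfree [simp]: "finite C \<Longrightarrow> keys (sqfree C) = C"
  by (auto simp: in_keys_iff lookup_sqfree split: if_splits)

lemma sqfree_dvd_iff:
  assumes "finite C"
  shows "(\<exists>c. b = sqfree C + c) \<longleftrightarrow> C \<subseteq> keys b"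
proof
  assume "C \<subseteq> keys b"
  then have "b = sqfree C + (b - sqfree C)"
    using assms by (intro poly_mapping_eqI) (auto simp: lookup_add lookup_minus lookup_sqfree in_keys_iff subset_iff)
  then show "\<exists>c. b = sqfree C + c" ..
qed (use assms in \<open>auto simp: in_keys_iff lookup_add lookup_sqfree\<close>)

lemma prod_Var: "finite C \<Longrightarrow> (\<Prod>v\<in>C. Var v) = mono_poly (sqfree C)"
  by (simp add: sqfree_def mono_poly_sum Var_def)

text \<open>The squarefree monomial of the vertices \<open>v\<close> with \<open>C\<^sub>l - C\<^sub>i = {v}\<close> for some \<open>l < i\<close>
  generates the intersection of the earlier primes modulo the \<open>i\<close>-th one.\<close>

lemma cover_ideal_weakly_regular:
  fixes Cs :: "'v::finite set list"
  assumes "shelling Cs" and reg: "\<And>C. C \<in> set Cs \<Longrightarrow> weakly_regular (idl.span (Var ` C) :: ('v, 'k::field) mpoly set) xs"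
    and "0 < n" "n \<le> length Cs"
  shows "weakly_regular (cover_ideal (set (take n Cs))) xs"
  using assms(3,4)
proof (induction n)
  case (Suc n)
  show ?case
  proof (cases "n = 0")
    case True
    then have "set (take (Suc n) Cs) = {Cs ! 0}"
      using Suc.prems by (cases Cs) auto
    moreover have "Cs ! 0 \<in> set Cs"
      using Suc.prems by (intro nth_mem) linarith
    ultimately show ?thesis
      using reg by (simp only: cover_ideal_def) simp
  next
    case False
    let ?J = "cover_ideal (set (take n Cs)) :: ('v, 'k) mpoly set"
    let ?C = "Cs ! n"
    let ?P = "idl.span (Var ` ?C) :: ('v, 'k) mpoly set"
    define W where "W = {v. \<exists>l<n. Cs ! l - ?C = {v}}"
    define e where "e = sqfree W"
    have e: "keys e = W" "lookup e v = (if v \<in> W then 1 else 0)" for v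
      by (simp_all add: e_def lookup_sqfree)
    have earlier: "C \<in> set (take n Cs) \<longleftrightarrow> (\<exists>l<n. C = Cs ! l)" for C
      using Suc.prems by (auto simp: in_set_conv_nth)
    have "weakly_regular (?J \<inter> ?P) xs"
    proof (rule weakly_regular_inter[where s = "mono_poly e"])
      show "mono_poly e \<in> ?J"
      proof -
        have shell: "\<forall>j<n. \<exists>l<n. \<exists>v. Cs ! l - ?C = {v} \<and> v \<in> Cs ! j"
          using \<open>shelling Cs\<close> Suc.prems unfolding shelling_def by auto
        have "W \<inter> Cs ! j \<noteq> {}" if j: "j < n" for j
        proof -
          obtain l v where "l < n" "Cs ! l - ?C = {v}" "v \<in> Cs ! j"
            using shell j by blast
          then show ?thesis
            unfolding W_def by blast
        qed
        then show ?thesis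
          by (auto simp: mem_cover_ideal_iff mono_poly_def e earlier)
      qed
      show "t \<in> ?P" if "mono_poly e * t \<in> ?P" for t
      proof -
        have "W \<inter> ?C = {}"
          by (auto simp: W_def)
        then have "mono_poly e \<notin> ?P"
          by (auto simp: span_Var mono_poly_def e)
        then show ?thesis
          using span_Var_prime[OF that] by blast
      qed
      show "\<exists>t. y - mono_poly e * t \<in> ?P" if y: "y \<in> ?J" for y
        using y
      proof -
        \<comment> \<open>A power product of y that avoids \<open>?C\<close> must meet each earlier
          cover outside \<open>?C\<close>; for the covers that define \<open>W\<close> only one
          vertex is available, so it is divisible by that of \<open>e\<close>.\<close>
        have *: "\<exists>t. single b c - mono_poly e * t \<in> ?P" if b: "b \<in> keys y" for b c
        proof (cases "keys b \<inter> ?C = {}")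
          case True
          have "W \<subseteq> keys b"
          proof
            fix v assume "v \<in> W"
            then obtain l where l: "l < n" "Cs ! l - ?C = {v}"
              by (auto simp: W_def)
            have "Cs ! l \<in> set (take n Cs)"
              using l(1) by (simp add: earlier) blast
            then obtain w where w: "w \<in> keys b" "w \<in> Cs ! l"
              using y b unfolding mem_cover_ideal_iff by blast
            then have "w \<in> Cs ! l - ?C"
              using True by blast
            then have "w = v"
              unfolding l(2) by simp
            then show "v \<in> keys b"
              using w(1) by simp
          qed
          then have "b = e + (b - e)"
            by (intro poly_mapping_eqI) (auto simp: lookup_add lookup_minus e(2) in_keys_iff subset_iff)
          then have "single b c = mono_poly e * single (b - e) c"
            by (simp add: mono_poly_def mult_single)
          then show ?thesis
            using idl.span_zero by (intro exI[of _ "single (b - e) c"]) simp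
        next
          case False
          then have "single b c \<in> ?P"
            by (simp add: span_Var)
          then show ?thesis
            by (intro exI[of _ 0]) simp
        qed
        have "\<forall>b\<in>keys y. \<exists>t. single b (lookup y b) - mono_poly e * t \<in> ?P"
          by (rule ballI) (rule *)
        from bchoice[OF this] obtain t where t: "\<And>b. b \<in> keys y \<Longrightarrow>
            single b (lookup y b) - mono_poly e * t b \<in> ?P"
          by blast
        have "y - mono_poly e * (\<Sum>b\<in>keys y. t b)
            = (\<Sum>b\<in>keys y. single b (lookup y b) - mono_poly e * t b)"
          using poly_mapping_eq_sum_single[of "keys y" y]
          by (simp add: sum_subtractf sum_distrib_left)
        also have "\<dots> \<in> ?P"
          using t by (rule idl.span_sum)
        finally show ?thesis by blast
      qed
      show "weakly_regular ?J xs"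
        using Suc False by simp
      show "weakly_regular ?P xs"
        using reg[of ?C] Suc.prems by simp
    qed (simp_all add: subspace_cover_ideal)
    moreover have "cover_ideal (set (take (Suc n) Cs)) = ?J \<inter> ?P"
      using Suc.prems by (auto simp: cover_ideal_def take_Suc_conv_app_nth)
    ultimately show ?thesis
      by simp
  qed
qed simp

text \<open>Otherwise choose from every cover a variable outside P: the product of these lies in
  every P_C but not in P.\<close>

lemma prime_contains_span_Var:
  assumes P: "is_prime_ideal P" and "finite \<C>" and sub: "cover_ideal \<C> \<subseteq> P"
  shows "\<exists>C\<in>\<C>. Var ` C \<subseteq> P"
proof (rule ccontr)
  assume "\<not> ?thesis"
  then have "\<forall>C\<in>\<C>. \<exists>v\<in>C. Var v \<notin> P"
    by blast
  then obtain v where v: "\<And>C. C \<in> \<C> \<Longrightarrow> v C \<in> C \<and> Var (v C) \<notin> P"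
    by metis
  have "(\<Prod>C\<in>\<D>. Var (v C)) \<notin> P" if "finite \<D>" "\<D> \<subseteq> \<C>" for \<D>
    using that
  proof (induction \<D> rule: finite_induct)
    case (insert C \<D>)
    then show ?case
      using is_prime_idealD(3)[OF P, of "Var (v C)" "\<Prod>C\<in>\<D>. Var (v C)"] v by auto
  qed (use is_prime_idealD(2)[OF P] in simp)
  then have "(\<Prod>C\<in>\<C>. Var (v C)) \<notin> P"
    using assms(2) by blast
  moreover have "(\<Prod>C\<in>\<C>. Var (v C)) \<in> cover_ideal \<C>"
    unfolding cover_ideal_def
  proof
    fix C assume C: "C \<in> \<C>"
    have "(\<Prod>C\<in>\<C>. Var (v C)) = (\<Prod>C\<in>\<C> - {C}. Var (v C)) * Var (v C)"
      using prod.remove[OF assms(2) C] by (simp add: mult.commute)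
    then show "(\<Prod>C\<in>\<C>. Var (v C)) \<in> idl.span (Var ` C)"
      using v[OF C] by (metis idl.span_scale idl.span_base imageI)
  qed
  ultimately show False
    using sub by blast
qed

text \<open>That all covers are transversals of the fibres of one \<rho> has two effects: they have
  equal size, which fixes the dimension, and the sequence built from one cover \<open>C0\<close>
  inside m is regular modulo the others.\<close>

lemma CM_ring_cover_ideal:
  fixes Cs :: "'v::finite set list" and \<rho> :: "'v \<Rightarrow> 'b"
  assumes "shelling Cs" "Cs \<noteq> []"
    and trans: "\<And>C. C \<in> set Cs \<Longrightarrow> \<exists>t. (\<forall>v. \<rho> (t (\<rho> v)) = \<rho> v) \<and> C = t ` range \<rho>"
  shows "CM_ring (type_ring Quot (cover_ideal (set Cs) :: ('v, 'k::field) mpoly set))"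
proof (rule CM_ring_QuotI[where D = "card (UNIV :: 'v set) - card (range \<rho>)"])
  have card: "card (- C) = card (UNIV :: 'v set) - card (range \<rho>)" if C: "C \<in> set Cs" for C
  proof -
    obtain t where t: "\<forall>v. \<rho> (t (\<rho> v)) = \<rho> v" "C = t ` range \<rho>"
      using trans[OF C] by blast
    have "inj_on t (range \<rho>)"
      by (rule inj_on_inverseI[of _ \<rho>]) (use t in auto)
    then show ?thesis
      unfolding t(2) by (simp add: Compl_eq_Diff_UNIV card_Diff_subset card_image)
  qed
  show "n \<le> card (UNIV :: 'v set) - card (range \<rho>)"
    if Q: "\<forall>i\<le>n. is_prime_ideal (Q i)" "\<forall>i<n. Q i \<subset> Q (Suc i)" "cover_ideal (set Cs) \<subseteq> Q 0"
    for n and Q :: "nat \<Rightarrow> ('v, 'k) mpoly set"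
  proof -
    obtain C where C: "C \<in> set Cs" "Var ` C \<subseteq> Q 0"
      using prime_contains_span_Var[of "Q 0" "set Cs"] Q by auto
    then show ?thesis
      using prime_chain_length_le[of n Q C] Q card by auto
  qed
  fix m :: "('v, 'k) mpoly set"
  assume m: "is_prime_ideal m" "\<And>u. u \<notin> m \<Longrightarrow> \<exists>w. u * w - 1 \<in> m" "cover_ideal (set Cs) \<subseteq> m"
  obtain C0 where C0: "C0 \<in> set Cs" "Var ` C0 \<subseteq> m"
    using prime_contains_span_Var[of m "set Cs"] m by auto
  obtain t0 where t0: "\<And>v. \<rho> (t0 (\<rho> v)) = \<rho> v" "C0 = t0 ` range \<rho>"
    using trans[OF C0(1)] by blast
  obtain vs where vs: "set vs = - C0" "distinct vs"
    using finite_distinct_list[of "- C0"] by auto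
  have "\<exists>F\<in>polys_over (polys_in {}). F \<noteq> 0 \<and> poly F (Var v) \<in> m" for v
    using is_prime_idealD[OF m(1)] m(2) by (intro maximal_contains_univariate) auto
  then obtain F where F: "\<And>v. F v \<in> polys_over (polys_in {})" "\<And>v. F v \<noteq> 0" "\<And>v. poly (F v) (Var v) \<in> m"
    by metis
  define xs where "xs = map (\<lambda>v. subst cst (\<lambda>v. Var v - Var (t0 (\<rho> v))) (poly (F v) (Var v))) vs"
  have "weakly_regular (idl.span (Var ` C)) xs" if C: "C \<in> set Cs" for C
  proof -
    obtain t where t: "\<And>v. \<rho> (t (\<rho> v)) = \<rho> v" "C = t ` range \<rho>"
      using trans[OF C] by blast
    show ?thesis
      unfolding xs_def by (rule transversal_ideal_regular[OF t(1) t0(1) t(2) t0(2) vs(2,1) F(1,2)])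
  qed
  then have "weakly_regular (cover_ideal (set Cs)) xs"
    using cover_ideal_weakly_regular[OF assms(1), of xs "length Cs"] assms(2) by simp
  \<comment> \<open>The substitution changes a polynomial only by an element of P_C0, which lies in
    m, so the univariate polynomials stay in m.\<close>
  moreover have "set xs \<subseteq> m"
  proof -
    have "p - subst cst (\<lambda>v. Var v - Var (t0 (\<rho> v))) p \<in> m" for p :: "('v, 'k) mpoly"
      using C0(2) t0(2) by (intro diff_subst_in_ideal[OF is_prime_idealD(1)[OF m(1)]]) auto
    then have "subst cst (\<lambda>v. Var v - Var (t0 (\<rho> v))) (poly (F v) (Var v)) \<in> m" for v
      using idl.subspace_diff[OF is_prime_idealD(1)[OF m(1)] F(3)[of v], of "poly (F v) (Var v) - _"] by simp
    then show ?thesis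
      by (auto simp: xs_def)
  qed
  moreover have "length xs = card (UNIV :: 'v set) - card (range \<rho>)"
    using card[OF C0(1)] distinct_card[OF vs(2)] vs(1) by (simp add: xs_def)
  ultimately show "\<exists>xs. weakly_regular (cover_ideal (set Cs)) xs \<and> set xs \<subseteq> m
      \<and> length xs = card (UNIV :: 'v set) - card (range \<rho>)"
    by blast
qed (simp_all add: mpoly_ideal_fg subspace_cover_ideal)


section \<open>Linear quotients and heights of edge ideals\<close>

lemma mdeg_sqfree: "finite C \<Longrightarrow> mdeg (sqfree C) = card C"
  by (simp add: mdeg_def lookup_sqfree)

lemma Idl_prod_Var:
  fixes \<C> :: "'v::finite set set"
  shows "Idl\<^bsub>mpoly_ring\<^esub> {\<Prod>v\<in>C. Var v | C. C \<in> \<C>}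
    = (idl.span (mono_poly ` sqfree ` \<C>) :: ('v, 'k::field) mpoly set)"
proof -
  have "{\<Prod>v\<in>C. Var v | C. C \<in> \<C>} = (mono_poly ` sqfree ` \<C> :: ('v, 'k) mpoly set)"
    by (auto simp: prod_Var)
  then show ?thesis
    by (simp add: mpoly_ring_eq_type_ring Idl_type_ring)
qed

lemma mem_span_sqfree_iff:
  fixes \<C> :: "'v::finite set set"
  shows "p \<in> idl.span (mono_poly ` sqfree ` \<C>) \<longleftrightarrow> (\<forall>b\<in>keys p. \<exists>C\<in>\<C>. C \<subseteq> keys b)"
  by (simp add: span_mono_poly sqfree_dvd_iff)

lemma keys_mult_mono_poly:
  fixes r :: "('v, 'k::field) mpoly"
  shows "keys (r * mono_poly a) = (\<lambda>b. b + a) ` keys r"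
proof -
  have "r * mono_poly a = (\<Sum>b\<in>keys r. single (b + a) (lookup r b))"
    by (subst poly_mapping_eq_sum_single[of "keys r" r])
      (simp_all add: sum_distrib_right mono_poly_def mult_single)
  then have *: "lookup (r * mono_poly a) e
      = (\<Sum>b\<in>keys r. if b + a = e then lookup r b else 0)" for e
    by (simp add: lookup_sum lookup_single when_def)
  have "lookup (r * mono_poly a) (b + a) = lookup r b" for b
    unfolding * by (simp add: sum.delta in_keys_iff)
  moreover have "e \<in> (\<lambda>b. b + a) ` keys r" if "lookup (r * mono_poly a) e \<noteq> 0" for e
  proof (rule ccontr)
    assume "\<not> ?thesis"
    then have "lookup (r * mono_poly a) e = 0"
      unfolding * by (intro sum.neutral) auto
    then show False
      using that by simp
  qed
  ultimately show ?thesis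
    by (auto simp: in_keys_iff)
qed

text \<open>A power product with support S lies in the i-th colon ideal iff some earlier cover is
  contained in S and \<open>Cs ! i\<close> together. The shelling reduces this to S meeting
  \<open>W\<close>, so variables generate the colon ideal. Equal sizes make the generators minimal
  and their degrees constant.\<close>

lemma linear_quotients_of_shelling:
  fixes Cs :: "'v::finite set list"
  assumes "distinct Cs" "shelling Cs" and card: "\<And>C. C \<in> set Cs \<Longrightarrow> card C = n"
  shows "linear_quotients (Idl\<^bsub>mpoly_ring\<^esub> {\<Prod>v\<in>C. Var v | C. C \<in> set Cs} :: ('v, 'k::field) mpoly set)"
proof -
  let ?I = "Idl\<^bsub>mpoly_ring\<^esub> {\<Prod>v\<in>C. Var v | C. C \<in> set Cs} :: ('v, 'k) mpoly set"
  let ?colon = "\<lambda>i. colon mpoly_ring (Idl\<^bsub>mpoly_ring\<^esub> (mono_poly ` set (take i (map sqfree Cs)))) (mono_poly (map sqfree Cs ! i)) :: ('v, 'k) mpoly set"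
  show ?thesis
    unfolding linear_quotients_def
  proof (intro exI[of _ "map sqfree Cs"] conjI allI impI ballI)
    have inj: "inj_on sqfree \<C>" for \<C> :: "'v set set"
      by (rule inj_on_inverseI[of _ keys]) simp
    show "distinct (map sqfree Cs)"
      using assms(1) inj by (simp add: distinct_map)
    show "Idl\<^bsub>mpoly_ring\<^esub> (mono_poly ` set (map sqfree Cs)) = ?I"
      unfolding Idl_prod_Var by (simp add: mpoly_ring_eq_type_ring Idl_type_ring)
    show "sorted (map mdeg (map sqfree Cs))"
      using card by (simp add: sorted_iff_nth_mono mdeg_sqfree)
  next
    fix A assume A: "A \<subset> set (map sqfree Cs)"
    then obtain C where C: "C \<in> set Cs" "sqfree C \<notin> A"
      by auto
    define \<D> where "\<D> = {C \<in> set Cs. sqfree C \<in> A}"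
    have \<D>: "A = sqfree ` \<D>" "\<D> \<subseteq> set Cs"
      using A by (auto simp: \<D>_def)
    have "mono_poly (sqfree C) \<notin> (idl.span (mono_poly ` A) :: ('v, 'k) mpoly set)"
    proof
      assume "mono_poly (sqfree C) \<in> (idl.span (mono_poly ` A) :: ('v, 'k) mpoly set)"
      then obtain D where D: "D \<in> \<D>" "D \<subseteq> C"
        unfolding \<D>(1) mem_span_sqfree_iff by (auto simp: mono_poly_def)
      then have "D = C"
        using card[of D] card[OF C(1)] \<D>(2) by (intro card_subset_eq) auto
      then show False
        using C(2) D(1) \<D>(1) by blast
    qed
    moreover have "mono_poly (sqfree C) \<in> (idl.span (mono_poly ` sqfree ` set Cs) :: ('v, 'k) mpoly set)"
      using C(1) by (intro idl.span_base) blast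
    ultimately show "Idl\<^bsub>mpoly_ring\<^esub> (mono_poly ` A) \<noteq> ?I"
      unfolding Idl_prod_Var by (auto simp: mpoly_ring_eq_type_ring Idl_type_ring)
  next
    fix i assume "i \<in> {1..<length (map sqfree Cs)}"
    then have i: "i < length Cs"
      by simp
    define W where "W = {v. \<exists>l<i. Cs ! l - Cs ! i = {v}}"
    have "?colon i
        = (Idl\<^bsub>mpoly_ring\<^esub> (Var ` W) :: ('v, 'k) mpoly set)"
    proof (rule Set.set_eqI)
      fix r :: "('v, 'k) mpoly"
      have earlier: "(\<exists>C\<in>set (take i Cs). P C) \<longleftrightarrow> (\<exists>l<i. P (Cs ! l))" for P
      proof -
        have "set (take i Cs) = (!) Cs ` {..<i}"
          using nth_image[of i Cs] i by (simp add: lessThan_atLeast0)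
        then show ?thesis
          by auto
      qed
      have "keys (b + sqfree C) = keys b \<union> C" for b and C :: "'v set"
        by (auto simp: in_keys_iff lookup_add lookup_sqfree)
      then have "r \<in> ?colon i
          \<longleftrightarrow> (\<forall>b\<in>keys r. \<exists>l<i. Cs ! l \<subseteq> keys b \<union> Cs ! i)"
        using i by (auto simp: colon_def mpoly_ring_eq_type_ring Idl_type_ring take_map mem_span_sqfree_iff keys_mult_mono_poly earlier)
      also have "\<dots> \<longleftrightarrow> (\<forall>b\<in>keys r. keys b \<inter> W \<noteq> {})"
      proof (intro ball_cong refl iffI)
        fix b :: "'v \<Rightarrow>\<^sub>0 nat"
        assume "\<exists>l<i. Cs ! l \<subseteq> keys b \<union> Cs ! i"
        then obtain j where j: "j < i" "Cs ! j \<subseteq> keys b \<union> Cs ! i" by blast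
        then obtain l v where "l < i" "Cs ! l - Cs ! i = {v}" "v \<in> Cs ! j"
          using assms(2) i unfolding shelling_def by blast
        then show "keys b \<inter> W \<noteq> {}"
          using j(2) unfolding W_def by blast
      next
        fix b :: "'v \<Rightarrow>\<^sub>0 nat"
        assume "keys b \<inter> W \<noteq> {}"
        then obtain v l where vl: "v \<in> keys b" "l < i" "Cs ! l - Cs ! i = {v}"
          by (auto simp: W_def)
        then have "Cs ! l - Cs ! i \<subseteq> keys b"
          by simp
        then have "Cs ! l \<subseteq> keys b \<union> Cs ! i"
          unfolding Diff_subset_conv by (simp add: Un_commute)
        then show "\<exists>l<i. Cs ! l \<subseteq> keys b \<union> Cs ! i"
          using vl(2) by blast
      qed
      also have "\<dots> \<longleftrightarrow> r \<in> Idl\<^bsub>mpoly_ring\<^esub> (Var ` W)"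
        by (simp add: mpoly_ring_eq_type_ring Idl_type_ring span_Var)
      finally show "r \<in> ?colon i
        \<longleftrightarrow> r \<in> Idl\<^bsub>mpoly_ring\<^esub> (Var ` W)" .
    qed
    moreover have "Var ` W \<subseteq> (linear_forms :: ('v, 'k) mpoly set)"
      by (auto simp: linear_forms_def Var_def mono_poly_def mdeg_def)
    ultimately show "\<exists>L\<subseteq>(linear_forms :: ('v, 'k) mpoly set).
        ?colon i
          = Idl\<^bsub>mpoly_ring\<^esub> L"
      by blast
  qed
qed

section \<open>Minimal covers, the edge ideal and its height\<close>

lemma vertex_cover_contains_minimal:
  "vertex_cover E D \<Longrightarrow> \<exists>C\<subseteq>D. minimal_vertex_cover E C"
proof (induction D rule: finite_psubset_induct[OF finite])
  case (1 D)
  show ?case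
  proof (cases "minimal_vertex_cover E D")
    case False
    then obtain D' where "D' \<subset> D" "vertex_cover E D'"
      using 1 by (auto simp: minimal_vertex_cover_def)
    then show ?thesis
      using 1(2)[of D'] by blast
  qed blast
qed

text \<open>A support contains an edge iff it meets every minimal cover: if it contains no edge, its
  complement is a cover and so contains a minimal one.\<close>

lemma edge_ideal_eq_cover_ideal:
  fixes E :: "'v::finite set set"
  shows "edge_ideal E = (cover_ideal {C. minimal_vertex_cover E C} :: ('v, 'k::field) mpoly set)"
proof -
  have *: "(\<exists>e\<in>E. e \<subseteq> W) \<longleftrightarrow> (\<forall>C. minimal_vertex_cover E C \<longrightarrow> W \<inter> C \<noteq> {})" for W
  proof
    show "\<forall>C. minimal_vertex_cover E C \<longrightarrow> W \<inter> C \<noteq> {}" if "\<exists>e\<in>E. e \<subseteq> W"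
      using that by (fastforce simp: minimal_vertex_cover_def vertex_cover_def)
    show "\<exists>e\<in>E. e \<subseteq> W" if "\<forall>C. minimal_vertex_cover E C \<longrightarrow> W \<inter> C \<noteq> {}"
    proof (rule ccontr)
      assume "\<not> (\<exists>e\<in>E. e \<subseteq> W)"
      then have "vertex_cover E (- W)"
        by (auto simp: vertex_cover_def)
      then show False
        using vertex_cover_contains_minimal[of E "- W"] that by blast
    qed
  qed
  have "(edge_ideal E :: ('v, 'k) mpoly set) = idl.span (mono_poly ` sqfree ` E)"
    unfolding edge_ideal_def by (rule Idl_prod_Var)
  then show ?thesis
    by (simp add: set_eq_iff mem_span_sqfree_iff mem_cover_ideal_iff *) blast
qed

lemma is_prime_ideal_span_Var: "is_prime_ideal (idl.span (Var ` C) :: ('v::finite, 'k::field) mpoly set)"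
proof -
  have "1 \<notin> (idl.span (Var ` C) :: ('v, 'k) mpoly set)"
    by (simp add: span_Var)
  then show ?thesis
    unfolding is_prime_ideal_def using span_Var_prime idl.subspace_span by blast
qed

lemma prime_height_ge_card:
  fixes P :: "('v::finite, 'k::field) mpoly set"
  assumes P: "is_prime_ideal P" and C: "Var ` C \<subseteq> P"
  shows "enat (card C) \<le> prime_height mpoly_ring P"
proof -
  obtain vs where vs: "set vs = C" "distinct vs"
    using finite_distinct_list[of C] by auto
  then have n: "length vs = card C"
    using distinct_card by fastforce
  \<comment> \<open>The last entry is P and not the ideal of all variables of C, since a chain
    counted by \<open>prime_height\<close> has to end in P.\<close>
  define Q where "Q = (\<lambda>i. if i < card C then idl.span (Var ` set (take i vs)) else P)"
  have "\<forall>i\<le>card C. primeideal (Q i) mpoly_ring"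
    using P by (simp add: Q_def mpoly_ring_eq_type_ring primeideal_type_ring_iff is_prime_ideal_span_Var)
  moreover have "Q i \<subset> Q (Suc i)" if i: "i < card C" for i
  proof -
    have new: "vs ! i \<notin> set (take i vs)"
      using i n vs(2) by (auto simp: distinct_conv_nth in_set_conv_nth)
    have "Var (vs ! i) \<notin> idl.span (Var ` set (take i vs))"
      using new by (subst span_Var) (simp add: Var_def mono_poly_def)
    moreover have "idl.span (Var ` set (take i vs)) \<subseteq> idl.span (Var ` set (take (Suc i) vs))"
      by (intro idl.span_mono image_mono set_take_subset_set_take) simp
    moreover have "idl.span (Var ` set (take i vs)) \<subseteq> P"
      using C vs(1) set_take_subset[of i vs] by (intro idl.span_minimal is_prime_idealD(1)[OF P]) blast
    moreover have "Var (vs ! i) \<in> idl.span (Var ` set (take (Suc i) vs))"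
      using i n by (intro idl.span_base) (simp add: take_Suc_conv_app_nth)
    moreover have "Var (vs ! i) \<in> P"
      using C i n vs(1) nth_mem[of i vs] by auto
    ultimately show ?thesis
      using i unfolding Q_def by (cases "Suc i < card C") auto
  qed
  moreover have "Q (card C) = P"
    by (simp add: Q_def)
  ultimately show ?thesis
    unfolding prime_height_def by (intro Sup_upper) blast
qed

text \<open>Every prime over the edge ideal contains the variables of some minimal cover. When the
  height is given, this bounds the size of covers from above.\<close>

lemma ideal_height_edge_ideal_ge:
  fixes E :: "'v::finite set set"
  assumes "\<And>C. minimal_vertex_cover E C \<Longrightarrow> n \<le> card C"
  shows "enat n \<le> ideal_height mpoly_ring (edge_ideal E :: ('v, 'k::field) mpoly set)"
  unfolding ideal_height_def
proof (rule Inf_greatest)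
  fix z assume "z \<in> {prime_height mpoly_ring P | P. primeideal P mpoly_ring \<and> (edge_ideal E :: ('v, 'k) mpoly set) \<subseteq> P}"
  then obtain P :: "('v, 'k) mpoly set" where P: "z = prime_height mpoly_ring P" "is_prime_ideal P" "edge_ideal E \<subseteq> P"
    by (auto simp: mpoly_ring_eq_type_ring primeideal_type_ring_iff)
  obtain C where C: "minimal_vertex_cover E C" "Var ` C \<subseteq> P"
    using prime_contains_span_Var[OF P(2), of "{C. minimal_vertex_cover E C}"] P(3)
    by (auto simp: edge_ideal_eq_cover_ideal)
  show "enat n \<le> z"
    using prime_height_ge_card[OF P(2) C(2)] assms[OF C(1)] P(1)
    by (metis enat_ord_simps(1) order_trans)
qed


section \<open>Admissible clutters\<close>

lemma sort_key_set_list: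
  fixes key :: "'a \<Rightarrow> 'b::linorder"
  assumes "finite A"
  obtains xs where "set xs = A" "distinct xs" "sorted (map key xs)"
proof -
  obtain ys where "set ys = A" "distinct ys"
    using finite_distinct_list[OF assms] by blast
  then show ?thesis
    using that[of "sort_key key ys"] by simp
qed

text \<open>The exchange yields a strictly smaller key, which forces an earlier position however
  ties are ordered.\<close>

lemma shelling_of_key:
  fixes key :: "'v set \<Rightarrow> 'b::linorder"
  assumes "distinct Cs" "sorted (map key Cs)"
    and exch: "\<And>C C'. C \<in> set Cs \<Longrightarrow> C' \<in> set Cs \<Longrightarrow> C \<noteq> C' \<Longrightarrow> key C' \<le> key C
      \<Longrightarrow> \<exists>D\<in>set Cs. key D < key C \<and> (\<exists>v. D - C = {v} \<and> v \<in> C')"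
  shows "shelling Cs"
  unfolding shelling_def
proof (intro allI impI)
  fix i j assume ij: "i < length Cs" "j < i"
  then have "Cs ! i \<noteq> Cs ! j" "key (Cs ! j) \<le> key (Cs ! i)"
    using assms(1) sorted_nth_mono[OF assms(2), of j i] by (auto simp: distinct_conv_nth)
  then obtain D v where D: "D \<in> set Cs" "key D < key (Cs ! i)" "D - Cs ! i = {v}" "v \<in> Cs ! j"
    using exch[of "Cs ! i" "Cs ! j"] ij by auto
  obtain l where l: "l < length Cs" "D = Cs ! l"
    using D(1) by (auto simp: in_set_conv_nth)
  have "l < i"
  proof (rule ccontr)
    assume "\<not> l < i"
    then have "key (Cs ! i) \<le> key (Cs ! l)"
      using sorted_nth_mono[OF assms(2), of i l] l(1) ij by auto
    then show False
      using D(2) l(2) by simp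
  qed
  then show "\<exists>l<i. \<exists>v. Cs ! l - Cs ! i = {v} \<and> v \<in> Cs ! j"
    using D l by auto
qed

lemma partition_on_index:
  assumes "partition_on UNIV (X ` A)" "inj_on X A"
  shows "\<exists>!i. i \<in> A \<and> v \<in> X i"
proof -
  have "v \<in> \<Union> (X ` A)"
    using assms(1) by (simp add: partition_on_def)
  then obtain i where i: "i \<in> A" "v \<in> X i" by blast
  moreover have "j = i" if "j \<in> A" "v \<in> X j" for j
  proof (rule inj_onD[OF assms(2)])
    show "X j = X i"
      using partition_onD2[OF assms(1)] i that unfolding disjoint_def by blast
  qed (use that i in auto)
  ultimately show ?thesis by blast
qed

theorem theorem4p1:
  fixes E :: "'v::finite set set"
  assumes "clutter E"
    and "uniform E"
    and "admissible TYPE('k::field) E"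
    and "unmixed E"
    and "ideal_height mpoly_ring (edge_ideal E :: ('v, 'k) mpoly set) = 3"
  shows "linear_quotients (alexander_dual E :: ('v, 'k) mpoly set) \<and>
         CM_clutter TYPE('k) E"
proof -
  obtain g d X f where adm: "ideal_height mpoly_ring (edge_ideal E :: ('v, 'k) mpoly set) = enat g"
    "partition_on UNIV (X ` {1..d})" "inj_on X {1..d}"
    "partition_on UNIV (f ` {1..g})" "inj_on f {1..g}"
    "\<forall>i\<in>{1..g}. \<forall>j\<in>{1..d}. card (f i \<inter> X j) \<le> 1"
    "\<forall>i\<in>{1..g}. f i \<in> E" "\<forall>e\<in>E. admissible_set d X g f e"
    using assms(3) unfolding admissible_def by blast
  have g: "g = 3"
    using adm(1) assms(5) by (simp add: numeral_eq_enat)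
  note X = partition_on_index[OF adm(2,3)] and f = partition_on_index[OF adm(4,5)]
  \<comment> \<open>Coordinates of a vertex: \<open>row\<close> is its index among the e_i and
    \<open>col\<close> its index among the classes X; the two together determine it.\<close>
  define row where "row = (\<lambda>v. THE i. i \<in> {1..g} \<and> v \<in> f i)"
  define col where "col = (\<lambda>v. THE l. l \<in> {1..d} \<and> v \<in> X l)"
  have row: "row v \<in> {1..3}" "v \<in> f (row v)" for v
    using theI'[OF f[of v]] by (simp_all add: row_def g)
  have row_eq: "row v = i" if "i \<in> {1..3}" "v \<in> f i" for v i
    using f[of v] row[of v] that by (auto simp: g)
  have col: "col v \<in> {1..d}" "v \<in> X (col v)" for v
    using theI'[OF X[of v]] by (simp_all add: col_def)
  have row_col: "v = w" if "row v = row w" "col v = col w" for v w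
  proof -
    have "card (f (row v) \<inter> X (col v)) \<le> 1"
      using adm(6) row[of v] col[of v] by (auto simp: g)
    moreover have "v \<in> f (row v) \<inter> X (col v)" "w \<in> f (row v) \<inter> X (col v)"
      using row[of v] row[of w] col[of v] col[of w] that by auto
    ultimately show ?thesis
      by (auto simp: card_le_Suc0_iff_eq)
  qed
  have fE: "f i \<in> E" if "i \<in> {1..3}" for i
    using adm(7) that by (simp add: g)
  have col_le: "col v \<le> card e" if "e \<in> E" "v \<in> e" for e v
    using adm(8) that col[of v] unfolding admissible_set_def by blast
  have edge: "\<exists>w\<in>e. col w = l" if "e \<in> E" "1 \<le> l" "l \<le> card e" "l \<le> d" for e l
  proof -
    have "e \<inter> X l \<noteq> {}"
      using adm(8) that unfolding admissible_set_def by auto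
    then obtain w where w: "w \<in> e" "w \<in> X l" by blast
    then have "col w = l"
      using X[of w] col[of w] that by auto
    then show ?thesis
      using w by blast
  qed
  have edge_mono: "row v \<le> row w" if e: "e \<in> E" "v \<in> e" "w \<in> e" "col v \<le> col w" for e v w
  proof -
    have "admissible_set d X 3 f e"
      using adm(8) e(1) g by simp
    then obtain j where j: "\<forall>l\<in>{1..card e}. j l \<in> {1..3} \<and> e \<inter> X l \<subseteq> f (j l)" "mono_on {1..card e} j"
      unfolding admissible_set_def by (elim conjE exE)
    have in_range: "col u \<in> {1..card e}" if "u \<in> e" for u
      using col[of u] col_le[OF e(1) that] by auto
    have "row u = j (col u)" if "u \<in> e" for u
      using bspec[OF j(1) in_range[OF that]] col[of u] that by (intro row_eq) auto
    then show ?thesis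
      using mono_onD[OF j(2) in_range[OF e(2)] in_range[OF e(3)] e(4)] e(2,3) by simp
  qed
  have cover_rows: "row ` C = {1..3}" if C: "vertex_cover E C" for C
  proof
    show "{1..3} \<subseteq> row ` C"
    proof
      fix i :: nat assume i: "i \<in> {1..3}"
      then obtain v where "v \<in> C" "v \<in> f i"
        using C fE unfolding vertex_cover_def by blast
      then show "i \<in> row ` C"
        using row_eq[OF i] by blast
    qed
  qed (use row in auto)
  have "vertex_cover E UNIV"
    using assms(1) by (auto simp: vertex_cover_def clutter_def)
  then obtain C0 where C0: "minimal_vertex_cover E C0"
    using vertex_cover_contains_minimal by blast
  \<comment> \<open>At most three, because by unmixedness the common size of the minimal covers is
    at most the height; at least three, because a cover meets the three disjoint edges
    \<open>f i\<close>.\<close>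
  have card: "card C = 3" if C: "minimal_vertex_cover E C" for C
  proof -
    have "enat (card C) \<le> ideal_height mpoly_ring (edge_ideal E :: ('v, 'k) mpoly set)"
      using assms(4) C unfolding unmixed_def by (intro ideal_height_edge_ideal_ge) (metis order_refl)
    then have "card C \<le> 3"
      using assms(5) by (simp add: numeral_eq_enat)
    then show ?thesis
      using card_image_le[of C row] cover_rows[of C] C by (simp add: minimal_vertex_cover_def)
  qed
  have row_bij: "bij_betw row C {1..3}" if C: "minimal_vertex_cover E C" for C
    using cover_rows[of C] card[OF C] C
    by (simp add: minimal_vertex_cover_def bij_betw_def eq_card_imp_inj_on)
  \<comment> \<open>A minimal cover inside the triple already has three elements, so it is the
    triple.\<close>
  have min_cover: "minimal_vertex_cover E {a, b, c}" if abc: "vertex_cover E {a, b, c}" for a b c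
  proof -
    obtain C where C: "C \<subseteq> {a, b, c}" "minimal_vertex_cover E C"
      using vertex_cover_contains_minimal[OF abc] by blast
    moreover have "card {a, b, c} \<le> 3"
      by (simp add: card_insert_if)
    ultimately have "C = {a, b, c}"
      using card[OF C(2)] by (intro card_seteq) auto
    then show ?thesis
      using C(2) by simp
  qed
  have triple: "\<exists>a b c. C = {a, b, c} \<and> row a = 1 \<and> row b = 2 \<and> row c = 3"
    if C: "minimal_vertex_cover E C" for C
  proof -
    have img: "row ` C = {1..3}" and inj: "inj_on row C"
      using row_bij[OF C] by (simp_all add: bij_betw_def)
    have "1 \<in> row ` C" "2 \<in> row ` C" "3 \<in> row ` C"
      unfolding img by simp_all
    then obtain a b c where abc: "a \<in> C" "b \<in> C" "c \<in> C" "row a = 1" "row b = 2" "row c = 3"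
      by (metis imageE)
    have "C \<subseteq> {a, b, c}"
    proof
      fix v assume v: "v \<in> C"
      then have "row v = 1 \<or> row v = 2 \<or> row v = 3"
        using row(1)[of v] by auto
      then show "v \<in> {a, b, c}"
        using inj_onD[OF inj _ v] abc by auto
    qed
    then show ?thesis
      using abc by blast
  qed
  have lower: "vertex_cover E {a', b, c}"
    if hyps: "vertex_cover E {a, b, c}" "row a = 1" "row a' = 1" "col a' \<le> col a" for a a' b c
    unfolding vertex_cover_def
  proof
    fix e assume e: "e \<in> E"
    show "{a', b, c} \<inter> e \<noteq> {}"
    proof (cases "a \<in> e")
      case True
      \<comment> \<open>An edge occupies an initial segment of the columns, so it has a vertex in
        the smaller column of a'; by monotonicity its row is at most 1, hence it is a'.\<close>
      obtain w where w: "w \<in> e" "col w = col a'"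
        using edge[OF e, of "col a'"] col[of a'] col_le[OF e True] hyps(4) by auto
      then have "row w = 1"
        using edge_mono[OF e w(1) True] row(1)[of w] hyps by simp
      then have "w = a'"
        using row_col w(2) hyps(3) by simp
      then show ?thesis
        using w(1) by blast
    next
      case False
      then show ?thesis
        using hyps(1) e unfolding vertex_cover_def by blast
    qed
  qed
  have raise: "vertex_cover E {a, b, c'}"
    if hyps: "vertex_cover E {a, b, c}" "row c = 3" "row c' = 3" "col c \<le> col c'" for a b c c'
    unfolding vertex_cover_def
  proof
    fix e assume e: "e \<in> E"
    show "{a, b, c'} \<inter> e \<noteq> {}"
    proof (cases "c \<in> e")
      case True
      \<comment> \<open>For a larger column the edge must reach that far. Uniformity ensures this:
        it has as many vertices as \<open>f 3\<close>, which contains c'.\<close>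
      have "c' \<in> f 3"
        using row(2)[of c'] hyps(3) by simp
      then have "col c' \<le> card e"
        using col_le[OF fE[of 3], of c'] assms(2) e fE[of 3] unfolding uniform_def by (metis atLeastAtMost_iff numeral_le_iff one_le_numeral order_refl semiring_norm(73))
      then obtain w where w: "w \<in> e" "col w = col c'"
        using edge[OF e, of "col c'"] col[of c'] by auto
      then have "row w = 3"
        using edge_mono[OF e True w(1)] row(1)[of w] hyps by simp
      then have "w = c'"
        using row_col w(2) hyps(3) by simp
      then show ?thesis
        using w(1) by blast
    next
      case False
      then show ?thesis
        using hyps(1) e unfolding vertex_cover_def by blast
    qed
  qed
  define vcol where "vcol = (\<lambda>i C. col (THE v. v \<in> C \<and> row v = i))"
  \<comment> \<open>The subtraction reverses the order of columns in the third row; it is faithful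
    because columns are at most d.\<close>
  define key where "key = (\<lambda>C. (vcol 2 C, vcol 1 C, d - vcol 3 C))"
  have key: "key {a, b, c} = (col b, col a, d - col c)" if "row a = 1" "row b = 2" "row c = 3" for a b c
  proof -
    have "(THE v. v \<in> {a, b, c} \<and> row v = 1) = a" "(THE v. v \<in> {a, b, c} \<and> row v = 2) = b"
      "(THE v. v \<in> {a, b, c} \<and> row v = 3) = c"
      using that by (auto intro!: the_equality)
    then show ?thesis
      by (simp add: key_def vcol_def)
  qed
  have exch: "\<exists>D\<in>{C. minimal_vertex_cover E C}. key D < key C \<and> (\<exists>v. D - C = {v} \<and> v \<in> C')"
    if hyps: "minimal_vertex_cover E C" "minimal_vertex_cover E C'" "C \<noteq> C'" "key C' \<le> key C" for C C'
  proof -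
    obtain a b c where C: "C = {a, b, c}" "row a = 1" "row b = 2" "row c = 3"
      using triple[OF hyps(1)] by blast
    obtain a' b' c' where C': "C' = {a', b', c'}" "row a' = 1" "row b' = 2" "row c' = 3"
      using triple[OF hyps(2)] by blast
    have cov: "vertex_cover E {a, b, c}" "vertex_cover E {a', b', c'}"
      using hyps(1,2) C(1) C'(1) by (auto simp: minimal_vertex_cover_def)
    have le: "col b' < col b \<or> (col b' = col b \<and> (col a' < col a \<or> (col a' = col a \<and> d - col c' \<le> d - col c)))"
      using hyps(4) by (auto simp: key C C')
    have d: "col c \<le> d" "col c' \<le> d"
      using col[of c] col[of c'] by auto
    \<comment> \<open>If neither outer vertex of C can be exchanged for that of C', the middle ones
      must differ: with b = b' the inequality of keys would force C = C'.\<close>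
    consider "col a' < col a" | "col c < col c'" | "col a \<le> col a'" "col c' \<le> col c" "b \<noteq> b'"
    proof -
      have "a = a' \<and> b = b' \<and> c = c'" if "col a \<le> col a'" "col c' \<le> col c" "b = b'"
        using le that d C C' by (auto intro!: row_col)
      then show ?thesis
        using that hyps(3) C(1) C'(1) by (metis not_le)
    qed
    then show ?thesis
    proof cases
      case 1
      have "{a', b, c} - C = {a'}"
        using 1 C C' by auto
      moreover have "key {a', b, c} < key C"
        using 1 C C' by (simp add: key)
      moreover have "minimal_vertex_cover E {a', b, c}"
        using 1 by (intro min_cover lower[OF cov(1) C(2) C'(2)]) simp
      ultimately show ?thesis
        using C'(1) by blast
    next
      case 2
      have "{a, b, c'} - C = {c'}"
        using 2 C C' by auto
      moreover have "key {a, b, c'} < key C"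
        using 2 d C C' by (simp add: key)
      moreover have "minimal_vertex_cover E {a, b, c'}"
        using 2 by (intro min_cover raise[OF cov(1) C(4) C'(4)]) simp
      ultimately show ?thesis
        using C'(1) by blast
    next
      case 3
      \<comment> \<open>With \<open>le\<close> this gives col b' < col b, so the first component of
        the key decreases. That {a, b', c} is a cover comes from C', whose a' is lowered to a and
        whose c' is raised to c.\<close>
      have "col b' \<noteq> col b"
        using 3(3) row_col[of b' b] C(3) C'(3) by auto
      have "{a, b', c} - C = {b'}"
        using 3 C C' by auto
      moreover have "key {a, b', c} < key C"
        using \<open>col b' \<noteq> col b\<close> le C C' by (simp add: key)
      moreover have "minimal_vertex_cover E {a, b', c}"
        by (intro min_cover raise[OF lower[OF cov(2) C'(2) C(2) 3(1)] C'(4) C(4) 3(2)])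
      ultimately show ?thesis
        using C'(1) by blast
    qed
  qed
  obtain Cs where Cs: "set Cs = {C. minimal_vertex_cover E C}" "distinct Cs" "sorted (map key Cs)"
    by (rule sort_key_set_list[of "{C. minimal_vertex_cover E C}" key]) simp
  have shell: "shelling Cs"
    by (rule shelling_of_key[OF Cs(2,3)]) (use exch Cs(1) in auto)
  have "linear_quotients (alexander_dual E :: ('v, 'k) mpoly set)"
  proof -
    have "alexander_dual E = (Idl\<^bsub>mpoly_ring\<^esub> {\<Prod>v\<in>C. Var v | C. C \<in> set Cs} :: ('v, 'k) mpoly set)"
      by (simp add: alexander_dual_def Cs(1))
    then show ?thesis
      using linear_quotients_of_shelling[OF Cs(2) shell, of 3] card Cs(1) by simp
  qed
  moreover have "CM_clutter TYPE('k) E"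
  proof -
    have "Cs \<noteq> []"
      using C0 Cs(1) by auto
    \<comment> \<open>The rows serve as the common map \<rho>: each minimal cover has exactly one
      vertex in every row.\<close>
    moreover have "\<exists>t. (\<forall>v. row (t (row v)) = row v) \<and> C = t ` range row" if "C \<in> set Cs" for C
    proof (intro exI[of _ "inv_into C row"] conjI allI)
      have bij: "bij_betw row C {1..3}"
        using row_bij that Cs(1) by simp
      have "row ` C \<subseteq> range row" "range row \<subseteq> {1..3}"
        using row(1) by blast+
      then have "range row = {1..3}"
        using bij by (simp add: bij_betw_def)
      then show "C = inv_into C row ` range row"
        using bij_betw_inv_into[OF bij] by (simp add: bij_betw_def)
      show "row (inv_into C row (row v)) = row v" for v
        using bij row(1)[of v] by (intro f_inv_into_f) (simp add: bij_betw_def)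
    qed
    ultimately have "CM_ring (type_ring Quot (cover_ideal (set Cs) :: ('v, 'k) mpoly set))"
      by (intro CM_ring_cover_ideal[OF shell])
    then show ?thesis
      by (simp add: CM_clutter_def mpoly_ring_eq_type_ring edge_ideal_eq_cover_ideal Cs(1))
  qed
  ultimately show ?thesis ..
qed

end
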